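(* Let $\mathbb{K}$ be a field of characteristic $0$, let $q\in\mathbb{K}^*$ be not a root of unity, and let $\alpha,\beta\in\mathbb{K}$ with $\alpha\neq 0$ and $\beta\neq 0$. Then: (1) every $\mathbb{K}$-derivation of $B_{\alpha,\beta}$ is inner, and $\mathrm{HH}^1(B_{\alpha,\beta})=0$; (2) $\dim_{\mathbb{K}}\mathrm{HH}^1(B_{\alpha,0})=\dim_{\mathbb{K}}\mathrm{HH}^1(B_{0,\beta})=1$.
   Context: Let $B=U_q^+(\mathfrak{so}_5)$ be the positive part of the quantized enveloping algebra of $\mathfrak{so}_5$, i.e. the $\mathbb{K}$-algebra generated by $E_1,E_4$ subject to the quantum Serre relations $E_1^2E_4-(q^2+q^{-2})E_1E_4E_1+E_4E_1^2=0$ and $E_4^3E_1-(q^2+1+q^{-2})E_4^2E_1E_4+(q^2+1+q^{-2})E_4E_1E_4^2-E_1E_4^3=0$. Put $E_2:=E_1E_4-q^{-2}E_4E_1$ and $E_3:=\frac{1}{q+q^{-1}}(E_2E_4-E_4E_2)$. Equivalently, $B$ is the $\mathbb{K}$-algebra generated by $E_1,E_2,E_3,E_4$ subject to $E_2E_1=q^{-2}E_1E_2$, $E_4E_1=q^2E_1E_4-q^2E_2$, $E_3E_1=E_1E_3+\frac{q-q^3}{1+q^2}E_2^2$, $E_4E_2=E_2E_4-(q+q^{-1})E_3$, $E_3E_2=q^{-2}E_2E_3$, $E_4E_3=q^{-2}E_3E_4$, and the monomials $E_1^{i_1}E_2^{i_2}E_3^{i_3}E_4^{i_4}$ ($i_k\in\mathbb{Z}_{\ge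 0}$) form a $\mathbb{K}$-basis of $B$. The center of $B$ is the polynomial algebra $\mathbb{K}[\chi_1,\chi_2]$, where $\chi_1:=E_1E_3+p_4E_2^2$ with $p_4=\frac{-q^5}{(1+q^2)^2}$, and $\chi_2:=E_2E_4+p_3E_3$ with $p_3=\frac{-(q^3+q)}{q^2-1}$. For $(\alpha,\beta)\in\mathbb{K}^2\setminus\{(0,0)\}$, set $B_{\alpha,\beta}:=B/\langle\chi_1-\alpha,\chi_2-\beta\rangle$ (quotient by the two-sided ideal). For $x\in B_{\alpha,\beta}$, $\mathrm{ad}_x(y)=xy-yx$; $\mathrm{Der}(B_{\alpha,\beta})$ is the space of $\mathbb{K}$-derivations of $B_{\alpha,\beta}$, $\mathrm{InnDer}(B_{\alpha,\beta})=\{\mathrm{ad}_x\mid x\in B_{\alpha,\beta}\}$ is the space of inner derivations, and $\mathrm{HH}^1(B_{\alpha,\beta}):=\mathrm{Der}(B_{\alpha,\beta})/\mathrm{InnDer}(B_{\alpha,\beta})$. *)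

theory Defs
  imports
    "HOL-Library.Poly_Mapping"
    "HOL-Algebra.QuotRing"
    "Jordan_Normal_Form.VS_Connect"
begin

text \<open>The ground field is a type \<open>'k\<close> of class \<^class>\<open>field\<close>, viewed as a ring record
  by \<^term>\<open>class_ring\<close>.  A \<open>'k\<close>-algebra is a record of type \<open>('k, 'a) module\<close>; its ring fields
  carry the (noncommutative) multiplication, so that ideals and quotients are
  those of \<open>HOL-Algebra\<close>, where \<^const>\<open>ideal\<close> and \<^const>\<open>genideal\<close> are two-sided.\<close>


section \<open>Free algebras\<close>

datatype 'g free_monoid = Word "'g list"

instantiation free_monoid :: (type) monoid_add
begin

definition zero_free_monoid :: "'g free_monoid" where
  "zero_free_monoid = Word []"

fun plus_free_monoid :: "'g free_monoid \<Rightarrow> 'g free_monoid \<Rightarrow> 'g free_monoid" where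
  "plus_free_monoid (Word u) (Word v) = Word (u @ v)"

instance
proof
  fix a b c :: "'g free_monoid"
  show "a + b + c = a + (b + c)" by (cases a; cases b; cases c) simp
  show "0 + a = a" by (cases a) (simp add: zero_free_monoid_def)
  show "a + 0 = a" by (cases a) (simp add: zero_free_monoid_def)
qed

end

text \<open>The library's product on \<^type>\<open>poly_mapping\<close> is convolution along the monoid of exponents,
  so over the free monoid it is the product of noncommutative polynomials.\<close>

type_synonym ('g, 'k) nc_poly = "'g free_monoid \<Rightarrow>\<^sub>0 'k"

definition free_algebra :: "('k::field, ('g, 'k) nc_poly) module" where
  "free_algebra = \<lparr>carrier = UNIV, mult = (*), one = 1, zero = 0, add = (+),
     smult = (\<lambda>c. Poly_Mapping.map ((*) c))\<rparr>"

definition nc_var :: "'g \<Rightarrow> ('g, 'k::field) nc_poly" where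
  "nc_var g = Poly_Mapping.single (Word [g]) 1"


section \<open>Quotients\<close>

text \<open>\<^const>\<open>FactRing\<close> together with the induced scalar multiplication \<open>c (I + x) = I + c x\<close>.
  It is used both for algebras modulo ideals and for vector spaces modulo subspaces.\<close>

definition quot :: "('k, 'a) module \<Rightarrow> 'a set \<Rightarrow> ('k, 'a set) module" where
  "quot A I = ring.extend (A Quot I)
     (module.fields (\<lambda>c X. \<Union>x\<in>X. I +>\<^bsub>A\<^esub> (c \<odot>\<^bsub>A\<^esub> x)))"


section \<open>Derivations and the first Hochschild cohomology\<close>

text \<open>Maps on the carrier are taken \<^const>\<open>extensional\<close>, so that equal derivations
  are equal as HOL functions.\<close>

definition Der :: "('k::field, 'a) module \<Rightarrow> ('a \<Rightarrow> 'a) set" where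
  "Der A = {D \<in> LinearCombinations.module_hom class_ring A A \<inter> extensional (carrier A).
     \<forall>x\<in>carrier A. \<forall>y\<in>carrier A. D (x \<otimes>\<^bsub>A\<^esub> y) = D x \<otimes>\<^bsub>A\<^esub> y \<oplus>\<^bsub>A\<^esub> x \<otimes>\<^bsub>A\<^esub> D y}"

definition ad :: "('k, 'a) module \<Rightarrow> 'a \<Rightarrow> 'a \<Rightarrow> 'a" where
  "ad A x = (\<lambda>y\<in>carrier A. x \<otimes>\<^bsub>A\<^esub> y \<ominus>\<^bsub>A\<^esub> y \<otimes>\<^bsub>A\<^esub> x)"

definition InnDer :: "('k, 'a) module \<Rightarrow> ('a \<Rightarrow> 'a) set" where
  "InnDer A = ad A ` carrier A"

text \<open>Only the vector space structure is meant here; as in \<^const>\<open>ring.func_space\<close>,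
  the ring fields required by the record type are filled with the zero map.\<close>

definition Der_space :: "('k::field, 'a) module \<Rightarrow> ('k, 'a \<Rightarrow> 'a) module" where
  "Der_space A = \<lparr>carrier = Der A,
     mult = (\<lambda>D D'. \<lambda>x\<in>carrier A. \<zero>\<^bsub>A\<^esub>),
     one = (\<lambda>x\<in>carrier A. \<zero>\<^bsub>A\<^esub>),
     zero = (\<lambda>x\<in>carrier A. \<zero>\<^bsub>A\<^esub>),
     add = (\<lambda>D D'. \<lambda>x\<in>carrier A. D x \<oplus>\<^bsub>A\<^esub> D' x),
     smult = (\<lambda>c D. \<lambda>x\<in>carrier A. c \<odot>\<^bsub>A\<^esub> D x)\<rparr>"

definition HH1 :: "('k::field, 'a) module \<Rightarrow> ('k, ('a \<Rightarrow> 'a) set) module" where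
  "HH1 A = quot (Der_space A) (InnDer A)"


section \<open>The positive part of the quantized enveloping algebra of so(5)\<close>

datatype gen = Gen1 | Gen4

text \<open>The left-hand sides of the two quantum Serre relations.\<close>

definition serre1 :: "'k::field \<Rightarrow> (gen, 'k) nc_poly" where
  "serre1 q = (let x = nc_var Gen1; y = nc_var Gen4 in
     x^2 * y - (q^2 + inverse q ^ 2) \<odot>\<^bsub>free_algebra\<^esub> (x * y * x) + y * x^2)"

definition serre2 :: "'k::field \<Rightarrow> (gen, 'k) nc_poly" where
  "serre2 q = (let x = nc_var Gen1; y = nc_var Gen4; c = q^2 + 1 + inverse q ^ 2 in
     y^3 * x - c \<odot>\<^bsub>free_algebra\<^esub> (y^2 * x * y) + c \<odot>\<^bsub>free_algebra\<^esub> (y * x * y^2) - x * y^3)"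

definition serre_ideal :: "'k::field \<Rightarrow> (gen, 'k) nc_poly set" where
  "serre_ideal q = Idl\<^bsub>free_algebra\<^esub> {serre1 q, serre2 q}"

definition Uq_plus :: "'k::field \<Rightarrow> ('k, (gen, 'k) nc_poly set) module" where
  "Uq_plus q = quot free_algebra (serre_ideal q)"

definition E1 :: "'k::field \<Rightarrow> (gen, 'k) nc_poly set" where
  "E1 q = serre_ideal q +>\<^bsub>free_algebra\<^esub> nc_var Gen1"

definition E4 :: "'k::field \<Rightarrow> (gen, 'k) nc_poly set" where
  "E4 q = serre_ideal q +>\<^bsub>free_algebra\<^esub> nc_var Gen4"

definition E2 :: "'k::field \<Rightarrow> (gen, 'k) nc_poly set" where
  "E2 q = E1 q \<otimes>\<^bsub>Uq_plus q\<^esub> E4 q \<ominus>\<^bsub>Uq_plus q\<^esub> (inverse q ^ 2) \<odot>\<^bsub>Uq_plus q\<^esub> (E4 q \<otimes>\<^bsub>Uq_plus q\<^esub> E1 q)"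

definition E3 :: "'k::field \<Rightarrow> (gen, 'k) nc_poly set" where
  "E3 q = (1 / (q + inverse q)) \<odot>\<^bsub>Uq_plus q\<^esub>
     (E2 q \<otimes>\<^bsub>Uq_plus q\<^esub> E4 q \<ominus>\<^bsub>Uq_plus q\<^esub> E4 q \<otimes>\<^bsub>Uq_plus q\<^esub> E2 q)"

definition p3 :: "'k::field \<Rightarrow> 'k" where
  "p3 q = - (q^3 + q) / (q^2 - 1)"

definition p4 :: "'k::field \<Rightarrow> 'k" where
  "p4 q = - (q^5) / (1 + q^2)^2"

definition chi1 :: "'k::field \<Rightarrow> (gen, 'k) nc_poly set" where
  "chi1 q = E1 q \<otimes>\<^bsub>Uq_plus q\<^esub> E3 q \<oplus>\<^bsub>Uq_plus q\<^esub> p4 q \<odot>\<^bsub>Uq_plus q\<^esub> (E2 q \<otimes>\<^bsub>Uq_plus q\<^esub> E2 q)"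

definition chi2 :: "'k::field \<Rightarrow> (gen, 'k) nc_poly set" where
  "chi2 q = E2 q \<otimes>\<^bsub>Uq_plus q\<^esub> E4 q \<oplus>\<^bsub>Uq_plus q\<^esub> p3 q \<odot>\<^bsub>Uq_plus q\<^esub> E3 q"

definition B_quot :: "'k::field \<Rightarrow> 'k \<Rightarrow> 'k \<Rightarrow> ('k, (gen, 'k) nc_poly set set) module" where
  "B_quot q \<alpha> \<beta> = quot (Uq_plus q)
     (Idl\<^bsub>Uq_plus q\<^esub> {chi1 q \<ominus>\<^bsub>Uq_plus q\<^esub> \<alpha> \<odot>\<^bsub>Uq_plus q\<^esub> \<one>\<^bsub>Uq_plus q\<^esub>, chi2 q \<ominus>\<^bsub>Uq_plus q\<^esub> \<beta> \<odot>\<^bsub>Uq_plus q\<^esub> \<one>\<^bsub>Uq_plus q\<^esub>})"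

end

theory Submission
  imports Defs
begin

text \<open>
  Let \<open>x\<close> and \<open>y\<close> be the classes of \<open>E\<^sub>2\<close> and \<open>E\<^sub>3\<close> in \<open>B\<^bsub>\<alpha>,\<beta>\<^esub>\<close>. The two central relations read
  \<open>E\<^sub>1 y = \<alpha> - p\<^sub>4 x\<^sup>2\<close> and \<open>x E\<^sub>4 = \<beta> - p\<^sub>3 y\<close>, so that once \<open>x\<close> and \<open>y\<close> are inverted the algebra becomes
  the quantum torus \<open>y x = q\<^sup>-\<^sup>2 x y\<close>, with \<open>E\<^sub>1 = (\<alpha> - p\<^sub>4 x\<^sup>2) y\<^sup>-\<^sup>1\<close> and
  \<open>E\<^sub>4 = x\<^sup>-\<^sup>1 (\<beta> - p\<^sub>3 y)\<close>. The proof takes place inside this torus.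

  \<^emph>\<open>The algebra embeds.\<close> Modulo the relations every element is a combination of monomials from four
  cones, \<open>E\<^sub>1\<^sup>i E\<^sub>2\<^sup>j\<close>, \<open>E\<^sub>2\<^sup>j E\<^sub>3\<^sup>k\<close>, \<open>E\<^sub>3\<^sup>k E\<^sub>4\<^sup>l\<close> and \<open>E\<^sub>1\<^sup>i E\<^sub>4\<^sup>l\<close>: neighbours
  in the cyclic order \<open>E\<^sub>1, E\<^sub>2, E\<^sub>3, E\<^sub>4\<close> commute up to scalars and simpler terms, and the products
  \<open>E\<^sub>1 E\<^sub>3\<close> and \<open>E\<^sub>2 E\<^sub>4\<close> can be eliminated (\<open>W_closed\<close>). If
  \<open>(\<alpha>, \<beta>) \<noteq> (0, 0)\<close>, the images of these monomials in the torus have pairwise distinct leading terms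
  for a suitable order (\<open>Mon_independent\<close>). Hence \<open>B\<^bsub>\<alpha>,\<beta>\<^esub>\<close> is isomorphic to the subalgebra \<open>S\<close>
  of the torus generated by \<open>E\<^sub>1, x, y, E\<^sub>4\<close> (\<open>torus_algebra_B\<close>).

  \<^emph>\<open>Derivations of the subalgebra.\<close> A derivation \<open>D\<close> of \<open>S\<close> is determined by \<open>D x\<close> and \<open>D y\<close>. Comparing
  coefficients in \<open>D (y x) = q\<^sup>-\<^sup>2 D (x y)\<close> shows that \<open>D = [t, -] + \<delta>\<^bsub>c,d\<^esub>\<close> for an element \<open>t\<close> of
  the torus and the diagonal derivation \<open>\<delta>\<^bsub>c,d\<^esub>\<close> with \<open>x \<mapsto> c x\<close>, \<open>y \<mapsto> d y\<close>; here \<open>q\<close> must not be a root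
  of unity. Two questions remain.

  Why is \<open>t\<close> in \<open>S\<close>? The algebra \<open>S\<close> is the intersection of two localizations (\<open>S1_flip_S1\<close>): in
  the first, an element has in \<open>y\<close>-degree \<open>-i \<le> 0\<close> a component that is a Laurent polynomial in \<open>x\<close>
  times \<open>E\<^sub>1\<^sup>i\<close>; the second is the same with the roles of \<open>x, E\<^sub>1\<close> and \<open>y, E\<^sub>4\<close> exchanged. In
  \<open>y\<close>-degree \<open>n\<close> the commutator with \<open>x\<close> is the multiplication by \<open>(q\<^bsup>-2n\<^esup> - 1) x\<close>, so that
  \<open>[t, x] \<in> S\<close> puts \<open>t\<close> into the first localization (\<open>commutator_x_S1\<close>), and \<open>[t, y] \<in> S\<close> puts it
  into the second.

  When does \<open>\<delta>\<^bsub>c,d\<^esub>\<close> preserve \<open>S\<close>? It does exactly if \<open>c = 0 \<or> \<alpha> = 0\<close> and \<open>d = 0 \<or> \<beta> = 0\<close>, because the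
  binomial \<open>\<alpha> - p\<^sub>4 x\<^sup>2\<close> is an eigenvector of \<open>\<delta>\<^bsub>c,d\<^esub>\<close> only then, and likewise for \<open>\<beta> - p\<^sub>3 y\<close>
  (\<open>euler_S\<close>, \<open>euler_e1_S1\<close>). Since \<open>c\<close> and \<open>d\<close> are the coefficients of \<open>x\<close> in \<open>D x\<close> and of \<open>y\<close> in
  \<open>D y\<close>, which vanish for inner derivations, the cohomology is \<open>0\<close> if \<open>\<alpha> \<beta> \<noteq> 0\<close> and is spanned
  by the class of a single \<open>\<delta>\<^bsub>c,d\<^esub>\<close> if exactly one of \<open>\<alpha>, \<beta>\<close> vanishes.

  All arguments about the torus are made for \<open>E\<^sub>1 = (\<alpha> + \<gamma> x\<^sup>r) y\<^sup>-\<^sup>1\<close> and \<open>E\<^sub>4 = x\<^sup>-\<^sup>1 (\<beta> + \<delta> y\<^sup>s)\<close>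
  with arbitrary exponents \<open>r, s > 0\<close>. The reason is symmetry: exchanging \<open>x\<close> and \<open>y\<close> is an
  anti-automorphism of the torus which exchanges \<open>(r, \<alpha>, \<gamma>)\<close> and \<open>(s, \<beta>, \<delta>)\<close>, and it halves the work.
\<close>

section \<open>The quantum torus\<close>

abbreviation "lookup \<equiv> Poly_Mapping.lookup"
abbreviation "keys \<equiv> Poly_Mapping.keys"
abbreviation "single \<equiv> Poly_Mapping.single"

type_synonym 'k torus = "(int \<times> int) \<Rightarrow>\<^sub>0 'k"

definition scl :: "'k::field \<Rightarrow> ('a \<Rightarrow>\<^sub>0 'k) \<Rightarrow> ('a \<Rightarrow>\<^sub>0 'k)" where
  "scl c = Poly_Mapping.map ((*) c)"

lemma lookup_scl [simp]: "lookup (scl c f) a = c * lookup f a"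
  by (simp add: scl_def Poly_Mapping.map.rep_eq when_def in_keys_iff)

lemma scl_simps [simp]:
  "scl c (f + g) = scl c f + scl c g" "scl c (f - g) = scl c f - scl c g"
  "scl c (- f) = - scl c f" "scl c 0 = 0" "scl 0 f = 0" "scl 1 f = f"
  "scl c (scl d f) = scl (c * d) f" "scl c (single a d) = single a (c * d)"
  by (auto intro!: poly_mapping_eqI
      simp: lookup_add lookup_minus lookup_single when_def algebra_simps)

lemma scl_add_left: "scl (c + d) f = scl c f + scl d f"
  by (auto intro!: poly_mapping_eqI simp: lookup_add algebra_simps)

lemma scl_diff_left: "scl (c - d) f = scl c f - scl d f"
  by (auto intro!: poly_mapping_eqI simp: lookup_minus left_diff_distrib)

lemma scl_minus_left: "scl (- c) f = - scl c f"
  by (auto intro!: poly_mapping_eqI)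

lemma scl_sum: "scl c (sum g A) = (\<Sum>a\<in>A. scl c (g a))"
  by (auto intro!: poly_mapping_eqI simp: lookup_sum sum_distrib_left)

lemma poly_mapping_add_induct [case_names zero add]:
  assumes "P 0" and "\<And>a c f. P f \<Longrightarrow> P (single a c + f)"
  shows "P f"
proof (induction f rule: update_induct)
  case const
  then show ?case using assms(1) by simp
next
  case (update f a c)
  have "Poly_Mapping.update a c f = single a c + f"
    using update by (intro poly_mapping_eqI)
      (auto simp: lookup_update lookup_add lookup_single in_keys_iff when_def)
  then show ?case using assms(2) update by simp
qed

lemma poly_mapping_sum_single: "f = (\<Sum>a\<in>keys f. single a (lookup f a))"
  by (intro poly_mapping_eqI) (auto simp: lookup_sum lookup_single when_def in_keys_iff)

locale quantum_torus =
  fixes p :: "'k::field"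
  assumes p_nonzero: "p \<noteq> 0"
begin

text \<open>
  The position \<open>(m, n)\<close> stands for \<open>x\<^sup>m y\<^sup>n\<close> with \<open>y x = p x y\<close>. Moving \<open>y\<^sup>n\<close> past a later \<open>x\<^sup>m\<close>
  costs \<open>p\<^bsup>n m\<^esup>\<close>.
\<close>

definition tmul :: "'k torus \<Rightarrow> 'k torus \<Rightarrow> 'k torus" (infixl \<open>\<star>\<close> 70) where
  "f \<star> g = (\<Sum>a\<in>keys f. \<Sum>b\<in>keys g. single (fst a + fst b, snd a + snd b)
     (lookup f a * lookup g b * p powi (snd a * fst b)))"

abbreviation mono :: "int \<Rightarrow> int \<Rightarrow> 'k torus" where
  "mono m n \<equiv> single (m, n) 1"

text \<open>Summing over larger index sets that do not depend on the factors makes the product visibly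
  bilinear.\<close>

lemma tmul_superset:
  assumes "finite A" "finite B" "keys f \<subseteq> A" "keys g \<subseteq> B"
  shows "f \<star> g = (\<Sum>a\<in>A. \<Sum>b\<in>B. single (fst a + fst b, snd a + snd b)
     (lookup f a * lookup g b * p powi (snd a * fst b)))"
proof -
  have "f \<star> g = (\<Sum>a\<in>keys f. \<Sum>b\<in>B. single (fst a + fst b, snd a + snd b)
     (lookup f a * lookup g b * p powi (snd a * fst b)))"
    unfolding tmul_def using assms
    by (intro sum.cong refl sum.mono_neutral_left) (auto simp: in_keys_iff)
  also have "\<dots> = (\<Sum>a\<in>A. \<Sum>b\<in>B. single (fst a + fst b, snd a + snd b)
     (lookup f a * lookup g b * p powi (snd a * fst b)))"
    using assms by (intro sum.mono_neutral_left) (auto simp: in_keys_iff)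
  finally show ?thesis .
qed

lemma tmul_add_left: "(f + f') \<star> g = f \<star> g + f' \<star> g"
proof -
  let ?A = "keys f \<union> keys f'"
  have "keys (f + f') \<subseteq> ?A" by (rule keys_add)
  then show ?thesis
    by (simp add: tmul_superset[of ?A "keys g"] lookup_add distrib_right single_add sum.distrib)
qed

lemma tmul_add_right: "g \<star> (f + f') = g \<star> f + g \<star> f'"
proof -
  let ?A = "keys f \<union> keys f'"
  have "keys (f + f') \<subseteq> ?A" by (rule keys_add)
  then show ?thesis
    by (simp add: tmul_superset[of "keys g" ?A] lookup_add distrib_right distrib_left single_add sum.distrib)
qed

lemma tmul_zero [simp]: "0 \<star> f = 0" "f \<star> 0 = 0"
  by (simp_all add: tmul_def)

lemma tmul_single [simp]:
  "single (m, n) c \<star> single (m', n') d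
    = single (m + m', n + n') (c * d * p powi (n * m'))"
  by (simp add: tmul_superset[of "{(m, n)}" "{(m', n')}"])

lemma tmul_scl_left: "scl c f \<star> g = scl c (f \<star> g)"
proof -
  have "keys (scl c f) \<subseteq> keys f" by (auto simp: in_keys_iff)
  then show ?thesis
    by (simp add: tmul_superset[of "keys f" "keys g"] scl_sum mult.assoc)
qed

lemma tmul_scl_right: "f \<star> scl c g = scl c (f \<star> g)"
proof -
  have "keys (scl c g) \<subseteq> keys g" by (auto simp: in_keys_iff)
  then show ?thesis
    by (simp add: tmul_superset[of "keys f" "keys g"] scl_sum mult_ac)
qed

lemma tmul_assoc: "(f \<star> g) \<star> h = f \<star> (g \<star> h)"
proof (induction f rule: poly_mapping_add_induct)
  case (add a c f)
  obtain a1 a2 where a: "a = (a1, a2)" by fastforce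
  have "(single a c \<star> g) \<star> h = single a c \<star> (g \<star> h)"
  proof (induction g rule: poly_mapping_add_induct)
    case (add b d g)
    obtain b1 b2 where b: "b = (b1, b2)" by fastforce
    have "(single a c \<star> single b d) \<star> h
        = single a c \<star> (single b d \<star> h)"
    proof (induction h rule: poly_mapping_add_induct)
      case (add e k h)
      obtain e1 e2 where e: "e = (e1, e2)" by fastforce
      show ?case using add p_nonzero
        by (simp add: tmul_add_right a b e algebra_simps power_int_add)
    qed simp
    with add show ?case by (simp add: tmul_add_left tmul_add_right)
  qed simp
  with add show ?case by (simp add: tmul_add_left tmul_add_right)
qed simp

lemma tmul_one_left [simp]: "mono 0 0 \<star> f = f"
  by (induction f rule: poly_mapping_add_induct) (auto simp: tmul_add_right)

lemma tmul_one_right [simp]: "f \<star> mono 0 0 = f"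
  by (induction f rule: poly_mapping_add_induct) (auto simp: tmul_add_left)

sublocale T: monoid_mult "mono 0 0" tmul
  by standard (simp_all add: tmul_assoc)

abbreviation tpow :: "'k torus \<Rightarrow> nat \<Rightarrow> 'k torus" (infixr \<open>\<up>\<close> 80) where
  "f \<up> n \<equiv> power.power (mono 0 0) tmul f n"

lemma tmul_minus_left: "- f \<star> g = - (f \<star> g)"
  using tmul_scl_left[of "-1" f g] by (simp add: scl_minus_left)

lemma tmul_minus_right: "f \<star> - g = - (f \<star> g)"
  using tmul_scl_right[of f "-1" g] by (simp add: scl_minus_left)

lemma tmul_diff_left: "(f - f') \<star> g = f \<star> g - f' \<star> g"
  using tmul_add_left[of f "- f'" g] by (simp add: tmul_minus_left)

lemma tmul_diff_right: "g \<star> (f - f') = g \<star> f - g \<star> f'"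
  using tmul_add_right[of g f "- f'"] by (simp add: tmul_minus_right)

lemmas tmul_simps = tmul_add_left tmul_add_right tmul_diff_left tmul_diff_right
  tmul_minus_left tmul_minus_right tmul_scl_left tmul_scl_right tmul_assoc

lemma tmul_mono_lookup:
  "lookup (f \<star> single (m', n') c) (m, n) = lookup f (m - m', n - n') * c * p powi ((n - n') * m')"
  by (induction f rule: poly_mapping_add_induct)
   (auto simp: tmul_add_left lookup_add lookup_single when_def algebra_simps split: if_splits)

lemma mono_tmul_lookup:
  "lookup (single (m', n') c \<star> f) (m, n) = c * lookup f (m - m', n - n') * p powi (n' * (m - m'))"
  by (induction f rule: poly_mapping_add_induct)
   (auto simp: tmul_add_right lookup_add lookup_single when_def algebra_simps split: if_splits)

end

section \<open>Gradings and the flip of the quantum torus\<close>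

definition restr :: "('a \<Rightarrow> bool) \<Rightarrow> ('a \<Rightarrow>\<^sub>0 'k::field) \<Rightarrow> ('a \<Rightarrow>\<^sub>0 'k)" where
  "restr P = Poly_Mapping.mapp (\<lambda>a c. if P a then c else 0)"

lemma lookup_restr [simp]: "lookup (restr P f) a = (if P a then lookup f a else 0)"
  by (simp add: restr_def lookup_mapp when_def in_keys_iff)

lemma restr_simps [simp]:
  "restr P (f + g) = restr P f + restr P g" "restr P (f - g) = restr P f - restr P g"
  "restr P (scl c f) = scl c (restr P f)" "restr P 0 = 0"
  "restr P (single a c) = (if P a then single a c else 0)"
  by (auto intro!: poly_mapping_eqI simp: lookup_add lookup_minus lookup_single when_def)

definition flip :: "'k::field torus \<Rightarrow> 'k torus" where
  "flip = Poly_Mapping.map_key prod.swap"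

lemma lookup_flip [simp]: "lookup (flip f) (m, n) = lookup f (n, m)"
  by (simp add: flip_def map_key.rep_eq)

lemma flip_simps [simp]:
  "flip (f + g) = flip f + flip g" "flip (f - g) = flip f - flip g"
  "flip (- f) = - flip f" "flip (scl c f) = scl c (flip f)" "flip 0 = 0"
  "flip (single (m, n) c) = single (n, m) c" "flip (flip f) = f"
  by (auto intro!: poly_mapping_eqI simp: lookup_add lookup_minus lookup_single when_def)

context quantum_torus
begin

text \<open>The relation \<open>y x = p x y\<close> survives if \<open>x\<close> and \<open>y\<close> are exchanged and products are reversed.\<close>

lemma flip_tmul: "flip (f \<star> g) = flip g \<star> flip f"
proof (induction f rule: poly_mapping_add_induct)
  case (add a c f)
  have "flip (single a c \<star> g) = flip g \<star> flip (single a c)"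
    by (induction g rule: poly_mapping_add_induct; cases a)
      (auto simp: tmul_simps mult.commute add.commute)
  with add show ?case by (simp add: tmul_simps)
qed simp

lemma flip_tpow: "flip (f \<up> n) = flip f \<up> n"
  by (induction n) (simp_all add: flip_tmul T.power_commutes)

definition row :: "int \<Rightarrow> 'k torus \<Rightarrow> 'k torus" where
  "row n = restr (\<lambda>a. snd a = n)"

definition col :: "int \<Rightarrow> 'k torus \<Rightarrow> 'k torus" where
  "col m = restr (\<lambda>a. fst a = m)"

definition in_row :: "int \<Rightarrow> 'k torus \<Rightarrow> bool" where
  "in_row n f \<longleftrightarrow> row n f = f"

lemma row_simps [simp]:
  "row n (f + g) = row n f + row n g" "row n (f - g) = row n f - row n g"
  "row n (scl c f) = scl c (row n f)" "row n 0 = 0"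
  "row n (single a c) = (if snd a = n then single a c else 0)"
  "lookup (row n f) a = (if snd a = n then lookup f a else 0)"
  by (simp_all add: row_def)

lemma col_simps [simp]:
  "col n (f + g) = col n f + col n g" "col n (f - g) = col n f - col n g"
  "col n (scl c f) = scl c (col n f)" "col n 0 = 0"
  "col n (single a c) = (if fst a = n then single a c else 0)"
  "lookup (col n f) a = (if fst a = n then lookup f a else 0)"
  by (simp_all add: col_def)

lemma flip_row: "flip (row n f) = col n (flip f)"
  by (auto intro!: poly_mapping_eqI)

lemma in_rowD: "in_row n f \<Longrightarrow> k \<noteq> n \<Longrightarrow> lookup f (m, k) = 0"
  unfolding in_row_def by (metis row_simps(6) snd_conv)

lemma row_row: "row n (row k f) = (if n = k then row k f else 0)"
  by (intro poly_mapping_eqI) auto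

lemma in_row_row [simp, intro]: "in_row n (row n f)"
  by (simp add: in_row_def row_row)

lemma in_row_simps [simp, intro]:
  "in_row n 0" "in_row n (single (m, n) c)"
  "in_row n f \<Longrightarrow> in_row n g \<Longrightarrow> in_row n (f + g)"
  "in_row n f \<Longrightarrow> in_row n g \<Longrightarrow> in_row n (f - g)"
  "in_row n f \<Longrightarrow> in_row n (scl c f)"
  by (simp_all add: in_row_def)

lemma row_tmul_single: "row n (f \<star> single (m, k) c) = row (n - k) f \<star> single (m, k) c"
  by (intro poly_mapping_eqI, clarify) (auto simp: tmul_mono_lookup)

lemma row_tmul:
  assumes "in_row k f"
  shows "row n (f \<star> g) = f \<star> row (n - k) g"
proof (induction g rule: poly_mapping_add_induct)
  case (add a c g)
  obtain u v where a: "a = (u, v)" by fastforce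
  have "row (n - v) f = (if n - v = k then f else 0)"
    using assms row_row[of "n - v" k f] by (simp add: in_row_def)
  with add show ?case
    by (simp add: tmul_simps a row_tmul_single)
qed simp

lemma in_row_tmul: "in_row k f \<Longrightarrow> in_row l g \<Longrightarrow> in_row (k + l) (f \<star> g)"
  using row_tmul[of k f "k + l" g] by (simp add: in_row_def)

lemma in_row_induct [consumes 1, case_names zero add]:
  assumes "in_row n f" "P 0" "\<And>m c f. in_row n f \<Longrightarrow> P f \<Longrightarrow> P (single (m, n) c + f)"
  shows "P f"
proof -
  have "P (row n f)"
  proof (induction f rule: poly_mapping_add_induct)
    case (add a c f)
    then show ?case using assms(3)[of "row n f" "fst a" c] by auto
  qed (simp add: assms(2))
  then show ?thesis using assms(1) by (simp add: in_row_def)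
qed

lemma in_row_single_tmul: "in_row n f \<Longrightarrow> l = k + n \<Longrightarrow> in_row l (single (m, k) c \<star> f)"
  using in_row_tmul[OF in_row_simps(2)] by simp

lemma sum_rows: "f = (\<Sum>n\<in>snd ` keys f. row n f)"
proof (intro poly_mapping_eqI)
  fix a show "lookup f a = lookup (\<Sum>n\<in>snd ` keys f. row n f) a"
    by (cases "a \<in> keys f") (auto simp: lookup_sum in_keys_iff)
qed

lemma row0_commute:
  assumes "in_row 0 f" "in_row 0 g"
  shows "f \<star> g = g \<star> f"
  using assms(1)
proof (induction rule: in_row_induct)
  case (add m c f)
  have "single (m, 0) c \<star> g = g \<star> single (m, 0) c"
    using assms(2) by (induction rule: in_row_induct) (simp_all add: tmul_simps ac_simps)
  with add show ?case by (simp add: tmul_simps)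
qed simp

lemma in_row_tmul_x: "in_row n f \<Longrightarrow> f \<star> mono 1 0 = scl (p powi n) (mono 1 0 \<star> f)"
  by (induction rule: in_row_induct) (simp_all add: tmul_simps ac_simps)

lemma in_row_tpow: "in_row n f \<Longrightarrow> in_row (int k * n) (f \<up> k)"
proof (induction k)
  case (Suc k)
  then show ?case using in_row_tmul[of n f "int k * n" "f \<up> k"]
    by (simp add: algebra_simps)
qed auto

lemma single_tpow_row0: "single (0, n) c \<up> k = single (0, int k * n) (c ^ k)"
  by (induction k) (simp_all add: algebra_simps)

lemma single_tpow_col0: "single (n, 0) c \<up> k = single (int k * n, 0) (c ^ k)"
  by (induction k) (simp_all add: algebra_simps)

text \<open>
  Positions are compared lexicographically: the leading one lies in the leftmost column, and within it
  in the highest row. The mixed directions are chosen because then the leading position of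
  \<open>x\<^sup>-\<^sup>1 (\<beta> + \<delta> y\<^sup>s)\<close> is \<open>(-1, s)\<close> whether or not \<open>\<beta> = 0\<close>, as \<open>\<delta> \<noteq> 0\<close>.
\<close>

definition has_lead :: "'k torus \<Rightarrow> int \<times> int \<Rightarrow> bool" where
  "has_lead f c \<longleftrightarrow> lookup f c \<noteq> 0 \<and>
     (\<forall>m n. lookup f (m, n) \<noteq> 0 \<longrightarrow> fst c < m \<or> fst c = m \<and> n \<le> snd c)"

lemma lookup_tmul: "lookup (f \<star> g) c = (\<Sum>a\<in>keys f. \<Sum>b\<in>keys g.
   if (fst a + fst b, snd a + snd b) = c then lookup f a * lookup g b * p powi (snd a * fst b) else 0)"
  unfolding tmul_def by (simp add: lookup_sum lookup_single when_def)

text \<open>The order is invariant under translation, so only the two leading terms contribute to the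
  product at the sum of their positions.\<close>

lemma has_lead_tmul:
  assumes "has_lead f (m, n)" "has_lead g (m', n')"
  shows "has_lead (f \<star> g) (m + m', n + n')"
proof -
  let ?t = "\<lambda>a b. lookup f a * lookup g b * p powi (snd a * fst b)"
  have f: "a = (m, n) \<or> m < fst a \<or> m = fst a \<and> snd a < n" if "a \<in> keys f" for a
    using assms(1) that unfolding has_lead_def in_keys_iff by (cases a) force
  have g: "b = (m', n') \<or> m' < fst b \<or> m' = fst b \<and> snd b < n'" if "b \<in> keys g" for b
    using assms(2) that unfolding has_lead_def in_keys_iff by (cases b) force
  have mem: "(m, n) \<in> keys f" "(m', n') \<in> keys g"
    using assms by (auto simp: has_lead_def in_keys_iff)
  have "lookup (f \<star> g) (m + m', n + n')
      = (\<Sum>a\<in>keys f. \<Sum>b\<in>keys g. if a = (m, n) then (if b = (m', n') then ?t a b else 0) else 0)"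
    unfolding lookup_tmul by (intro sum.cong refl) (use f g in fastforce)
  also have "\<dots> = ?t (m, n) (m', n')"
    using mem by (simp add: sum.delta' if_distrib[of "\<lambda>x. sum x _"] cong: if_cong)
      (subst sum.swap, simp add: sum.delta)?
  finally have 1: "lookup (f \<star> g) (m + m', n + n') \<noteq> 0"
    using assms p_nonzero by (simp add: has_lead_def)
  have 2: "m + m' < u \<or> m + m' = u \<and> v \<le> n + n'" if "lookup (f \<star> g) (u, v) \<noteq> 0" for u v
  proof -
    from that obtain a where a: "a \<in> keys f" and "(\<Sum>b\<in>keys g.
        if (fst a + fst b, snd a + snd b) = (u, v) then ?t a b else 0) \<noteq> 0"
      unfolding lookup_tmul by (rule sum.not_neutral_contains_not_neutral)
    from this(2) obtain b where "b \<in> keys g"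
        "(if (fst a + fst b, snd a + snd b) = (u, v) then ?t a b else 0) \<noteq> 0"
      by (rule sum.not_neutral_contains_not_neutral)
    then show ?thesis using f[of a] g[of b] a by (auto split: if_splits)
  qed
  show ?thesis using 1 2 by (simp add: has_lead_def)
qed

lemma has_lead_tpow: "has_lead f (m, n) \<Longrightarrow> has_lead (f \<up> k) (int k * m, int k * n)"
proof (induction k)
  case 0
  then show ?case by (auto simp: has_lead_def lookup_single when_def)
next
  case (Suc k)
  then show ?case using has_lead_tmul[of f m n "f \<up> k" "int k * m" "int k * n"]
    by (simp add: algebra_simps)
qed

text \<open>
  Among the summands with a nonzero coefficient, take the one whose leading position is foremost: none
  of the others has a term at that position.
\<close>

lemma lead_independent:
  assumes "finite F" and lead: "\<And>i. i \<in> F \<Longrightarrow> has_lead (g i) (l i)"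
    and "inj_on l F" and "(\<Sum>i\<in>F. scl (c i) (g i)) = 0" and "i \<in> F"
  shows "c i = 0"
proof (rule ccontr)
  assume "c i \<noteq> 0"
  define G where "G = {i \<in> F. c i \<noteq> 0}"
  have G: "finite G" "G \<noteq> {}" using assms \<open>c i \<noteq> 0\<close> by (auto simp: G_def)
  define m where "m = Min (fst ` l ` G)"
  define H where "H = {i \<in> G. fst (l i) = m}"
  have "m \<in> fst ` l ` G" unfolding m_def using G by (intro Min_in) auto
  then have H: "finite H" "H \<noteq> {}" using G by (auto simp: H_def)
  define n where "n = Max (snd ` l ` H)"
  have "n \<in> snd ` l ` H" unfolding n_def using H by (intro Max_in) auto
  then obtain j where j: "j \<in> H" "snd (l j) = n" by auto
  then have lj: "l j = (m, n)" "j \<in> F" "c j \<noteq> 0" by (auto simp: H_def G_def prod_eq_iff)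
  have "lookup (g k) (m, n) = 0" if "k \<in> G" "k \<noteq> j" for k
  proof (rule ccontr)
    assume nz: "lookup (g k) (m, n) \<noteq> 0"
    have "has_lead (g k) (l k)" using lead that by (auto simp: G_def)
    then have *: "fst (l k) < m \<or> fst (l k) = m \<and> n \<le> snd (l k)"
      using nz by (auto simp: has_lead_def)
    have "m \<le> fst (l k)" unfolding m_def using G that by simp
    with * have k: "fst (l k) = m" "n \<le> snd (l k)" by auto
    then have "k \<in> H" using that by (simp add: H_def)
    then have "snd (l k) \<le> n" unfolding n_def using H by simp
    then have "l k = l j" using k lj by (simp add: prod_eq_iff)
    then show False using assms(3) that lj by (auto simp: inj_on_def G_def)
  qed
  then have "lookup (\<Sum>i\<in>F. scl (c i) (g i)) (m, n) = (\<Sum>k\<in>F. if k = j then c j * lookup (g j) (m, n) else 0)"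
    unfolding lookup_sum by (intro sum.cong refl) (auto simp: G_def)
  also have "\<dots> = c j * lookup (g j) (m, n)" using assms(1) lj by simp
  finally show False using assms(4) lead[of j] lj by (simp add: has_lead_def)
qed

lemma exists_lead:
  assumes "f \<noteq> 0"
  shows "\<exists>c. has_lead f c"
proof -
  have ne: "keys f \<noteq> {}" using assms by simp
  define m where "m = Min (fst ` keys f)"
  have "m \<in> fst ` keys f" unfolding m_def using ne by (intro Min_in) auto
  then have H: "{a \<in> keys f. fst a = m} \<noteq> {}" by auto
  define n where "n = Max (snd ` {a \<in> keys f. fst a = m})"
  have "n \<in> snd ` {a \<in> keys f. fst a = m}" unfolding n_def using H by (intro Max_in) auto
  then have mem: "(m, n) \<in> keys f" by auto
  have "m < u \<or> m = u \<and> v \<le> n" if "(u, v) \<in> keys f" for u v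
  proof -
    have "m \<le> u" unfolding m_def using that by (intro Min_le) force+
    moreover have "v \<le> n" if "m = u"
      unfolding n_def using that \<open>(u, v) \<in> keys f\<close> by (intro Max_ge) force+
    ultimately show ?thesis by auto
  qed
  then have "has_lead f (m, n)"
    using mem unfolding has_lead_def by (auto simp: in_keys_iff)
  then show ?thesis ..
qed

lemma has_lead_single: "c \<noteq> 0 \<Longrightarrow> has_lead (single (m, n) c) (m, n)"
  by (auto simp: has_lead_def lookup_single when_def split: if_splits)

definition col_ge :: "int \<Rightarrow> 'k torus \<Rightarrow> bool" where
  "col_ge k f \<longleftrightarrow> (\<forall>m n. m < k \<longrightarrow> lookup f (m, n) = 0)"

lemma col_ge_simps [simp, intro]:
  "col_ge k 0" "col_ge k f \<Longrightarrow> col_ge k g \<Longrightarrow> col_ge k (f + g)"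
  "col_ge k f \<Longrightarrow> col_ge k g \<Longrightarrow> col_ge k (f - g)" "col_ge k f \<Longrightarrow> col_ge k (scl c f)"
  "k \<le> m \<Longrightarrow> col_ge k (single (m, n) c)"
  by (auto simp: col_ge_def lookup_add lookup_minus lookup_single when_def)

text \<open>The supports bounded on the left define a filtration, and in a product the extreme columns
  multiply.\<close>

lemma col_ge_tmul:
  assumes "col_ge a f" "col_ge b g"
  shows "col_ge (a + b) (f \<star> g)" "col (a + b) (f \<star> g) = col a f \<star> col b g"
proof -
  have ka: "a \<le> fst i" if "i \<in> keys f" for i
    using assms(1) that by (cases i) (force simp: col_ge_def in_keys_iff)
  have kb: "b \<le> fst i" if "i \<in> keys g" for i
    using assms(2) that by (cases i) (force simp: col_ge_def in_keys_iff)
  show "col_ge (a + b) (f \<star> g)"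
    unfolding col_ge_def lookup_tmul
    by (intro allI impI sum.neutral ballI) (use ka kb in force)
  have fin: "finite (keys f)" "finite (keys g)" by simp_all
  have sub: "keys (col a f) \<subseteq> keys f" "keys (col b g) \<subseteq> keys g"
    by (auto simp: in_keys_iff split: if_splits)
  show "col (a + b) (f \<star> g) = col a f \<star> col b g"
    unfolding tmul_superset[OF fin sub] unfolding tmul_def
    apply (intro poly_mapping_eqI)
    apply (simp add: lookup_sum lookup_single when_def sum.If_cases)
    apply (intro conjI impI sum.cong refl sum.neutral ballI)
    using ka kb
     apply force
    apply force
    done
qed

lemma exists_col_ge: "\<exists>N. col_ge (- int N) t"
proof (induction t rule: poly_mapping_add_induct)
  case (add a c f)
  then obtain N where N: "col_ge (- int N) f" by blast
  obtain m n where a: "a = (m, n)" by fastforce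
  have "col_ge (- int (N + nat (- m))) (single a c + f)"
    using N by (intro col_ge_simps(2)) (auto simp: a col_ge_def lookup_single when_def)
  then show ?case by blast
qed auto

end

section \<open>A rank two subalgebra of the quantum torus\<close>

text \<open>The generators are \<open>e1 = (\<alpha> + \<gamma> x\<^sup>r) y\<^sup>-\<^sup>1\<close> and
  \<open>e4 = x\<^sup>-\<^sup>1 (\<beta> + \<delta> y\<^sup>s)\<close>.\<close>

locale rank_two = quantum_torus p for p :: "'k::field_char_0" +
  fixes r s :: nat and \<alpha> \<gamma> \<beta> \<delta> :: 'k
  assumes generic: "k \<noteq> 0 \<Longrightarrow> p powi k \<noteq> 1"
    and rs_pos: "r > 0" "s > 0"
    and coeff_nonzero: "\<gamma> \<noteq> 0" "\<delta> \<noteq> 0"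
begin

abbreviation x :: "'k torus" where "x \<equiv> mono 1 0"
abbreviation y :: "'k torus" where "y \<equiv> mono 0 1"

definition e1 :: "'k torus" where
  "e1 = single (0, -1) \<alpha> + single (int r, -1) \<gamma>"

definition e4 :: "'k torus" where
  "e4 = single (-1, 0) \<beta> + single (-1, int s) \<delta>"

text \<open>Left multiplication by generators suffices to describe the generated subalgebra; closure under
  products follows. Including \<open>x\<close> and \<open>y\<close> among the generators keeps the description symmetric.\<close>

inductive_set S :: "'k torus set" where
  one: "mono 0 0 \<in> S"
| add: "a \<in> S \<Longrightarrow> b \<in> S \<Longrightarrow> a + b \<in> S"
| scl: "a \<in> S \<Longrightarrow> scl c a \<in> S"
| e1: "a \<in> S \<Longrightarrow> e1 \<star> a \<in> S"
| x: "a \<in> S \<Longrightarrow> x \<star> a \<in> S"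
| y: "a \<in> S \<Longrightarrow> y \<star> a \<in> S"
| e4: "a \<in> S \<Longrightarrow> e4 \<star> a \<in> S"

lemma S_tmul: "a \<in> S \<Longrightarrow> b \<in> S \<Longrightarrow> a \<star> b \<in> S"
  by (induction rule: S.induct) (auto simp: tmul_simps intro: S.intros)

lemma S_zero: "0 \<in> S"
  using S.scl[OF S.one, of 0] by simp

lemma S_uminus: "a \<in> S \<Longrightarrow> - a \<in> S"
  using S.scl[of a "-1"] by (simp add: scl_minus_left)

lemma S_diff: "a \<in> S \<Longrightarrow> b \<in> S \<Longrightarrow> a - b \<in> S"
  using S.add[of a "- b"] S_uminus by simp

lemma S_gens: "e1 \<in> S" "x \<in> S" "y \<in> S" "e4 \<in> S"
  using S.intros(4-7)[OF S.one] by simp_all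

lemma S_tpow: "a \<in> S \<Longrightarrow> a \<up> n \<in> S"
  by (induction n) (auto intro: S.one S_tmul)

lemma S_sum: "(\<And>i. i \<in> F \<Longrightarrow> g i \<in> S) \<Longrightarrow> sum g F \<in> S"
  by (induction F rule: infinite_finite_induct) (auto intro: S_zero S.add)

lemma S_mono: "m \<ge> 0 \<Longrightarrow> n \<ge> 0 \<Longrightarrow> single (m, n) c \<in> S"
proof -
  assume "m \<ge> 0" "n \<ge> 0"
  then have "single (m, n) c = scl c (x \<up> nat m \<star> y \<up> nat n)"
    by (simp add: single_tpow_row0 single_tpow_col0)
  then show ?thesis by (metis S.scl S_tmul S_tpow S_gens(2,3))
qed

text \<open>The flip exchanges the two pairs of parameters. Each result below that mentions only rows or
  only \<open>\<alpha>\<close> is also applied to this mirror image, where it speaks of columns or of \<open>\<beta>\<close>.\<close>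

lemma mirror: "rank_two p s r \<delta> \<gamma>"
  using generic rs_pos coeff_nonzero by unfold_locales auto

lemma flip_gens:
  "flip e1 = rank_two.e4 r \<alpha> \<gamma>" "flip e4 = rank_two.e1 s \<beta> \<delta>"
  using mirror by (simp_all add: e1_def e4_def rank_two.e1_def rank_two.e4_def)

lemma flip_S: "a \<in> S \<Longrightarrow> flip a \<in> rank_two.S p s r \<beta> \<delta> \<alpha> \<gamma>"
proof -
  interpret M: rank_two p s r \<beta> \<delta> \<alpha> \<gamma> by (simp add: mirror)
  show "a \<in> S \<Longrightarrow> flip a \<in> M.S"
    by (induction rule: S.induct)
      (auto simp: flip_tmul flip_gens intro: M.S_tmul M.S_gens M.S.one M.S.add M.S.scl)
qed

lemma flip_S_iff: "flip a \<in> rank_two.S p s r \<beta> \<delta> \<alpha> \<gamma> \<longleftrightarrow> a \<in> S"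
  using flip_S rank_two.flip_S[OF mirror, of "flip a"] by auto

section \<open>The subalgebra as an intersection of two localizations\<close>

text \<open>
  This is the localization of \<open>S\<close> at the powers of \<open>x\<close>: Laurent polynomials in \<open>x\<close> times nonnegative
  powers of \<open>y\<close> or of \<open>e1\<close>. Rows of positive degree are unrestricted.
\<close>

definition S1 :: "'k torus set" where
  "S1 = {t. \<forall>i. \<exists>f. in_row 0 f \<and> row (- int i) t = f \<star> e1 \<up> i}"

lemma S1_row: "t \<in> S1 \<Longrightarrow> \<exists>f. in_row 0 f \<and> row (- int i) t = f \<star> e1 \<up> i"
  by (simp add: S1_def)

lemma S1I: "(\<And>i. i > 0 \<Longrightarrow> \<exists>f. in_row 0 f \<and> row (- int i) t = f \<star> e1 \<up> i) \<Longrightarrow> t \<in> S1"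
  unfolding S1_def
proof (intro CollectI allI)
  fix i assume *: "\<And>i. i > 0 \<Longrightarrow> \<exists>f. in_row 0 f \<and> row (- int i) t = f \<star> e1 \<up> i"
  show "\<exists>f. in_row 0 f \<and> row (- int i) t = f \<star> e1 \<up> i"
    by (cases "i = 0") (use * in auto)
qed

lemma in_row_e1: "in_row (-1) e1"
  by (simp add: e1_def)

lemma S1_add: "a \<in> S1 \<Longrightarrow> b \<in> S1 \<Longrightarrow> a + b \<in> S1"
  unfolding S1_def by (simp) (metis tmul_add_left in_row_simps(3))

lemma S1_scl: "a \<in> S1 \<Longrightarrow> scl c a \<in> S1"
  unfolding S1_def by (simp) (metis tmul_scl_left in_row_simps(5))

lemma S1_diff: "a \<in> S1 \<Longrightarrow> b \<in> S1 \<Longrightarrow> a - b \<in> S1"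
  using S1_add[of a "scl (-1) b"] S1_scl[of b "-1"] by (simp add: scl_minus_left)

text \<open>As \<open>e1 y\<close> lies in row 0, which is commutative, \<open>e1\<close> moves past a Laurent polynomial in \<open>x\<close> in the
  same way as \<open>y\<^sup>-\<^sup>1\<close>.\<close>

lemma e1_shift:
  assumes "in_row 0 f"
  shows "\<exists>g. in_row 0 g \<and> e1 \<star> f = g \<star> e1"
proof (intro exI conjI)
  let ?g = "mono 0 (-1) \<star> f \<star> mono 0 1" and ?h = "e1 \<star> mono 0 1"
  have f': "in_row (-1) (mono 0 (-1) \<star> f)"
    using in_row_single_tmul[OF assms] by simp
  show g: "in_row 0 ?g" using in_row_tmul[OF f' in_row_simps(2)[of 1]] by simp
  have h: "in_row 0 ?h" using in_row_tmul[OF in_row_e1 in_row_simps(2)[of 1]] by simp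
  have inv: "mono 0 1 \<star> (mono 0 (-1) \<star> u) = u" "mono 0 (-1) \<star> (mono 0 1 \<star> u) = u" for u
    by (simp_all flip: tmul_assoc)
  have inv': "mono 0 1 \<star> mono 0 (-1) = mono 0 0" by simp
  have "?g \<star> e1 = ?g \<star> ?h \<star> mono 0 (-1)"
    by (simp only: tmul_assoc inv' tmul_one_right)
  also have "\<dots> = ?h \<star> ?g \<star> mono 0 (-1)" by (simp only: row0_commute[OF g h])
  also have "\<dots> = e1 \<star> f" by (simp only: tmul_assoc inv inv' tmul_one_right)
  finally show "e1 \<star> f = ?g \<star> e1" ..
qed

text \<open>Multiplying by a generator from the left preserves the factor \<open>e1\<^sup>i\<close> on the right. The generators
  \<open>y\<close> and \<open>e4\<close> move terms up by 1 or \<open>s\<close> rows; the superfluous powers of \<open>e1\<close> then combine with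
  them to elements of row 0.\<close>

lemma S_subset_S1: "a \<in> S \<Longrightarrow> a \<in> S1"
proof (induction rule: S.induct)
  case one
  show ?case by (rule S1I) (auto intro!: exI[of _ 0])
next
  case (add a b) then show ?case by (simp add: S1_add)
next
  case (scl a) then show ?case by (simp add: S1_scl)
next
  case (e1 a)
  show ?case
  proof (rule S1I)
    fix i :: nat assume "i > 0"
    then obtain j where i: "i = Suc j" by (cases i) auto
    obtain f where f: "in_row 0 f" "row (- int j) a = f \<star> e1 \<up> j"
      using e1 S1_row by blast
    obtain g where g: "in_row 0 g" "e1 \<star> f = g \<star> e1" using e1_shift f by blast
    have "row (- int i) (e1 \<star> a) = e1 \<star> f \<star> e1 \<up> j"
      using f by (simp add: row_tmul[OF in_row_e1] i tmul_assoc)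
    then show "\<exists>f. in_row 0 f \<and> row (- int i) (e1 \<star> a) = f \<star> e1 \<up> i"
      using g by (auto simp: i tmul_assoc)
  qed
next
  case (x a)
  show ?case
  proof (rule S1I)
    fix i :: nat
    obtain f where f: "in_row 0 f" "row (- int i) a = f \<star> e1 \<up> i"
      using x S1_row by blast
    have "row (- int i) (mono 1 0 \<star> a) = (mono 1 0 \<star> f) \<star> e1 \<up> i"
      using f by (simp add: row_tmul[OF in_row_simps(2)] tmul_assoc)
    then show "\<exists>f. in_row 0 f \<and> row (- int i) (mono 1 0 \<star> a) = f \<star> e1 \<up> i"
      using in_row_single_tmul[OF f(1)] by (metis add_0)
  qed
next
  case (y a)
  show ?case
  proof (rule S1I)
    fix i :: nat
    obtain f where f: "in_row 0 f" "row (- int (Suc i)) a = f \<star> e1 \<up> Suc i"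
      using y S1_row by blast
    have idx: "- int i - 1 = - int (Suc i)" by simp
    have eq: "row (- int i) (mono 0 1 \<star> a) = (mono 0 1 \<star> (f \<star> e1)) \<star> e1 \<up> i"
      unfolding row_tmul[OF in_row_simps(2)] idx f(2) by (simp add: tmul_assoc)
    have "in_row (-1) (f \<star> e1)" using in_row_tmul[OF f(1) in_row_e1] by simp
    then have "in_row 0 (mono 0 1 \<star> (f \<star> e1))" by (rule in_row_single_tmul) simp
    with eq show "\<exists>f. in_row 0 f \<and> row (- int i) (mono 0 1 \<star> a) = f \<star> e1 \<up> i"
      by auto
  qed
next
  case (e4 a)
  show ?case
  proof (rule S1I)
    fix i :: nat
    obtain f where f: "in_row 0 f" "row (- int i) a = f \<star> e1 \<up> i"
      using e4 S1_row by blast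
    obtain g where g: "in_row 0 g" "row (- int (s + i)) a = g \<star> e1 \<up> (s + i)"
      using e4 S1_row by blast
    let ?f = "single (-1, 0) \<beta> \<star> f" and ?g = "single (-1, int s) \<delta> \<star> (g \<star> e1 \<up> s)"
    have idx: "- int i - int s = - int (s + i)" by simp
    have eq: "row (- int i) (e4 \<star> a) = (?f + ?g) \<star> e1 \<up> i"
      unfolding e4_def tmul_add_left row_simps
      unfolding row_tmul[OF in_row_simps(2)] idx g(2) using f
      by (simp add: tmul_assoc T.power_add)
    have "in_row (- int s) (g \<star> e1 \<up> s)"
      using in_row_tmul[OF g(1) in_row_tpow[OF in_row_e1, of s]] by simp
    then have "in_row 0 (?f + ?g)"
      using f(1) by (intro in_row_simps(3) in_row_single_tmul[of 0 f] in_row_single_tmul[of "- int s"]) auto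
    with eq show "\<exists>f. in_row 0 f \<and> row (- int i) (e4 \<star> a) = f \<star> e1 \<up> i"
      by auto
  qed
qed

text \<open>On row \<open>n\<close> the commutator with \<open>x\<close> is left multiplication by \<open>(p\<^sup>n - 1) x\<close>, which is invertible
  for \<open>n \<noteq> 0\<close>.\<close>

lemma commutator_x_S1:
  assumes "t \<star> x - x \<star> t \<in> S1"
  shows "t \<in> S1"
proof (rule S1I)
  fix i :: nat assume "i > 0"
  define c where "c = p powi (- int i) - 1"
  have c: "c \<noteq> 0" using generic[of "- int i"] \<open>i > 0\<close> by (simp add: c_def)
  obtain f where f: "in_row 0 f" "row (- int i) (t \<star> x - x \<star> t) = f \<star> e1 \<up> i"
    using S1_row[OF assms] by blast
  have "row (- int i) (t \<star> x - x \<star> t) = row (- int i) t \<star> x - x \<star> row (- int i) t"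
    by (simp add: row_tmul_single row_tmul[OF in_row_simps(2)])
  also have "\<dots> = scl c (x \<star> row (- int i) t)"
    by (simp add: in_row_tmul_x c_def scl_diff_left)
  finally have "f \<star> e1 \<up> i = scl c (x \<star> row (- int i) t)"
    using f by simp
  then have "mono (-1) 0 \<star> (f \<star> e1 \<up> i) = scl c (mono (-1) 0 \<star> (x \<star> row (- int i) t))"
    by (simp only: tmul_scl_right)
  also have "\<dots> = scl c (row (- int i) t)" by (simp flip: tmul_assoc)
  finally have "row (- int i) t = scl (1 / c) (mono (-1) 0 \<star> f \<star> e1 \<up> i)"
    using c by (simp add: tmul_assoc)
  then show "\<exists>f. in_row 0 f \<and> row (- int i) t = f \<star> e1 \<up> i"
    using in_row_single_tmul[OF f(1), of 0 0 "-1" 1]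
    by (auto simp: tmul_scl_left intro!: exI[of _ "scl (1 / c) (mono (-1) 0 \<star> f)"])
qed

lemma S_quadrant: "(\<And>m n. lookup f (m, n) \<noteq> 0 \<Longrightarrow> m \<ge> 0 \<and> n \<ge> 0) \<Longrightarrow> f \<in> S"
  by (subst poly_mapping_sum_single) (rule S_sum, auto simp: in_keys_iff intro: S_mono)

lemma has_lead_e1: "\<alpha> \<noteq> 0 \<Longrightarrow> has_lead e1 (0, -1)"
  using rs_pos by (auto simp: has_lead_def e1_def lookup_add lookup_single when_def split: if_splits)

lemma has_lead_e4: "has_lead e4 (-1, int s)"
  using rs_pos coeff_nonzero
  by (auto simp: has_lead_def e4_def lookup_add lookup_single when_def split: if_splits)

text \<open>Each pair of integers indexes one fan monomial: the signs of \<open>u\<close> and \<open>v\<close> choose the cone, since at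
  most one of \<open>x, e4\<close> and at most one of \<open>y, e1\<close> occur with positive exponent. With this indexing the
  flip just exchanges \<open>u\<close> and \<open>v\<close>.\<close>

definition Mon :: "int \<Rightarrow> int \<Rightarrow> 'k torus" where
  "Mon u v = e1 \<up> nat (- v) \<star> (x \<up> nat u \<star> (y \<up> nat v \<star> e4 \<up> nat (- u)))"

lemma has_lead_Mon:
  assumes "\<alpha> \<noteq> 0"
  shows "has_lead (Mon u v) (u, v + int s * int (nat (- u)))"
proof -
  have "has_lead (Mon u v) (int (nat (- v)) * 0 + (int (nat u) * 1 + (int (nat v) * 0 + int (nat (- u)) * -1)),
     int (nat (- v)) * -1 + (int (nat u) * 0 + (int (nat v) * 1 + int (nat (- u)) * int s)))"
    unfolding Mon_def
    by (intro has_lead_tmul has_lead_tpow has_lead_e1 has_lead_e4 has_lead_single assms) auto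
  moreover have "int (nat u) - int (nat (- u)) = u" "int (nat v) - int (nat (- v)) = v" by auto
  ultimately show ?thesis by (simp add: algebra_simps)
qed

lemma flip_Mon: "flip (Mon u v) = rank_two.Mon p s r \<beta> \<delta> \<alpha> \<gamma> v u"
proof -
  interpret M: rank_two p s r \<beta> \<delta> \<alpha> \<gamma> by (simp add: mirror)
  show ?thesis by (simp add: Mon_def M.Mon_def flip_tmul flip_tpow flip_gens tmul_assoc)
qed

lemma Mon_independent_aux:
  assumes "\<alpha> \<noteq> 0" "finite F" "(\<Sum>(u, v)\<in>F. scl (c (u, v)) (Mon u v)) = 0" "i \<in> F"
  shows "c i = 0"
proof (rule lead_independent[where l = "\<lambda>(u, v). (u, v + int s * int (nat (- u)))"
      and g = "\<lambda>(u, v). Mon u v"])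
  show "(\<Sum>i\<in>F. scl (c i) (case i of (u, v) \<Rightarrow> Mon u v)) = 0"
    using assms(3) by (simp add: case_prod_beta)
qed (use assms has_lead_Mon in \<open>auto simp: inj_on_def\<close>)

text \<open>For \<open>\<alpha> \<noteq> 0\<close> the leading positions \<open>(u, v + s max(-u, 0))\<close> are distinct. For \<open>\<alpha> = 0\<close> the leading
  term of \<open>e1\<close> is different and they need not be, but then \<open>\<beta> \<noteq> 0\<close> and the mirror image applies.\<close>

theorem Mon_independent:
  assumes "\<alpha> \<noteq> 0 \<or> \<beta> \<noteq> 0" "finite F" "(\<Sum>(u, v)\<in>F. scl (c (u, v)) (Mon u v)) = 0" "i \<in> F"
  shows "c i = 0"
proof (cases "\<alpha> = 0")
  case True
  interpret M: rank_two p s r \<beta> \<delta> \<alpha> \<gamma> by (simp add: mirror)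
  have flip_sum: "flip (sum g G) = (\<Sum>i\<in>G. flip (g i))" for g :: "int \<times> int \<Rightarrow> 'k torus" and G
    by (induction G rule: infinite_finite_induct) auto
  have "flip (\<Sum>(u, v)\<in>F. scl (c (u, v)) (Mon u v)) = 0" using assms by simp
  then have "(\<Sum>(u, v)\<in>F. scl (c (u, v)) (M.Mon v u)) = 0"
    by (simp add: flip_sum case_prod_beta flip_Mon)
  also have "(\<Sum>(u, v)\<in>F. scl (c (u, v)) (M.Mon v u))
      = (\<Sum>(u, v)\<in>prod.swap ` F. scl ((c \<circ> prod.swap) (u, v)) (M.Mon u v))"
    by (subst sum.reindex) (auto intro: sum.cong)
  finally have "(c \<circ> prod.swap) (prod.swap i) = 0"
    using assms True by (intro M.Mon_independent_aux[of "prod.swap ` F"]) auto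
  then show ?thesis by simp
qed (use Mon_independent_aux assms in blast)

text \<open>Row \<open>-i\<close> of \<open>t\<close> is \<open>f e1\<^sup>i\<close> with a Laurent polynomial \<open>f\<close> in \<open>x\<close>. The lowest term of
  \<open>(\<alpha> + \<gamma> x\<^sup>r)\<^sup>i\<close> is constant because \<open>\<alpha> \<noteq> 0\<close>, so \<open>f\<close> has no negative powers of \<open>x\<close> if \<open>t\<close> has none.\<close>

lemma S1_col_ge:
  assumes "\<alpha> \<noteq> 0" "t \<in> S1" "col_ge 0 t"
  shows "t \<in> S"
proof -
  have "row n t \<in> S" for n
  proof (cases "n \<ge> 0")
    case True
    then show ?thesis using assms(3)
      by (intro S_quadrant) (auto simp: col_ge_def not_le[symmetric] split: if_splits)
  next
    case False
    define i where "i = nat (- n)"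
    have i: "- int i = n" using False by (simp add: i_def)
    obtain f where f: "in_row 0 f" "row n t = f \<star> e1 \<up> i"
      using S1_row[OF assms(2), of i] i by auto
    have "m \<ge> 0 \<and> k \<ge> 0" if "lookup f (m, k) \<noteq> 0" for m k
    proof -
      have "f \<noteq> 0" using that by auto
      then obtain u v where l: "has_lead f (u, v)" using exists_lead by fastforce
      from has_lead_tmul[OF l has_lead_tpow[OF has_lead_e1[OF assms(1)], of i]]
      have "lookup (row n t) (u, v - int i) \<noteq> 0"
        unfolding f(2) has_lead_def by simp
      then have "u \<ge> 0" using assms(3) by (auto simp: col_ge_def not_le[symmetric] split: if_splits)
      moreover have "u \<le> m" using l that by (force simp: has_lead_def)
      ultimately show ?thesis using that in_rowD[OF f(1), of k m] by auto
    qed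
    then have "f \<in> S" by (rule S_quadrant)
    then show ?thesis unfolding f(2) by (intro S_tmul S_tpow S_gens)
  qed
  then show ?thesis by (subst sum_rows) (rule S_sum)
qed

text \<open>Negative powers of \<open>y\<close> come from \<open>e1\<^sup>i\<close>, whose column 0 is \<open>\<alpha>\<^sup>i y\<^bsup>-i\<^esup>\<close>.\<close>

lemma col0_lift:
  assumes "\<alpha> \<noteq> 0"
  shows "\<exists>a\<in>S. col_ge 0 a \<and> col 0 a = col 0 h"
proof (induction h rule: poly_mapping_add_induct)
  case zero
  then show ?case by (intro bexI[of _ 0]) (auto intro: S_zero)
next
  case (add a c h)
  obtain m k where a: "a = (m, k)" by fastforce
  have "\<exists>b\<in>S. col_ge 0 b \<and> col 0 b = col 0 (single a c)"
  proof (cases "m = 0 \<and> k < 0")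
    case True
    define i where "i = nat (- k)"
    have e1: "col_ge 0 e1" "col 0 e1 = single (0, -1) \<alpha>"
      using rs_pos by (auto simp: e1_def)
    have "col_ge 0 (e1 \<up> j) \<and> col 0 (e1 \<up> j) = single (0, -1) \<alpha> \<up> j" for j
      by (induction j) (use col_ge_tmul[OF e1(1)] e1(2) in \<open>auto\<close>)
    from this[of i] show ?thesis using True assms
      by (intro bexI[of _ "scl (c / \<alpha> ^ i) (e1 \<up> i)"])
        (auto simp: a single_tpow_row0 i_def intro: S.scl S_tpow S_gens)
  next
    case False
    show ?thesis
    proof (cases "m = 0")
      case True
      then show ?thesis using False
        by (intro bexI[of _ "single a c"]) (auto simp: a intro: S_mono)
    qed (auto simp: a intro!: bexI[of _ 0] S_zero)
  qed
  with add show ?case by (metis S.add col_ge_simps(2) col_simps(1))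
qed

text \<open>By the second localization, the leftmost column \<open>-l\<close> of \<open>t\<close> is \<open>e4\<^sup>l h\<close> with a Laurent polynomial
  \<open>h\<close> in \<open>y\<close>. Lifting \<open>h\<close> to an element \<open>a\<close> of \<open>S\<close> and subtracting \<open>e4\<^sup>l a\<close> removes this column, until no
  negative column is left.\<close>

lemma S1_flip_S1_aux:
  assumes "\<alpha> \<noteq> 0" "t \<in> S1" "flip t \<in> rank_two.S1 p s \<beta> \<delta>" "col_ge (- int N) t"
  shows "t \<in> S"
  using assms(2-4)
proof (induction N arbitrary: t)
  case 0
  then show ?case using S1_col_ge assms(1) by simp
next
  interpret M: rank_two p s r \<beta> \<delta> \<alpha> \<gamma> by (simp add: mirror)
  case (Suc N)
  let ?l = "Suc N"
  obtain f where f: "in_row 0 f" "row (- int ?l) (flip t) = f \<star> M.e1 \<up> ?l"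
    using M.S1_row[OF Suc.prems(2)] by blast
  have "flip (row (- int ?l) (flip t)) = e4 \<up> ?l \<star> flip f"
    unfolding f(2) by (simp only: flip_tmul flip_tpow M.flip_gens)
  then have t: "col (- int ?l) t = e4 \<up> ?l \<star> flip f" by (simp add: flip_row)
  have f': "col 0 (flip f) = flip f" using f(1) by (simp add: in_row_def flip: flip_row)
  obtain a where a: "a \<in> S" "col_ge 0 a" "col 0 a = flip f"
    using col0_lift[OF assms(1), of "flip f"] f' by auto
  have "in_row (- int ?l) (M.e1 \<up> ?l)" using in_row_tpow[OF M.in_row_e1, of ?l] by simp
  then have "flip (row (- int ?l) (M.e1 \<up> ?l)) = flip (M.e1 \<up> ?l)" by (simp only: in_row_def)
  then have c: "col (- int ?l) (e4 \<up> ?l) = e4 \<up> ?l"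
    by (simp only: flip_row flip_tpow M.flip_gens)
  have ge: "col_ge k (col k g)" for k g by (auto simp: col_ge_def)
  define b where "b = e4 \<up> ?l \<star> a"
  have b: "b \<in> S" unfolding b_def by (intro S_tmul S_tpow S_gens a(1))
  have "col_ge (- int ?l) (e4 \<up> ?l)" using ge[of "- int ?l" "e4 \<up> ?l"] by (simp only: c)
  from col_ge_tmul[OF this a(2)]
  have b': "col_ge (- int ?l) b" "col (- int ?l) b = col (- int ?l) t"
    by (simp_all only: b_def c a(3) t add_0_right)
  have "t - b \<in> S"
  proof (rule Suc.IH)
    show "t - b \<in> S1" using Suc.prems(1) S_subset_S1[OF b] by (rule S1_diff)
    show "flip (t - b) \<in> M.S1"
      using Suc.prems(2) M.S_subset_S1[OF flip_S[OF b]] by (simp add: M.S1_diff)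
    show "col_ge (- int N) (t - b)" unfolding col_ge_def
    proof (intro allI impI)
      fix m n assume m: "m < - int N"
      show "lookup (t - b) (m, n) = 0"
      proof (cases "m = - int ?l")
        case True
        then show ?thesis using arg_cong[OF b'(2), of "\<lambda>g. lookup g (m, n)"]
          by (simp add: lookup_minus)
      next
        case False
        then have "m < - int ?l" using m by simp
        then show ?thesis using b'(1) Suc.prems(3) by (simp add: col_ge_def lookup_minus)
      qed
    qed
  qed
  from S.add[OF this b] show ?case by simp
qed

theorem S1_flip_S1:
  assumes "\<alpha> \<noteq> 0 \<or> \<beta> \<noteq> 0" "t \<in> S1" "flip t \<in> rank_two.S1 p s \<beta> \<delta>"
  shows "t \<in> S"
proof (cases "\<alpha> = 0")
  case True
  interpret M: rank_two p s r \<beta> \<delta> \<alpha> \<gamma> by (simp add: mirror)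
  obtain N where "col_ge (- int N) (flip t)" using exists_col_ge by blast
  then have "flip t \<in> M.S"
    using assms True by (intro M.S1_flip_S1_aux) auto
  then show ?thesis by (simp add: flip_S_iff)
next
  case False
  then show ?thesis using S1_flip_S1_aux assms exists_col_ge by blast
qed

end

section \<open>Derivations of the subalgebra\<close>

text \<open>The diagonal derivation with \<open>x \<mapsto> c x\<close> and \<open>y \<mapsto> d y\<close>, named after the Euler operator.\<close>

definition euler :: "'k::field \<Rightarrow> 'k \<Rightarrow> 'k torus \<Rightarrow> 'k torus" where
  "euler c d = Poly_Mapping.mapp (\<lambda>(m, n) v. (c * of_int m + d * of_int n) * v)"

lemma lookup_euler [simp]: "lookup (euler c d f) (m, n) = (c * of_int m + d * of_int n) * lookup f (m, n)"
  by (simp add: euler_def lookup_mapp when_def in_keys_iff)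

lemma euler_simps [simp]:
  "euler c d (f + g) = euler c d f + euler c d g"
  "euler c d (scl e f) = scl e (euler c d f)" "euler c d 0 = 0"
  "euler c d (single (m, n) e) = single (m, n) ((c * of_int m + d * of_int n) * e)"
  "flip (euler c d f) = euler d c (flip f)"
  by (auto intro!: poly_mapping_eqI simp: lookup_add lookup_single when_def algebra_simps)

lemma euler_0: "euler 0 0 t = 0"
  by (intro poly_mapping_eqI) auto

context quantum_torus
begin

lemma euler_tmul: "euler c d (f \<star> g) = euler c d f \<star> g + f \<star> euler c d g"
proof (induction f rule: poly_mapping_add_induct)
  case (add a e f)
  have "euler c d (single a e \<star> g) = euler c d (single a e) \<star> g + single a e \<star> euler c d g"
  proof (induction g rule: poly_mapping_add_induct)
    case (add b e' g)
    show ?case using add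
      by (cases a; cases b) (simp add: tmul_simps algebra_simps flip: single_add)
  qed simp
  with add show ?case by (simp add: tmul_simps)
qed simp

end

context rank_two
begin

lemma euler_e1: "euler c d e1 = scl (- d) e1 + single (int r, -1) (c * of_nat r * \<gamma>)"
  by (simp add: e1_def algebra_simps flip: single_add)

text \<open>If \<open>\<alpha> = 0\<close>, then \<open>e1\<close> is a monomial and thus an eigenvector of every diagonal derivation; if
  \<open>c = 0\<close>, it is one because both its terms have \<open>y\<close>-degree \<open>-1\<close>. The same holds for \<open>e4\<close>.\<close>

lemma euler_S:
  assumes "c = 0 \<or> \<alpha> = 0" "d = 0 \<or> \<beta> = 0" "a \<in> S"
  shows "euler c d a \<in> S"
proof -
  have e1: "euler c d e1 \<in> S"
  proof (cases "c = 0")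
    case False
    then have "euler c d e1 = scl (c * of_nat r - d) e1"
      using assms(1) unfolding e1_def by (auto simp: algebra_simps)
    then show ?thesis by (simp add: S.scl S_gens)
  qed (simp add: euler_e1 S_gens S.scl)
  have e4: "euler c d e4 \<in> S"
  proof (cases "d = 0")
    case True
    then have "euler c d e4 = scl (- c) e4" by (simp add: e4_def)
    then show ?thesis by (simp add: S.scl S_gens)
  next
    case False
    then have "euler c d e4 = scl (d * of_nat s - c) e4"
      using assms(2) unfolding e4_def by (auto simp: algebra_simps)
    then show ?thesis by (simp add: S.scl S_gens)
  qed
  have "euler c d x = single (1, 0) c" "euler c d y = single (0, 1) d" by simp_all
  then have xy: "euler c d x \<in> S" "euler c d y \<in> S" using S_mono[of 1 0 c] S_mono[of 0 1 d] by auto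
  have gen: "euler c d (g \<star> a) \<in> S" if "euler c d g \<in> S" "g \<in> S" "a \<in> S" "euler c d a \<in> S" for g a
    unfolding euler_tmul by (intro S.add S_tmul that)
  from assms(3) show ?thesis
  proof (induction rule: S.induct)
    case one
    show ?case using S_zero by simp
  next
    case (add a b)
    then show ?case unfolding euler_simps by (intro S.add)
  next
    case (scl a e)
    then show ?case unfolding euler_simps by (intro S.scl)
  next
    case (e1 a)
    then show ?case by (intro gen \<open>euler c d e1 \<in> S\<close> S_gens)
  next
    case (x a)
    then show ?case by (intro gen xy S_gens)
  next
    case (y a)
    then show ?case by (intro gen xy S_gens)
  next
    case (e4 a)
    then show ?case by (intro gen \<open>euler c d e4 \<in> S\<close> S_gens)
  qed
qed

text \<open>As \<open>\<alpha>\<close> and \<open>\<gamma>\<close> are not zero, a product \<open>f (\<alpha> + \<gamma> x\<^sup>r)\<close> with \<open>f \<noteq> 0\<close> has at least two terms, the ones of lowest and of highest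
  degree, so it is never a monomial.\<close>

lemma single_not_S1:
  assumes "\<alpha> \<noteq> 0" "e \<noteq> 0"
  shows "single (int r, -1) e \<notin> S1"
proof
  assume "single (int r, -1) e \<in> S1"
  from S1_row[OF this, of 1] obtain f where f: "in_row 0 f" "f \<star> e1 = single (int r, -1) e"
    by auto
  have eq: "\<alpha> * lookup f (m, 0) + \<gamma> * lookup f (m - int r, 0) = (if m = int r then e else 0)" for m
    using arg_cong[OF f(2), of "\<lambda>g. lookup g (m, -1)"]
    by (simp add: e1_def tmul_add_right lookup_add tmul_mono_lookup lookup_single when_def mult.commute
        split: if_splits)
  have ne: "keys f \<noteq> {}"
  proof
    assume "keys f = {}"
    then have "f = 0" by simp
    then have "f \<star> e1 = 0" by (simp only: tmul_zero)
    then have "(single (int r, -1) e :: 'k torus) = 0" by (rule trans[OF f(2)[symmetric]])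
    then show False using assms(2) by (metis lookup_single_eq lookup_zero)
  qed
  have mem: "lookup f (fst a, 0) \<noteq> 0" if "a \<in> keys f" for a
    using that in_rowD[OF f(1), of "snd a" "fst a"] by (cases a) (auto simp: in_keys_iff)
  define M where "M = Max (fst ` keys f)"
  define N where "N = Min (fst ` keys f)"
  have "M \<in> fst ` keys f" "N \<in> fst ` keys f"
    unfolding M_def N_def using ne by (auto intro: Max_in Min_in)
  then have M: "lookup f (M, 0) \<noteq> 0" "lookup f (N, 0) \<noteq> 0" using mem by auto
  have bounds: "N \<le> m \<and> m \<le> M" if "lookup f (m, 0) \<noteq> 0" for m
    unfolding M_def N_def using that by (auto simp: image_iff in_keys_iff intro!: Max_ge Min_le)
      (force simp: in_keys_iff)+
  have "lookup f (M + int r, 0) = 0" "lookup f (N - int r, 0) = 0"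
    using bounds[of "M + int r"] bounds[of "N - int r"] rs_pos by auto
  then have "M = 0" "N = int r"
    using eq[of "M + int r"] eq[of N] M coeff_nonzero assms by (auto split: if_splits)
  then show False using bounds[OF M(1)] rs_pos by simp
qed

lemma euler_e1_S1: "euler c d e1 \<in> S1 \<Longrightarrow> c = 0 \<or> \<alpha> = 0"
proof (rule ccontr)
  assume *: "euler c d e1 \<in> S1" "\<not> (c = 0 \<or> \<alpha> = 0)"
  have "single (int r, -1) (c * of_nat r * \<gamma>) = euler c d e1 - scl (- d) e1"
    by (simp add: euler_e1)
  also have "\<dots> \<in> S1" using *(1) S_subset_S1[OF S_gens(1)] by (intro S1_diff S1_scl)
  finally show False using single_not_S1 * rs_pos coeff_nonzero by simp
qed

lemma e1_y: "e1 \<star> y = scl \<alpha> (mono 0 0) + scl \<gamma> (x \<up> r)"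
  by (simp add: e1_def tmul_simps single_tpow_col0)

lemma x_e4: "x \<star> e4 = scl \<beta> (mono 0 0) + scl \<delta> (y \<up> s)"
  by (simp add: e4_def tmul_simps single_tpow_row0)

text \<open>The coefficients of \<open>D (y x) = p D (x y)\<close> link those of \<open>D x\<close> and \<open>D y\<close>. Outside row 0 the
  coefficients of \<open>t\<close> can be read off from \<open>D x\<close>, outside column 0 from \<open>D y\<close>, and both ways agree. The
  position \<open>(0, 0)\<close> is what the diagonal part accounts for.
  On \<open>e1\<close> and \<open>e4\<close> the derivation is then determined, since \<open>e1 y\<close> and \<open>x e4\<close> are polynomials in \<open>x\<close> and
  in \<open>y\<close>.\<close>

theorem derivation_form:
  assumes nz: "\<alpha> \<noteq> 0 \<or> \<beta> \<noteq> 0"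
    and D_S: "\<And>a. a \<in> S \<Longrightarrow> D a \<in> S"
    and D_add: "\<And>a b. a \<in> S \<Longrightarrow> b \<in> S \<Longrightarrow> D (a + b) = D a + D b"
    and D_scl: "\<And>c a. a \<in> S \<Longrightarrow> D (scl c a) = scl c (D a)"
    and D_mul: "\<And>a b. a \<in> S \<Longrightarrow> b \<in> S \<Longrightarrow> D (a \<star> b) = D a \<star> b + a \<star> D b"
  shows "\<exists>t\<in>S. \<exists>c d. (c = 0 \<or> \<alpha> = 0) \<and> (d = 0 \<or> \<beta> = 0)
    \<and> (\<forall>a\<in>S. D a = t \<star> a - a \<star> t + euler c d a)"
proof -
  interpret M: rank_two p s r \<beta> \<delta> \<alpha> \<gamma> by (simp add: mirror)
  define A where "A = (\<lambda>m n. lookup (D x) (m, n))"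
  define B where "B = (\<lambda>m n. lookup (D y) (m, n))"
  define c where "c = A 1 0"
  define d where "d = B 0 1"
  have q: "k \<noteq> 0 \<Longrightarrow> p powi k - 1 \<noteq> 0" for k using generic by simp
  have yx: "y \<star> x = scl p (x \<star> y)" by simp
  have "D y \<star> x + y \<star> D x = D (y \<star> x)" by (simp only: D_mul S_gens)
  also have "\<dots> = scl p (D x \<star> y + x \<star> D y)"
    unfolding yx by (simp only: D_scl D_mul S_gens S_tmul)
  finally have rel0: "D y \<star> x + y \<star> D x = scl p (D x \<star> y + x \<star> D y)" .
  have rel: "B m (n + 1) * (p powi n - 1) = A (m + 1) n * (1 - p powi m)" for m n
  proof -
    have "B m (n + 1) * p powi (n + 1) + A (m + 1) n * p powi (m + 1)
        = p * (A (m + 1) n + B m (n + 1))"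
      using arg_cong[OF rel0, of "\<lambda>g. lookup g (m + 1, n + 1)"]
      by (simp add: lookup_add tmul_mono_lookup mono_tmul_lookup A_def B_def distrib_left)
    then have "p * (B m (n + 1) * p powi n + A (m + 1) n * p powi m) = p * (A (m + 1) n + B m (n + 1))"
      using p_nonzero by (simp add: power_int_add algebra_simps)
    then have "B m (n + 1) * p powi n + A (m + 1) n * p powi m = A (m + 1) n + B m (n + 1)"
      using p_nonzero by simp
    then show ?thesis by (simp add: algebra_simps)
  qed
  \<comment> \<open>Read off from \<open>[t, x]\<close>, which multiplies row \<open>n\<close> by \<open>p\<^sup>n - 1\<close>, and in row 0 from \<open>[t, y]\<close>.
    The factors \<open>x\<^sup>-\<^sup>1\<close> and \<open>y\<^sup>-\<^sup>1\<close> stand on those sides where they introduce no power of \<open>p\<close>.\<close>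
  define t where "t =
      Poly_Mapping.mapp (\<lambda>(m, n) v. if n = 0 then 0 else v / (p powi n - 1)) (mono (-1) 0 \<star> D x)
    + Poly_Mapping.mapp (\<lambda>(m, n) v. if n = 0 \<and> m \<noteq> 0 then v / (1 - p powi m) else 0) (D y \<star> mono 0 (-1))"
  have t: "lookup t (m, n) = (if n \<noteq> 0 then A (m + 1) n / (p powi n - 1)
      else if m \<noteq> 0 then B m (n + 1) / (1 - p powi m) else 0)" for m n
    unfolding t_def
    by (simp add: lookup_add lookup_mapp when_def in_keys_iff tmul_mono_lookup mono_tmul_lookup A_def B_def)
  define E where "E = (\<lambda>a. t \<star> a - a \<star> t + euler c d a)"
  have E_mul: "E (a \<star> b) = E a \<star> b + a \<star> E b" for a b
    by (simp add: E_def tmul_simps euler_tmul)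
  have E_add: "E (a + b) = E a + E b" and E_scl: "E (scl e a) = scl e (E a)" for a b e
    by (simp_all add: E_def tmul_simps)
  have Dx: "D x = E x"
  proof (rule poly_mapping_eqI, clarify)
    fix m n
    have "lookup (E x) (m, n) = lookup t (m - 1, n) * (p powi n - 1) + (if m = 1 \<and> n = 0 then c else 0)"
      by (auto simp: E_def lookup_add lookup_minus tmul_mono_lookup mono_tmul_lookup lookup_single
          when_def algebra_simps)
    also have "\<dots> = A m n"
      using rel[of "m - 1" 0] q[of n] q[of "m - 1"] by (cases "n = 0") (auto simp: t c_def)
    finally show "lookup (D x) (m, n) = lookup (E x) (m, n)" by (simp add: A_def)
  qed
  have Dy: "D y = E y"
  proof (rule poly_mapping_eqI, clarify)
    fix m n
    have "lookup (E y) (m, n) = lookup t (m, n - 1) * (1 - p powi m) + (if m = 0 \<and> n = 1 then d else 0)"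
      by (auto simp: E_def lookup_add lookup_minus tmul_mono_lookup mono_tmul_lookup lookup_single
          when_def algebra_simps)
    also have "\<dots> = B m n"
      using rel[of m "n - 1"] q[of "n - 1"] q[of m]
      by (cases "n = 1"; cases "m = 0") (auto simp: t d_def field_simps)
    finally show "lookup (D y) (m, n) = lookup (E y) (m, n)" by (simp add: B_def)
  qed
  have D1: "D (mono 0 0) = E (mono 0 0)"
    using D_mul[OF S.one S.one] E_mul[of "mono 0 0" "mono 0 0"] by simp
  have pow: "D (a \<up> n) = E (a \<up> n)" if "a \<in> S" "D a = E a" for a n
    by (induction n) (simp_all add: D1 D_mul E_mul that S_tpow)
  have "D (e1 \<star> y) = E (e1 \<star> y)"
    unfolding e1_y by (simp only: D_add D_scl E_add E_scl S.scl S.one S_tpow S_gens D1 pow Dx)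
  then have "(D e1 - E e1) \<star> y \<star> mono 0 (-1) = 0"
    by (simp add: D_mul E_mul S_gens Dy tmul_diff_left)
  then have De1: "D e1 = E e1" by (simp add: tmul_assoc)
  have "D (x \<star> e4) = E (x \<star> e4)"
    unfolding x_e4 by (simp only: D_add D_scl E_add E_scl S.scl S.one S_tpow S_gens D1 pow Dy)
  then have "mono (-1) 0 \<star> (x \<star> (D e4 - E e4)) = 0"
    by (simp add: D_mul E_mul S_gens Dx tmul_diff_right)
  then have De4: "D e4 = E e4" by (simp flip: tmul_assoc)
  have DE: "D a = E a" if "a \<in> S" for a
    using that
    by (induction rule: S.induct)
      (simp_all add: D1 D_add E_add D_scl E_scl D_mul E_mul S_gens De1 De4 Dx Dy)
  have "t \<star> x - x \<star> t = D x - scl c x"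
    unfolding Dx E_def by simp
  also have "\<dots> \<in> S" by (intro S_diff S.scl D_S S_gens)
  finally have t1: "t \<in> S1" by (rule commutator_x_S1[OF S_subset_S1])
  have "flip t \<star> x - x \<star> flip t = flip (scl d y - D y)"
    unfolding Dy E_def by (simp add: flip_tmul)
  also have "\<dots> \<in> M.S" by (intro flip_S S_diff S.scl D_S S_gens)
  finally have t2: "flip t \<in> M.S1" by (rule M.commutator_x_S1[OF M.S_subset_S1])
  have tS: "t \<in> S" using S1_flip_S1[OF nz t1 t2] .
  have eulS: "euler c d a \<in> S" if "a \<in> S" for a
  proof -
    have "euler c d a = D a - (t \<star> a - a \<star> t)" using DE[OF that] by (simp add: E_def)
    also have "\<dots> \<in> S" using that tS by (intro S_diff S_tmul D_S)
    finally show ?thesis .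
  qed
  have "c = 0 \<or> \<alpha> = 0"
    using eulS[OF S_gens(1)] euler_e1_S1 S_subset_S1 by blast
  moreover have "euler d c M.e1 \<in> M.S1"
    using M.S_subset_S1[OF flip_S[OF eulS[OF S_gens(4)]]] by (simp add: flip_gens)
  then have "d = 0 \<or> \<beta> = 0" by (rule M.euler_e1_S1)
  ultimately show ?thesis using tS DE unfolding E_def by blast
qed

end

section \<open>Quotients of vector spaces and algebras\<close>

lemma quot_simps [simp]:
  "carrier (quot A I) = a_rcosets\<^bsub>A\<^esub> I" "mult (quot A I) = rcoset_mult A I"
  "one (quot A I) = I +>\<^bsub>A\<^esub> \<one>\<^bsub>A\<^esub>" "zero (quot A I) = I" "add (quot A I) = set_add A"
  "smult (quot A I) = (\<lambda>c X. \<Union>x\<in>X. I +>\<^bsub>A\<^esub> (c \<odot>\<^bsub>A\<^esub> x))"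
  by (simp_all add: quot_def FactRing_def ring.defs module.defs)

text \<open>The module axioms with the scalars ranging over the type \<open>'k\<close> instead of the carrier of
  \<^term>\<open>class_ring\<close>.\<close>

lemma class_moduleI:
  fixes V :: "('k::field, 'a) module" (structure)
  assumes "abelian_group V"
    and "\<And>c v. v \<in> carrier V \<Longrightarrow> c \<odot> v \<in> carrier V"
    and "\<And>c d v. v \<in> carrier V \<Longrightarrow> (c + d) \<odot> v = c \<odot> v \<oplus> d \<odot> v"
    and "\<And>c v w. v \<in> carrier V \<Longrightarrow> w \<in> carrier V \<Longrightarrow> c \<odot> (v \<oplus> w) = c \<odot> v \<oplus> c \<odot> w"
    and "\<And>c d v. v \<in> carrier V \<Longrightarrow> (c * d) \<odot> v = c \<odot> (d \<odot> v)"
    and "\<And>v. v \<in> carrier V \<Longrightarrow> 1 \<odot> v = v"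
  shows "Module.module class_ring V"
  using assms by (intro moduleI) (simp_all add: class_cring.is_cring)

lemma class_module_simps:
  fixes V :: "('k::field, 'a) module" (structure)
  assumes "Module.module class_ring V" and "v \<in> carrier V"
  shows "c \<odot> v \<in> carrier V" "(c + d) \<odot> v = c \<odot> v \<oplus> d \<odot> v"
    "w \<in> carrier V \<Longrightarrow> c \<odot> (v \<oplus> w) = c \<odot> v \<oplus> c \<odot> w"
    "(c * d) \<odot> v = c \<odot> (d \<odot> v)" "1 \<odot> v = v" "(-1) \<odot> v = \<ominus> v" "0 \<odot> v = \<zero>"
proof -
  interpret Module.module class_ring V by fact
  show 1: "c \<odot> v \<in> carrier V" "(c + d) \<odot> v = c \<odot> v \<oplus> d \<odot> v"
    "w \<in> carrier V \<Longrightarrow> c \<odot> (v \<oplus> w) = c \<odot> v \<oplus> c \<odot> w"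
    "(c * d) \<odot> v = c \<odot> (d \<odot> v)" "1 \<odot> v = v" "0 \<odot> v = \<zero>" for c d
    using assms(2) smult_closed[of c v] smult_l_distr[of c d v] smult_r_distr[of c v w]
      smult_assoc1[of c d v] smult_one[of v] smult_l_null[of v] by simp_all
  have "(-1) \<odot> v \<oplus> v = (-1 + 1) \<odot> v" by (simp only: 1)
  also have "\<dots> = \<zero>" by (simp add: 1)
  finally show "(-1) \<odot> v = \<ominus> v" using assms(2) 1(1)[of "-1"] by (simp add: minus_equality)
qed

locale subspace_of = V?: Module.module "class_ring :: 'k::field ring" V for V :: "('k::field, 'a) module" (structure) +
  fixes W
  assumes W_subset: "W \<subseteq> carrier V"
    and W_zero: "\<zero> \<in> W"
    and W_add: "v \<in> W \<Longrightarrow> w \<in> W \<Longrightarrow> v \<oplus> w \<in> W"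
    and W_smult: "v \<in> W \<Longrightarrow> c \<odot> v \<in> W"
begin

lemma V_add_closed: "v \<in> carrier V \<Longrightarrow> w \<in> carrier V \<Longrightarrow> v \<oplus> w \<in> carrier V"
  by simp

sublocale W?: abelian_subgroup W V
proof (rule abelian_subgroupI3)
  have "\<ominus> v \<in> W" if "v \<in> W" for v
    using W_smult[OF that, of "-1"] that W_subset class_module_simps(6)[OF module_axioms, of v] by auto
  then show "additive_subgroup W V"
    using W_subset W_zero W_add
    by (intro additive_subgroup.intro subgroup.intro) (auto simp flip: a_inv_def)
qed unfold_locales

lemmas V_simps = class_module_simps[OF module_axioms]

lemma smult_coset: "v \<in> carrier V \<Longrightarrow> c \<odot>\<^bsub>quot V W\<^esub> (W +> v) = W +> (c \<odot> v)"
proof -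
  assume v: "v \<in> carrier V"
  have "W +> (c \<odot> x) = W +> (c \<odot> v)" if "x \<in> W +> v" for x
  proof -
    obtain w where w: "w \<in> W" "x = w \<oplus> v" using \<open>x \<in> W +> v\<close> by (auto simp: a_r_coset_def')
    then have "c \<odot> x = c \<odot> w \<oplus> c \<odot> v" using v W_subset V_simps(3)[of w v c] by auto
    then have "c \<odot> x \<in> W +> (c \<odot> v)" using W_smult[OF w(1)] by (auto simp: a_r_coset_def')
    then show ?thesis using v by (intro a_repr_independence'[symmetric] V_simps)
  qed
  moreover have "v \<in> W +> v" using v by (rule a_rcos_self)
  ultimately have "(\<Union>x\<in>W +> v. W +> (c \<odot> x)) = W +> (c \<odot> v)" by blast
  then show ?thesis by (simp only: quot_simps)
qed

lemma coset_closed: "v \<in> carrier V \<Longrightarrow> W +> v \<in> carrier (quot V W)"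
  using a_rcosetsI[OF W_subset] by simp

lemma coset_cases: "X \<in> carrier (quot V W) \<Longrightarrow> (\<And>v. v \<in> carrier V \<Longrightarrow> X = W +> v \<Longrightarrow> P) \<Longrightarrow> P"
  by (auto simp: A_RCOSETS_def')

lemma coset_add: "v \<in> carrier V \<Longrightarrow> w \<in> carrier V \<Longrightarrow> (W +> v) \<oplus>\<^bsub>quot V W\<^esub> (W +> w) = W +> (v \<oplus> w)"
  by (simp add: a_rcos_sum)

lemma coset_eq_zero_iff: "v \<in> carrier V \<Longrightarrow> W +> v = \<zero>\<^bsub>quot V W\<^esub> \<longleftrightarrow> v \<in> W"
  by (simp, metis a_coset_join1 a_coset_join2 a_rcos_const a_rcos_self additive_subgroup_axioms)

lemma zero_coset: "\<zero>\<^bsub>quot V W\<^esub> = W +> \<zero>"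
  using W_subset by simp

lemma quot_module: "Module.module class_ring (quot V W)"
proof (rule class_moduleI)
  note [simp del] = quot_simps
  note [simp] = coset_add smult_coset coset_closed zero_coset
  show "abelian_group (quot V W)"
  proof (rule abelian_groupI)
    fix X assume "X \<in> carrier (quot V W)"
    then obtain v where v: "v \<in> carrier V" "X = W +> v" by (rule coset_cases)
    show "\<exists>Y\<in>carrier (quot V W). Y \<oplus>\<^bsub>quot V W\<^esub> X = \<zero>\<^bsub>quot V W\<^esub>"
      using v by (intro bexI[of _ "W +> \<ominus> v"]) (simp_all add: l_neg)
  next
    fix X Y Z assume "X \<in> carrier (quot V W)" "Y \<in> carrier (quot V W)" "Z \<in> carrier (quot V W)"
    then obtain u v w where "u \<in> carrier V" "v \<in> carrier V" "w \<in> carrier V"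
      "X = W +> u" "Y = W +> v" "Z = W +> w" by (meson coset_cases)
    then show "X \<oplus>\<^bsub>quot V W\<^esub> Y \<oplus>\<^bsub>quot V W\<^esub> Z = X \<oplus>\<^bsub>quot V W\<^esub> (Y \<oplus>\<^bsub>quot V W\<^esub> Z)"
      by (simp only: coset_add V_add_closed a_assoc)
  next
    fix X Y assume "X \<in> carrier (quot V W)" "Y \<in> carrier (quot V W)"
    then obtain u v where "u \<in> carrier V" "v \<in> carrier V" "X = W +> u" "Y = W +> v"
      by (meson coset_cases)
    then show "X \<oplus>\<^bsub>quot V W\<^esub> Y = Y \<oplus>\<^bsub>quot V W\<^esub> X" "X \<oplus>\<^bsub>quot V W\<^esub> Y \<in> carrier (quot V W)"
      using a_comm[of u v] by (simp_all only: coset_add V_add_closed coset_closed)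
  qed (auto elim!: coset_cases)
qed (auto elim!: coset_cases simp del: quot_simps
    simp: coset_add smult_coset coset_closed V_simps)

end

locale kalgebra = A?: Module.module "class_ring :: 'k::field ring" A + A?: Ring.ring A for A :: "('k::field, 'a) module" (structure) +
  assumes smult_mult_left: "a \<in> carrier A \<Longrightarrow> b \<in> carrier A \<Longrightarrow> (c \<odot> a) \<otimes> b = c \<odot> (a \<otimes> b)"
    and smult_mult_right: "a \<in> carrier A \<Longrightarrow> b \<in> carrier A \<Longrightarrow> a \<otimes> (c \<odot> b) = c \<odot> (a \<otimes> b)"
begin

lemmas A_simps = class_module_simps[OF module_axioms]

lemma ideal_subspace:
  assumes "ideal I A"
  shows "subspace_of A I"
proof -
  interpret I: ideal I A by fact
  show ?thesis
  proof unfold_locales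
    fix v c assume v: "v \<in> I"
    then have "c \<odot> v = (c \<odot> \<one>) \<otimes> v" by (simp add: smult_mult_left)
    then show "c \<odot> v \<in> I" using v I.I_l_closed by simp
  qed (auto simp: I.a_subset)
qed

lemma quot_kalgebra:
  assumes "ideal I A"
  shows "kalgebra (quot A I)"
proof -
  interpret I: ideal I A by fact
  interpret S: subspace_of A I by (rule ideal_subspace) fact
  interpret Q: Module.module class_ring "quot A I" by (rule S.quot_module)
  have mult: "(I +> a) \<otimes>\<^bsub>quot A I\<^esub> (I +> b) = I +> (a \<otimes> b)" if "a \<in> carrier A" "b \<in> carrier A" for a b
    using I.rcoset_mult_add that by simp
  have one: "\<one>\<^bsub>quot A I\<^esub> = I +> \<one>" by simp
  have ring: "ring (quot A I)"
  proof (rule ringI[OF Q.abelian_group_axioms])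
    show "Group.monoid (quot A I)"
    proof (rule monoidI)
      fix X Y Z assume XYZ: "X \<in> carrier (quot A I)" "Y \<in> carrier (quot A I)" "Z \<in> carrier (quot A I)"
      then obtain a b c where abc: "a \<in> carrier A" "b \<in> carrier A" "c \<in> carrier A"
        and eq: "X = I +> a" "Y = I +> b" "Z = I +> c" by (meson S.coset_cases)
      show "X \<otimes>\<^bsub>quot A I\<^esub> Y \<otimes>\<^bsub>quot A I\<^esub> Z = X \<otimes>\<^bsub>quot A I\<^esub> (Y \<otimes>\<^bsub>quot A I\<^esub> Z)"
        using abc by (simp only: mult eq m_closed m_assoc)
    next
      fix X Y assume "X \<in> carrier (quot A I)" "Y \<in> carrier (quot A I)"
      then obtain a b where "a \<in> carrier A" "b \<in> carrier A" "X = I +> a" "Y = I +> b"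
        by (meson S.coset_cases)
      then show "X \<otimes>\<^bsub>quot A I\<^esub> Y \<in> carrier (quot A I)"
        by (simp only: mult S.coset_closed m_closed)
    next
      fix X assume "X \<in> carrier (quot A I)"
      then obtain a where a: "a \<in> carrier A" "X = I +> a" by (meson S.coset_cases)
      then show "\<one>\<^bsub>quot A I\<^esub> \<otimes>\<^bsub>quot A I\<^esub> X = X" "X \<otimes>\<^bsub>quot A I\<^esub> \<one>\<^bsub>quot A I\<^esub> = X"
        by (simp_all only: mult one one_closed l_one r_one)
    qed (simp only: one one_closed S.coset_closed)
  next
    fix X Y Z assume XYZ: "X \<in> carrier (quot A I)" "Y \<in> carrier (quot A I)" "Z \<in> carrier (quot A I)"
    then obtain a b c where abc: "a \<in> carrier A" "b \<in> carrier A" "c \<in> carrier A"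
      and eq: "X = I +> a" "Y = I +> b" "Z = I +> c" by (meson S.coset_cases)
    show "(X \<oplus>\<^bsub>quot A I\<^esub> Y) \<otimes>\<^bsub>quot A I\<^esub> Z = X \<otimes>\<^bsub>quot A I\<^esub> Z \<oplus>\<^bsub>quot A I\<^esub> Y \<otimes>\<^bsub>quot A I\<^esub> Z"
      "Z \<otimes>\<^bsub>quot A I\<^esub> (X \<oplus>\<^bsub>quot A I\<^esub> Y) = Z \<otimes>\<^bsub>quot A I\<^esub> X \<oplus>\<^bsub>quot A I\<^esub> Z \<otimes>\<^bsub>quot A I\<^esub> Y"
      using abc by (simp_all only: mult S.coset_add eq m_closed a_closed l_distr r_distr)
  qed
  show ?thesis
  proof (rule kalgebra.intro)
    show "kalgebra_axioms (quot A I)"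
    proof
      fix X Y c assume "X \<in> carrier (quot A I)" "Y \<in> carrier (quot A I)"
      then obtain a b where ab: "a \<in> carrier A" "b \<in> carrier A" and eq: "X = I +> a" "Y = I +> b"
        by (meson S.coset_cases)
      show "(c \<odot>\<^bsub>quot A I\<^esub> X) \<otimes>\<^bsub>quot A I\<^esub> Y = c \<odot>\<^bsub>quot A I\<^esub> (X \<otimes>\<^bsub>quot A I\<^esub> Y)"
        "X \<otimes>\<^bsub>quot A I\<^esub> (c \<odot>\<^bsub>quot A I\<^esub> Y) = c \<odot>\<^bsub>quot A I\<^esub> (X \<otimes>\<^bsub>quot A I\<^esub> Y)"
        using ab by (simp_all only: mult S.smult_coset eq m_closed S.V_simps(1) smult_mult_left smult_mult_right)
    qed
  qed (fact ring S.quot_module)+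
qed

end

lemma (in kalgebra) quot_coset_simps:
  assumes "ideal I A" "a \<in> carrier A" "b \<in> carrier A"
  shows "(I +> a) \<oplus>\<^bsub>quot A I\<^esub> (I +> b) = I +> (a \<oplus> b)"
    "(I +> a) \<otimes>\<^bsub>quot A I\<^esub> (I +> b) = I +> (a \<otimes> b)"
    "c \<odot>\<^bsub>quot A I\<^esub> (I +> a) = I +> (c \<odot> a)"
    "(I +> a) \<ominus>\<^bsub>quot A I\<^esub> (I +> b) = I +> (a \<ominus> b)"
    "\<one>\<^bsub>quot A I\<^esub> = I +> \<one>"
    "I +> a \<in> carrier (quot A I)" "I +> a = \<zero>\<^bsub>quot A I\<^esub> \<longleftrightarrow> a \<in> I"
proof -
  interpret I: ideal I A by fact
  interpret S: subspace_of A I by (rule ideal_subspace) fact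
  interpret Q: kalgebra "quot A I" by (rule quot_kalgebra) fact
  show 1: "(I +> a) \<oplus>\<^bsub>quot A I\<^esub> (I +> b) = I +> (a \<oplus> b)"
    "(I +> a) \<otimes>\<^bsub>quot A I\<^esub> (I +> b) = I +> (a \<otimes> b)"
    "c \<odot>\<^bsub>quot A I\<^esub> (I +> a) = I +> (c \<odot> a)" "\<one>\<^bsub>quot A I\<^esub> = I +> \<one>"
    "I +> a \<in> carrier (quot A I)" "I +> a = \<zero>\<^bsub>quot A I\<^esub> \<longleftrightarrow> a \<in> I"
    using assms S.coset_add I.rcoset_mult_add S.smult_coset S.coset_closed S.coset_eq_zero_iff
    by (simp_all del: quot_simps add: quot_simps(2,3))
  have "\<ominus>\<^bsub>quot A I\<^esub> (I +> b) = (-1) \<odot>\<^bsub>quot A I\<^esub> (I +> b)"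
    using Q.A_simps(6)[OF S.coset_closed[OF assms(3)]] by (simp only:)
  also have "\<dots> = I +> (\<ominus> b)" using assms by (simp only: S.smult_coset A_simps(6))
  finally show "(I +> a) \<ominus>\<^bsub>quot A I\<^esub> (I +> b) = I +> (a \<ominus> b)"
    unfolding a_minus_def using assms by (simp only: S.coset_add a_inv_closed)
qed

context subspace_of
begin

text \<open>A linear functional \<open>\<epsilon>\<close> with kernel \<open>W\<close> and \<open>\<epsilon> u = 1\<close> splits each \<open>v\<close> into \<open>\<epsilon> v \<odot> u\<close> and an element of
  \<open>W\<close>, so the class of \<open>u\<close> spans the quotient and is not zero.\<close>

lemma quot_dim_one:
  assumes add: "\<And>v w. v \<in> carrier V \<Longrightarrow> w \<in> carrier V \<Longrightarrow> \<epsilon> (v \<oplus> w) = \<epsilon> v + \<epsilon> w"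
    and smult: "\<And>c v. v \<in> carrier V \<Longrightarrow> \<epsilon> (c \<odot> v) = c * \<epsilon> v"
    and ker: "\<And>v. v \<in> carrier V \<Longrightarrow> \<epsilon> v = 0 \<longleftrightarrow> v \<in> W"
    and u: "u \<in> carrier V" "\<epsilon> u = 1"
  shows "vectorspace class_ring (quot V W) \<and> vectorspace.fin_dim class_ring (quot V W)
    \<and> vectorspace.dim class_ring (quot V W) = 1"
proof -
  let ?Q = "quot V W" and ?u = "W +> u"
  interpret Q: vectorspace class_ring ?Q
    by (rule vectorspace.intro[OF quot_module class_field])
  have uQ: "?u \<in> carrier ?Q" using u by (intro coset_closed)
  have "X \<in> Q.span {?u}" if X: "X \<in> carrier ?Q" for X
  proof -
    obtain v where v: "v \<in> carrier V" "X = W +> v" using X by (rule coset_cases)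
    define w where "w = v \<oplus> (- \<epsilon> v) \<odot> u"
    have closed: "\<epsilon> v \<odot> u \<in> carrier V" "(- \<epsilon> v) \<odot> u \<in> carrier V" "w \<in> carrier V"
      using v u V_simps(1) V_add_closed by (simp_all add: w_def)
    have "\<epsilon> w = 0" using closed v u by (simp add: w_def add smult)
    then have "w \<in> W" using ker closed by simp
    have "w \<oplus> \<epsilon> v \<odot> u = v \<oplus> ((- \<epsilon> v) \<odot> u \<oplus> \<epsilon> v \<odot> u)"
      unfolding w_def using closed v by (simp only: a_assoc)
    also have "(- \<epsilon> v) \<odot> u \<oplus> \<epsilon> v \<odot> u = (- \<epsilon> v + \<epsilon> v) \<odot> u" using u by (simp only: V_simps)
    also have "\<dots> = \<zero>" using u by (simp add: V_simps)
    finally have "w \<oplus> \<epsilon> v \<odot> u = v" using v by simp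
    then have "X = (W +> w) \<oplus>\<^bsub>?Q\<^esub> (W +> (\<epsilon> v \<odot> u))" using v closed by (simp only: coset_add)
    also have "W +> w = \<zero>\<^bsub>?Q\<^esub>" using coset_eq_zero_iff \<open>w \<in> W\<close> closed by blast
    also have "W +> (\<epsilon> v \<odot> u) = \<epsilon> v \<odot>\<^bsub>?Q\<^esub> ?u" using u by (simp only: smult_coset)
    finally have eq: "X = \<zero>\<^bsub>?Q\<^esub> \<oplus>\<^bsub>?Q\<^esub> \<epsilon> v \<odot>\<^bsub>?Q\<^esub> ?u" .
    have cl: "\<epsilon> v \<odot>\<^bsub>?Q\<^esub> ?u \<in> carrier ?Q" by (rule Q.smult_closed) (use uQ in simp_all)
    have "Q.lincomb (\<lambda>_. \<epsilon> v) {?u} = \<epsilon> v \<odot>\<^bsub>?Q\<^esub> ?u"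
      unfolding Q.lincomb_def using cl by (simp del: quot_simps)
    with eq have "X = Q.lincomb (\<lambda>_. \<epsilon> v) {?u}" using Q.l_zero[OF cl] by simp
    then show ?thesis unfolding Q.span_def by (auto intro!: exI[of _ "{?u}"] exI[of _ "\<lambda>_. \<epsilon> v"])
  qed
  then have gen: "Q.gen_set {?u}"
    using Q.span_is_subset2[of "{?u}"] uQ by auto
  have empty: "\<not> Q.gen_set {}"
  proof
    assume "Q.gen_set {}"
    then have "?u \<in> Q.span {}" using uQ by simp
    then have "?u = \<zero>\<^bsub>?Q\<^esub>" by (auto simp: Q.span_def Q.lincomb_def simp del: quot_simps)
    then show False using coset_eq_zero_iff[OF u(1)] ker[OF u(1)] u(2) by simp
  qed
  have "Q.fin_dim" unfolding Q.fin_dim_def using gen uQ by (intro exI[of _ "{?u}"]) simp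
  moreover have "Q.dim = 1" unfolding Q.dim_def
  proof (rule Least_equality)
    show "\<exists>A. finite A \<and> card A = 1 \<and> A \<subseteq> carrier ?Q \<and> Q.gen_set A"
      using gen uQ by (intro exI[of _ "{?u}"]) simp
    show "1 \<le> n" if "\<exists>A. finite A \<and> card A = n \<and> A \<subseteq> carrier ?Q \<and> Q.gen_set A" for n
      using that empty by (cases n) auto
  qed
  ultimately show ?thesis using Q.vectorspace_axioms by blast
qed

end

section \<open>Derivations of an algebra\<close>

context kalgebra
begin

lemma Der_iff: "D \<in> Der A \<longleftrightarrow> D \<in> extensional (carrier A) \<and> (\<forall>x\<in>carrier A. D x \<in> carrier A)
   \<and> (\<forall>x\<in>carrier A. \<forall>y\<in>carrier A. D (x \<oplus> y) = D x \<oplus> D y)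
   \<and> (\<forall>c. \<forall>x\<in>carrier A. D (c \<odot> x) = c \<odot> D x)
   \<and> (\<forall>x\<in>carrier A. \<forall>y\<in>carrier A. D (x \<otimes> y) = D x \<otimes> y \<oplus> x \<otimes> D y)"
  by (auto simp: Der_def LinearCombinations.module_hom_def)

lemma Der_space_simps [simp]:
  "carrier (Der_space A) = Der A" "\<zero>\<^bsub>Der_space A\<^esub> = (\<lambda>x\<in>carrier A. \<zero>)"
  "D \<oplus>\<^bsub>Der_space A\<^esub> D' = (\<lambda>x\<in>carrier A. D x \<oplus> D' x)"
  "c \<odot>\<^bsub>Der_space A\<^esub> D = (\<lambda>x\<in>carrier A. c \<odot> D x)"
  by (simp_all add: Der_space_def)

lemma add_swap: "a \<in> carrier A \<Longrightarrow> b \<in> carrier A \<Longrightarrow> c \<in> carrier A \<Longrightarrow> d \<in> carrier A \<Longrightarrow>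
    (a \<oplus> b) \<oplus> (c \<oplus> d) = (a \<oplus> c) \<oplus> (b \<oplus> d)"
  by algebra

lemma Der_zero: "(\<lambda>x\<in>carrier A. \<zero>) \<in> Der A"
  by (auto simp: Der_iff)

lemma Der_add: "D \<in> Der A \<Longrightarrow> D' \<in> Der A \<Longrightarrow> (\<lambda>x\<in>carrier A. D x \<oplus> D' x) \<in> Der A"
  unfolding Der_iff
  by (auto simp: add_swap A_simps l_distr r_distr)

lemma Der_smult: "D \<in> Der A \<Longrightarrow> (\<lambda>x\<in>carrier A. c \<odot> D x) \<in> Der A"
  unfolding Der_iff
  by (auto simp: A_simps smult_mult_left smult_mult_right mult.commute simp flip: A_simps(4))

lemma Der_eqI: "D \<in> extensional (carrier A) \<Longrightarrow> D' \<in> extensional (carrier A) \<Longrightarrow>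
    (\<And>x. x \<in> carrier A \<Longrightarrow> D x = D' x) \<Longrightarrow> D = D'"
  by (rule extensionalityI)

lemma Der_space_module: "Module.module class_ring (Der_space A)"
proof (rule class_moduleI)
  show "abelian_group (Der_space A)"
  proof (rule abelian_groupI)
    fix D assume D: "D \<in> carrier (Der_space A)"
    let ?D' = "\<lambda>x\<in>carrier A. (-1) \<odot> D x"
    have "?D' \<in> carrier (Der_space A)" using D by (simp only: Der_space_simps Der_smult)
    moreover have "?D' \<oplus>\<^bsub>Der_space A\<^esub> D = \<zero>\<^bsub>Der_space A\<^esub>"
      using D by (auto simp: A_simps(6) Der_iff l_neg intro!: restrict_ext)
    ultimately show "\<exists>D'\<in>carrier (Der_space A). D' \<oplus>\<^bsub>Der_space A\<^esub> D = \<zero>\<^bsub>Der_space A\<^esub>" by blast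
  next
    fix D D' assume "D \<in> carrier (Der_space A)" "D' \<in> carrier (Der_space A)"
    then show "D \<oplus>\<^bsub>Der_space A\<^esub> D' \<in> carrier (Der_space A)"
      by (simp only: Der_space_simps Der_add)
  next
    show "\<zero>\<^bsub>Der_space A\<^esub> \<in> carrier (Der_space A)" by (simp only: Der_space_simps Der_zero)
  qed (auto simp: Der_iff a_assoc intro!: restrict_ext a_comm extensionalityI[where A = "carrier A"])
next
  fix c D assume "D \<in> carrier (Der_space A)"
  then show "c \<odot>\<^bsub>Der_space A\<^esub> D \<in> carrier (Der_space A)"
    by (simp only: Der_space_simps Der_smult)
qed (auto simp: A_simps Der_iff intro!: restrict_ext extensionalityI[where A = "carrier A"])

lemma ad_apply: "x \<in> carrier A \<Longrightarrow> ad A a x = a \<otimes> x \<ominus> x \<otimes> a"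
  by (simp add: ad_def)

lemma ad_Der:
  assumes "a \<in> carrier A"
  shows "ad A a \<in> Der A"
proof -
  have "a \<otimes> (x \<oplus> y) \<ominus> (x \<oplus> y) \<otimes> a = (a \<otimes> x \<ominus> x \<otimes> a) \<oplus> (a \<otimes> y \<ominus> y \<otimes> a)"
    "a \<otimes> (x \<otimes> y) \<ominus> (x \<otimes> y) \<otimes> a = (a \<otimes> x \<ominus> x \<otimes> a) \<otimes> y \<oplus> x \<otimes> (a \<otimes> y \<ominus> y \<otimes> a)"
    if "x \<in> carrier A" "y \<in> carrier A" for x y
    using assms that by algebra+
  moreover have "a \<otimes> (c \<odot> x) \<ominus> (c \<odot> x) \<otimes> a = c \<odot> (a \<otimes> x \<ominus> x \<otimes> a)" if "x \<in> carrier A" for x c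
    using assms that
    by (simp add: a_minus_def smult_mult_left smult_mult_right A_simps mult.commute
        flip: A_simps(6) A_simps(4))
  ultimately show ?thesis using assms by (auto simp: Der_iff ad_def A_simps)
qed

lemma InnDer_subspace: "subspace_of (Der_space A) (InnDer A)"
proof (intro subspace_of.intro Der_space_module subspace_of_axioms.intro)
  show "InnDer A \<subseteq> carrier (Der_space A)" by (auto simp: InnDer_def ad_Der)
  have "ad A \<zero> = (\<lambda>x\<in>carrier A. \<zero>)" by (auto simp: ad_def a_minus_def intro!: restrict_ext)
  then show "\<zero>\<^bsub>Der_space A\<^esub> \<in> InnDer A" by (auto simp: InnDer_def intro!: image_eqI[of _ _ \<zero>])
next
  fix D D' assume "D \<in> InnDer A" "D' \<in> InnDer A"
  then obtain a b where ab: "a \<in> carrier A" "b \<in> carrier A" and D: "D = ad A a" "D' = ad A b"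
    by (auto simp: InnDer_def)
  have "(a \<oplus> b) \<otimes> x \<ominus> x \<otimes> (a \<oplus> b) = (a \<otimes> x \<ominus> x \<otimes> a) \<oplus> (b \<otimes> x \<ominus> x \<otimes> b)" if "x \<in> carrier A" for x
    using ab that by algebra
  then have "D \<oplus>\<^bsub>Der_space A\<^esub> D' = ad A (a \<oplus> b)"
    unfolding D by (auto simp: ad_def intro!: restrict_ext)
  then show "D \<oplus>\<^bsub>Der_space A\<^esub> D' \<in> InnDer A" using ab by (simp add: InnDer_def)
next
  fix D c assume "D \<in> InnDer A"
  then obtain a where a: "a \<in> carrier A" and D: "D = ad A a" by (auto simp: InnDer_def)
  have "(c \<odot> a) \<otimes> x \<ominus> x \<otimes> (c \<odot> a) = c \<odot> (a \<otimes> x \<ominus> x \<otimes> a)" if "x \<in> carrier A" for x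
    using a that
    by (simp add: a_minus_def smult_mult_left smult_mult_right A_simps mult.commute
        flip: A_simps(6) A_simps(4))
  then have "c \<odot>\<^bsub>Der_space A\<^esub> D = ad A (c \<odot> a)"
    unfolding D by (auto simp: ad_def intro!: restrict_ext)
  then show "c \<odot>\<^bsub>Der_space A\<^esub> D \<in> InnDer A" using a A_simps(1) by (simp add: InnDer_def)
qed

end

section \<open>Algebras embedded in the quantum torus\<close>

context quantum_torus
begin

definition torus_hom :: "('k, 'a) module \<Rightarrow> ('a \<Rightarrow> 'k torus) \<Rightarrow> bool" where
  "torus_hom A h \<longleftrightarrow> (\<forall>a\<in>carrier A. \<forall>b\<in>carrier A.
       h (a \<oplus>\<^bsub>A\<^esub> b) = h a + h b \<and> h (a \<otimes>\<^bsub>A\<^esub> b) = h a \<star> h b)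
     \<and> (\<forall>c. \<forall>a\<in>carrier A. h (c \<odot>\<^bsub>A\<^esub> a) = scl c (h a)) \<and> h \<one>\<^bsub>A\<^esub> = mono 0 0"

lemma torus_homD:
  assumes "torus_hom A h" "a \<in> carrier A"
  shows "b \<in> carrier A \<Longrightarrow> h (a \<oplus>\<^bsub>A\<^esub> b) = h a + h b"
    "b \<in> carrier A \<Longrightarrow> h (a \<otimes>\<^bsub>A\<^esub> b) = h a \<star> h b" "h (c \<odot>\<^bsub>A\<^esub> a) = scl c (h a)"
    "h \<one>\<^bsub>A\<^esub> = mono 0 0"
  using assms by (auto simp: torus_hom_def)

lemma torus_hom_zero:
  fixes A :: "('k, 'a) module" (structure)
  assumes "kalgebra A" "torus_hom A h"
  shows "h \<zero>\<^bsub>A\<^esub> = 0"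
proof -
  interpret kalgebra A by fact
  have "h \<zero> + h \<zero> = h \<zero>" using torus_homD(1)[OF assms(2), of \<zero> \<zero>] by simp
  then show ?thesis by simp
qed

lemma torus_hom_neg:
  fixes A :: "('k, 'a) module" (structure)
  assumes "kalgebra A" "torus_hom A h" "a \<in> carrier A"
  shows "h (\<ominus>\<^bsub>A\<^esub> a) = - h a"
proof -
  interpret kalgebra A by fact
  show ?thesis using torus_homD(3)[OF assms(2,3), of "-1"] assms(3)
    by (simp add: A_simps(6) scl_minus_left)
qed

lemma torus_hom_minus:
  fixes A :: "('k, 'a) module" (structure)
  assumes "kalgebra A" "torus_hom A h" "a \<in> carrier A" "b \<in> carrier A"
  shows "h (a \<ominus>\<^bsub>A\<^esub> b) = h a - h b"
proof -
  interpret kalgebra A by fact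
  show ?thesis using torus_homD(1)[OF assms(2,3), of "\<ominus> b"] torus_hom_neg[OF assms(1,2,4)] assms(4)
    by (simp add: a_minus_def)
qed

lemma torus_hom_kernel_ideal:
  fixes A :: "('k, 'a) module" (structure)
  assumes "kalgebra A" "torus_hom A h"
  shows "ideal {a \<in> carrier A. h a = 0} A"
proof -
  interpret kalgebra A by fact
  note hD = torus_homD[OF assms(2)]
  show ?thesis
  proof (rule idealI)
    show "subgroup {a \<in> carrier A. h a = 0} (add_monoid A)"
      using hD(1) torus_hom_zero[OF assms] torus_hom_neg[OF assms]
      by (intro subgroup.intro) (auto simp flip: a_inv_def)
  qed (auto simp: hD(2) ring_axioms)
qed

lemma torus_hom_quot:
  fixes A :: "('k, 'a) module" (structure)
  assumes "kalgebra A" "ideal I A" "torus_hom A h" "\<And>a. a \<in> I \<Longrightarrow> h a = 0"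
  obtains h' where "torus_hom (quot A I) h'" "\<And>a. a \<in> carrier A \<Longrightarrow> h' (I +>\<^bsub>A\<^esub> a) = h a"
proof -
  interpret kalgebra A by fact
  interpret I: ideal I A by fact
  interpret S: subspace_of A I by (rule ideal_subspace) fact
  note hD = torus_homD[OF assms(3)]
  define h' where "h' X = h (SOME a. a \<in> X)" for X
  have h': "h' (I +> a) = h a" if a: "a \<in> carrier A" for a
  proof -
    have "(SOME b. b \<in> I +> a) \<in> I +> a" using I.a_rcos_self[OF a] by (rule someI)
    then obtain i where i: "i \<in> I" "(SOME b. b \<in> I +> a) = i \<oplus> a" by (auto simp: a_r_coset_def')
    then show ?thesis using hD(1)[of i a] I.a_subset assms(4)[of i] a by (auto simp: h'_def)
  qed
  note mult = quot_coset_simps(2)[OF assms(2)]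
  have one: "\<one>\<^bsub>quot A I\<^esub> = I +> \<one>" by simp
  have "torus_hom (quot A I) h'" unfolding torus_hom_def
  proof (intro conjI ballI allI)
    fix X Y assume "X \<in> carrier (quot A I)" "Y \<in> carrier (quot A I)"
    then obtain a b where "a \<in> carrier A" "b \<in> carrier A" "X = I +> a" "Y = I +> b"
      by (meson S.coset_cases)
    then show "h' (X \<oplus>\<^bsub>quot A I\<^esub> Y) = h' X + h' Y" "h' (X \<otimes>\<^bsub>quot A I\<^esub> Y) = h' X \<star> h' Y"
      by (simp_all only: S.coset_add mult h' hD m_closed S.V_add_closed)
  next
    fix X c assume "X \<in> carrier (quot A I)"
    then obtain a where "a \<in> carrier A" "X = I +> a" by (meson S.coset_cases)
    then show "h' (c \<odot>\<^bsub>quot A I\<^esub> X) = scl c (h' X)"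
      by (simp only: S.smult_coset h' hD S.V_simps(1))
  next
    show "h' \<one>\<^bsub>quot A I\<^esub> = mono 0 0" unfolding one using h'[OF one_closed] hD(4)[OF one_closed] by simp
  qed
  with h' show ?thesis using that by blast
qed

end

text \<open>Algebras that an injective homomorphism \<open>h\<close> identifies with the subalgebra \<open>S\<close>. Identities between
  their elements are checked in the torus.\<close>

locale torus_algebra = rank_two p r s \<alpha> \<gamma> \<beta> \<delta> + kalgebra A
  for p :: "'k::field_char_0" and r s \<alpha> \<gamma> \<beta> \<delta> and A :: "('k, 'a) module" (structure) +
  fixes h :: "'a \<Rightarrow> 'k torus"
  assumes hom: "torus_hom A h" and inj: "inj_on h (carrier A)" and img: "h ` carrier A = S"
    and nz: "\<alpha> \<noteq> 0 \<or> \<beta> \<noteq> 0"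
begin

lemma h_simps:
  "a \<in> carrier A \<Longrightarrow> b \<in> carrier A \<Longrightarrow> h (a \<oplus> b) = h a + h b"
  "a \<in> carrier A \<Longrightarrow> b \<in> carrier A \<Longrightarrow> h (a \<otimes> b) = h a \<star> h b"
  "a \<in> carrier A \<Longrightarrow> h (c \<odot> a) = scl c (h a)"
  "a \<in> carrier A \<Longrightarrow> b \<in> carrier A \<Longrightarrow> h (a \<ominus> b) = h a - h b"
  using torus_homD[OF hom] torus_hom_minus[OF kalgebra_axioms hom] by auto

lemma h_S: "a \<in> carrier A \<Longrightarrow> h a \<in> S"
  using img by auto

lemma h_eqD: "h a = h b \<Longrightarrow> a \<in> carrier A \<Longrightarrow> b \<in> carrier A \<Longrightarrow> a = b"
  using inj by (auto dest: inj_onD)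

definition g :: "'k torus \<Rightarrow> 'a" where
  "g = inv_into (carrier A) h"

lemma g_simps: "t \<in> S \<Longrightarrow> h (g t) = t" "t \<in> S \<Longrightarrow> g t \<in> carrier A" "a \<in> carrier A \<Longrightarrow> g (h a) = a"
  using img inj by (auto simp: g_def f_inv_into_f inv_into_into inv_into_f_f)

lemma ad_eq: "a \<in> carrier A \<Longrightarrow> z \<in> carrier A \<Longrightarrow> h (ad A a z) = h a \<star> h z - h z \<star> h a"
  by (simp add: ad_apply h_simps)

lemma Der_form:
  assumes "D \<in> Der A"
  obtains a c d where "a \<in> carrier A" "c = 0 \<or> \<alpha> = 0" "d = 0 \<or> \<beta> = 0"
    "\<And>z. z \<in> carrier A \<Longrightarrow> h (D z) = h a \<star> h z - h z \<star> h a + euler c d (h z)"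
proof -
  note D = assms[unfolded Der_iff]
  have "\<exists>t\<in>S. \<exists>c d. (c = 0 \<or> \<alpha> = 0) \<and> (d = 0 \<or> \<beta> = 0)
    \<and> (\<forall>a\<in>S. h (D (g a)) = t \<star> a - a \<star> t + euler c d a)"
  proof (rule derivation_form[OF nz])
    fix t u c assume t: "t \<in> S"
    show "h (D (g t)) \<in> S" using D t g_simps(2) h_S by blast
    have "g (scl c t) = c \<odot> g t"
      using t by (intro h_eqD) (simp_all add: g_simps h_simps S.scl A_simps)
    then show "h (D (g (scl c t))) = scl c (h (D (g t)))" using D t by (simp add: g_simps h_simps)
    assume u: "u \<in> S"
    have "g (t + u) = g t \<oplus> g u" "g (t \<star> u) = g t \<otimes> g u"
      using t u by (intro h_eqD; simp add: g_simps h_simps S.add S_tmul)+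
    then show "h (D (g (t + u))) = h (D (g t)) + h (D (g u))"
      "h (D (g (t \<star> u))) = h (D (g t)) \<star> u + t \<star> h (D (g u))"
      using D t u by (simp_all add: g_simps h_simps)
  qed
  then obtain t c d where t: "t \<in> S" "c = 0 \<or> \<alpha> = 0" "d = 0 \<or> \<beta> = 0"
    and eq: "\<forall>a\<in>S. h (D (g a)) = t \<star> a - a \<star> t + euler c d a" by blast
  have "h (D z) = h (g t) \<star> h z - h z \<star> h (g t) + euler c d (h z)" if "z \<in> carrier A" for z
    using eq[rule_format, OF h_S[OF that]] g_simps(1)[OF t(1)] g_simps(3)[OF that] by simp
  then show thesis using that[OF g_simps(2)[OF t(1)] t(2,3)] by blast
qed

lemma euler_Der:
  assumes "c = 0 \<or> \<alpha> = 0" "d = 0 \<or> \<beta> = 0"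
  defines "D \<equiv> \<lambda>z\<in>carrier A. g (euler c d (h z))"
  shows "D \<in> Der A" "z \<in> carrier A \<Longrightarrow> h (D z) = euler c d (h z)"
proof -
  note eS = euler_S[OF assms(1,2)]
  show hD: "h (D z) = euler c d (h z)" if "z \<in> carrier A" for z
    using that by (simp add: D_def g_simps eS h_S)
  have cl: "D z \<in> carrier A" if "z \<in> carrier A" for z
    using that by (simp add: D_def g_simps eS h_S)
  show "D \<in> Der A" unfolding Der_iff
    by (auto intro!: h_eqD simp: hD cl h_simps euler_tmul A_simps) (simp add: D_def)
qed

lemma Inn_if_no_euler:
  assumes "D \<in> Der A" "a \<in> carrier A"
    "\<And>z. z \<in> carrier A \<Longrightarrow> h (D z) = h a \<star> h z - h z \<star> h a"
  shows "D \<in> InnDer A"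
proof -
  have "D z = ad A a z" if "z \<in> carrier A" for z
    using that assms ad_Der[OF assms(2)] by (intro h_eqD) (auto simp: ad_eq Der_iff)
  then have "D = ad A a"
    using assms(1) ad_Der[OF assms(2)] by (intro Der_eqI) (auto simp: Der_iff)
  then show ?thesis using assms(2) by (simp add: InnDer_def)
qed

theorem Der_inner:
  assumes "\<alpha> \<noteq> 0" "\<beta> \<noteq> 0" "D \<in> Der A"
  shows "D \<in> InnDer A"
proof -
  obtain a c d where "a \<in> carrier A" "c = 0 \<or> \<alpha> = 0" "d = 0 \<or> \<beta> = 0"
    "\<And>z. z \<in> carrier A \<Longrightarrow> h (D z) = h a \<star> h z - h z \<star> h a + euler c d (h z)"
    using Der_form[OF assms(3)] by blast
  then show ?thesis using assms by (intro Inn_if_no_euler[of D a]) (auto simp: euler_0)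
qed

theorem HH1_trivial:
  assumes "\<alpha> \<noteq> 0" "\<beta> \<noteq> 0"
  shows "carrier (HH1 A) = {\<zero>\<^bsub>HH1 A\<^esub>}"
proof -
  interpret I: subspace_of "Der_space A" "InnDer A" by (rule InnDer_subspace)
  have "X = \<zero>\<^bsub>HH1 A\<^esub>" if X: "X \<in> carrier (HH1 A)" for X
  proof -
    obtain D where "D \<in> carrier (Der_space A)" "X = InnDer A +>\<^bsub>Der_space A\<^esub> D"
      using X unfolding HH1_def by (rule I.coset_cases)
    then show ?thesis using I.coset_eq_zero_iff[of D] Der_inner[OF assms, of D]
      unfolding HH1_def by auto
  qed
  moreover have "\<zero>\<^bsub>HH1 A\<^esub> \<in> carrier (HH1 A)"
    unfolding HH1_def I.zero_coset by (rule I.coset_closed) (simp add: Der_zero)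
  ultimately show ?thesis by blast
qed

text \<open>The functional reads off the coefficient of \<open>m\<close> in \<open>D m\<close>, where \<open>m\<close> is \<open>x\<close> or \<open>y\<close>. It vanishes on inner
  derivations: to \<open>[t, m]\<close> at the position of \<open>m\<close> only the constant term of \<open>t\<close> could contribute, and it
  commutes with \<open>m\<close>.\<close>

lemma HH1_dim_one:
  assumes m: "single m 1 \<in> S" "m = (1, 0) \<or> m = (0, 1)"
    and ab: "m = (1, 0) \<Longrightarrow> \<alpha> = 0 \<and> \<beta> \<noteq> 0" "m = (0, 1) \<Longrightarrow> \<beta> = 0 \<and> \<alpha> \<noteq> 0"
  shows "vectorspace class_ring (HH1 A) \<and> vectorspace.fin_dim class_ring (HH1 A)
    \<and> vectorspace.dim class_ring (HH1 A) = 1"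
proof -
  interpret I: subspace_of "Der_space A" "InnDer A" by (rule InnDer_subspace)
  define w where "w = g (single m 1)"
  have w: "w \<in> carrier A" "h w = single m 1" using m by (simp_all add: w_def g_simps)
  define \<epsilon> where "\<epsilon> D = lookup (h (D w)) m" for D
  have comm: "lookup (t \<star> single m 1 - single m 1 \<star> t) m = 0" for t
    using m(2) by (auto simp: lookup_minus tmul_mono_lookup mono_tmul_lookup)
  define u where "u = (if m = (1, 0) then euler 1 0 else euler 0 1 :: 'k torus \<Rightarrow> 'k torus)"
  show ?thesis unfolding HH1_def
  proof (rule I.quot_dim_one[of \<epsilon>])
    fix D D' assume "D \<in> carrier (Der_space A)" "D' \<in> carrier (Der_space A)"
    then show "\<epsilon> (D \<oplus>\<^bsub>Der_space A\<^esub> D') = \<epsilon> D + \<epsilon> D'"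
      using w by (simp add: \<epsilon>_def Der_iff h_simps lookup_add)
  next
    fix D c assume "D \<in> carrier (Der_space A)"
    then show "\<epsilon> (c \<odot>\<^bsub>Der_space A\<^esub> D) = c * \<epsilon> D"
      using w by (simp add: \<epsilon>_def Der_iff h_simps)
  next
    fix D assume "D \<in> carrier (Der_space A)"
    then have D: "D \<in> Der A" by simp
    obtain a c d where a: "a \<in> carrier A" "c = 0 \<or> \<alpha> = 0" "d = 0 \<or> \<beta> = 0"
      and eq: "\<And>z. z \<in> carrier A \<Longrightarrow> h (D z) = h a \<star> h z - h z \<star> h a + euler c d (h z)"
      using Der_form[OF D] by blast
    have \<epsilon>: "\<epsilon> D = (if m = (1, 0) then c else d)"
      using comm[of "h a"] m(2) by (auto simp: \<epsilon>_def eq w lookup_add)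
    show "\<epsilon> D = 0 \<longleftrightarrow> D \<in> InnDer A"
    proof
      assume "\<epsilon> D = 0"
      then have "c = 0 \<and> d = 0" using \<epsilon> a ab m(2) by (auto split: if_splits)
      then show "D \<in> InnDer A" using eq by (intro Inn_if_no_euler[OF D a(1)]) (simp add: euler_0)
    next
      assume "D \<in> InnDer A"
      then obtain b where "b \<in> carrier A" "D = ad A b" by (auto simp: InnDer_def)
      then show "\<epsilon> D = 0" using w comm by (simp add: \<epsilon>_def ad_eq)
    qed
  next
    let ?c = "if m = (1, 0) then 1 else 0 :: 'k" and ?d = "if m = (1, 0) then 0 else 1 :: 'k"
    have cd: "?c = 0 \<or> \<alpha> = 0" "?d = 0 \<or> \<beta> = 0" using ab m(2) by auto
    show "(\<lambda>z\<in>carrier A. g (euler ?c ?d (h z))) \<in> carrier (Der_space A)"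
      using euler_Der(1)[OF cd] by simp
    show "\<epsilon> (\<lambda>z\<in>carrier A. g (euler ?c ?d (h z))) = 1"
      unfolding \<epsilon>_def euler_Der(2)[OF cd w(1)] using m(2) w by (auto simp: lookup_single)
  qed
qed

end

section \<open>Spanning by fan monomials\<close>

lemma single_0_central:
  fixes f :: "'b::monoid_add \<Rightarrow>\<^sub>0 'k::field"
  shows "single 0 c * f = f * single 0 c"
  by (induction f rule: poly_mapping_add_induct) (simp_all add: distrib_left distrib_right mult_single mult.commute)

lemma scl_mult [simp]:
  fixes f g :: "'b::monoid_add \<Rightarrow>\<^sub>0 'k::field"
  shows "scl c f * g = scl c (f * g)" "f * scl c g = scl c (f * g)"
proof -
  have s: "scl c h = single 0 c * h" for h :: "'b \<Rightarrow>\<^sub>0 'k" by (simp add: scl_def mult_map_scale_conv_mult)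
  show "scl c f * g = scl c (f * g)" by (simp add: s mult.assoc)
  show "f * scl c g = scl c (f * g)" unfolding s by (metis mult.assoc single_0_central)
qed

lemma power_pull: "a ^ n * (a * b) = a * (a ^ n * b)" for a b :: "'a::monoid_mult"
  by (simp add: power_commutes flip: mult.assoc)

text \<open>Congruences modulo a two-sided ideal \<open>I\<close> by which \<open>e1, x, y, e4\<close> can be sorted. Neighbours in the
  cyclic order \<open>e1, x, y, e4\<close> commute up to scalars (or, for \<open>e4\<close> and \<open>e1\<close>, up to a multiple of \<open>x\<close>),
  while products of opposite ones are polynomials in the element between them.\<close>

locale fan_relations =
  fixes I :: "('b::monoid_add \<Rightarrow>\<^sub>0 'k::field) set"
    and e1 x y e4 :: "'b \<Rightarrow>\<^sub>0 'k"
    and \<alpha> \<beta> \<gamma> \<delta> \<delta>' c1 c2 c3 c5 c6 :: 'k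
  assumes I_zero: "0 \<in> I" and I_add: "a \<in> I \<Longrightarrow> b \<in> I \<Longrightarrow> a + b \<in> I"
    and I_left: "a \<in> I \<Longrightarrow> b * a \<in> I" and I_right: "a \<in> I \<Longrightarrow> a * b \<in> I"
    and c_nonzero: "c1 \<noteq> 0" "c2 \<noteq> 0"
    and rel_x_e1: "x * e1 - scl c1 (e1 * x) \<in> I"
    and rel_y_x: "y * x - scl c2 (x * y) \<in> I"
    and rel_e4_y: "e4 * y - scl c3 (y * e4) \<in> I"
    and rel_x_e4: "x * e4 - (scl \<beta> 1 + scl \<delta> y) \<in> I"
    and rel_e4_x: "e4 * x - (scl \<beta> 1 + scl \<delta>' y) \<in> I"
    and rel_e1_y: "e1 * y - (scl \<alpha> 1 + scl \<gamma> (x * x)) \<in> I"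
    and rel_e4_e1: "e4 * e1 - (scl c5 (e1 * e4) + scl c6 x) \<in> I"
begin

definition eqv (infix \<open>\<approx>\<close> 50) where "a \<approx> b \<longleftrightarrow> a - b \<in> I"

lemma I_scl: "a \<in> I \<Longrightarrow> scl c a \<in> I"
  using I_left[of a "scl c 1"] by simp

lemma I_minus: "a \<in> I \<Longrightarrow> - a \<in> I"
  using I_scl[of a "-1"] by (simp add: scl_minus_left)

lemma eqv_refl: "a \<approx> a"
  by (simp add: eqv_def I_zero)

lemma eqv_sym: "a \<approx> b \<Longrightarrow> b \<approx> a"
  unfolding eqv_def using I_minus by fastforce

lemma eqv_trans [trans]: "a \<approx> b \<Longrightarrow> b \<approx> c \<Longrightarrow> a \<approx> c"
  unfolding eqv_def using I_add[of "a - b" "b - c"] by simp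

lemma eqv_add: "a \<approx> b \<Longrightarrow> a' \<approx> b' \<Longrightarrow> a + a' \<approx> b + b'"
  unfolding eqv_def using I_add[of "a - b" "a' - b'"] by (simp add: algebra_simps)

lemma eqv_scl: "a \<approx> b \<Longrightarrow> scl c a \<approx> scl c b"
  unfolding eqv_def using I_scl[of "a - b" c] by simp

lemma eqv_sub: "a \<approx> b \<Longrightarrow> u * a * v \<approx> u * b * v"
  unfolding eqv_def using I_right[OF I_left, of "a - b" u v] by (simp add: algebra_simps)

lemma eqv_left: "a \<approx> b \<Longrightarrow> u * a \<approx> u * b"
  using eqv_sub[of a b u 1] by simp

lemma eqv_right: "a \<approx> b \<Longrightarrow> a * v \<approx> b * v"
  using eqv_sub[of a b 1 v] by simp

lemma q_commute_inverse: "a * b \<approx> scl c (b * a) \<Longrightarrow> c \<noteq> 0 \<Longrightarrow> b * a \<approx> scl (1 / c) (a * b)"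
  using eqv_sym[OF eqv_scl[of "a * b" "scl c (b * a)" "1 / c"]] by simp

lemma q_commute_power_right: "a * b \<approx> scl c (b * a) \<Longrightarrow> a * b ^ n \<approx> scl (c ^ n) (b ^ n * a)"
proof (induction n)
  case (Suc n)
  have "a * b ^ Suc n = a * b * b ^ n" by (simp add: mult.assoc)
  also have "\<dots> \<approx> scl c (b * a) * b ^ n" by (rule eqv_right) fact
  also have "scl c (b * a) * b ^ n = scl c (b * (a * b ^ n))" by (simp add: mult.assoc)
  also have "\<dots> \<approx> scl c (b * scl (c ^ n) (b ^ n * a))" using Suc by (intro eqv_scl eqv_left)
  finally show ?case by (simp add: mult.assoc)
qed (simp add: eqv_refl)

lemma eqv_rels:
  "x * e1 \<approx> scl c1 (e1 * x)" "y * x \<approx> scl c2 (x * y)" "e4 * y \<approx> scl c3 (y * e4)"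
  "x * e4 \<approx> scl \<beta> 1 + scl \<delta> y" "e4 * x \<approx> scl \<beta> 1 + scl \<delta>' y"
  "e1 * y \<approx> scl \<alpha> 1 + scl \<gamma> (x * x)" "e4 * e1 \<approx> scl c5 (e1 * e4) + scl c6 x"
  using rel_x_e1 rel_y_x rel_e4_y rel_x_e4 rel_e4_x rel_e1_y rel_e4_e1 by (simp_all add: eqv_def)

definition Fan :: "int \<Rightarrow> int \<Rightarrow> 'b \<Rightarrow>\<^sub>0 'k" where
  "Fan u v = e1 ^ nat (- v) * (x ^ nat u * (y ^ nat v * e4 ^ nat (- u)))"

text \<open>The span of the ideal and the fan monomials. It is a left ideal for the subalgebra generated by
  \<open>e1\<close> and \<open>e4\<close> (\<open>W_closed\<close>), so it is everything if these two generate.\<close>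

inductive_set W :: "('b \<Rightarrow>\<^sub>0 'k) set" where
  ideal: "a \<in> I \<Longrightarrow> a \<in> W"
| Fan: "Fan u v \<in> W"
| add: "a \<in> W \<Longrightarrow> b \<in> W \<Longrightarrow> a + b \<in> W"
| scl: "a \<in> W \<Longrightarrow> scl c a \<in> W"

lemma W_eqv: "a \<approx> b \<Longrightarrow> b \<in> W \<Longrightarrow> a \<in> W"
  using W.add[OF W.ideal[of "a - b"], of b] by (simp add: eqv_def)

lemma W_sub: "a \<approx> b \<Longrightarrow> u * b * v \<in> W \<Longrightarrow> u * a * v \<in> W"
  using W_eqv eqv_sub by blast

lemma cones:
  "e1 ^ i * x ^ j \<in> W" "x ^ j * y ^ k \<in> W" "y ^ k * e4 ^ l \<in> W" "e1 ^ i * e4 ^ l \<in> W"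
  using W.Fan[of "int j" "- int i"] W.Fan[of "int j" "int k"]
    W.Fan[of "- int l" "int k"] W.Fan[of "- int l" "- int i"]
  by (simp_all add: Fan_def)

text \<open>Next to each other, \<open>x\<close> and \<open>e4\<close> cancel to a polynomial in \<open>y\<close>; this lowers the exponent of \<open>e4\<close>.\<close>

lemma x_y_e4: "x ^ a * y ^ b * e4 ^ l \<in> W"
proof (induction l arbitrary: a b)
  case 0
  then show ?case using cones(2) by simp
next
  case (Suc l)
  show ?case
  proof (cases a)
    case 0
    then show ?thesis using cones(3)[of b "Suc l"] by simp
  next
    case (Suc a')
    define k where "k = (1 / c2) ^ b"
    have 1: "x * y ^ b \<approx> scl k (y ^ b * x)"
      unfolding k_def by (intro q_commute_power_right q_commute_inverse eqv_rels c_nonzero)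
    have "(x ^ a' * y ^ b) * (x * e4) * e4 ^ l \<in> W"
      by (rule W_sub[OF eqv_rels(4)])
        (use Suc.IH[of a' b] Suc.IH[of a' "Suc b"] in
          \<open>simp add: distrib_left distrib_right mult.assoc power_commutes power_pull W.add W.scl\<close>)
    then have "x ^ a' * scl k (y ^ b * x) * e4 ^ Suc l \<in> W"
      using W.scl[of _ k] by (simp add: mult.assoc)
    from W_sub[OF 1 this] show ?thesis by (simp add: Suc mult.assoc power_commutes power_pull)
  qed
qed

text \<open>Again \<open>x e4\<close> is eliminated. The factor \<open>y\<close> that it leaves behind is absorbed by \<open>e1\<close>; if there
  is no \<open>e1\<close>, the monomial is one of \<open>x_y_e4\<close>.\<close>

lemma e1_x_e4: "e1 ^ a * x ^ b * e4 ^ l \<in> W"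
proof (induction l arbitrary: a b)
  case 0
  then show ?case using cones(1) by simp
next
  case (Suc l)
  show ?case
  proof (cases b)
    case 0
    then show ?thesis using cones(4)[of a "Suc l"] by simp
  next
    case (Suc b')
    have "e1 ^ a * x ^ b' * y * e4 ^ l \<in> W"
    proof (cases a)
      case 0
      then show ?thesis using x_y_e4[of b' 1 l] by simp
    next
      case (Suc a')
      define k where "k = (1 / c1) ^ b'"
      have 1: "e1 * x ^ b' \<approx> scl k (x ^ b' * e1)"
        unfolding k_def by (intro q_commute_power_right q_commute_inverse eqv_rels c_nonzero)
      have "(e1 ^ a' * x ^ b') * (e1 * y) * e4 ^ l \<in> W"
        by (rule W_sub[OF eqv_rels(6)])
          (use Suc.IH[of a' b'] Suc.IH[of a' "Suc (Suc b')"] in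
            \<open>simp add: distrib_left distrib_right mult.assoc power_commutes power_pull W.add W.scl\<close>)
      then have "e1 ^ a' * scl k (x ^ b' * e1) * (y * e4 ^ l) \<in> W"
        using W.scl[of _ k] by (simp add: mult.assoc)
      from W_sub[OF 1 this] show ?thesis by (simp add: Suc mult.assoc power_commutes power_pull)
    qed
    then have "(e1 ^ a * x ^ b') * (x * e4) * e4 ^ l \<in> W"
      by (intro W_sub[OF eqv_rels(4)])
        (use Suc.IH[of a b'] in
          \<open>simp add: distrib_left distrib_right mult.assoc power_commutes power_pull W.add W.scl\<close>)
    then show ?thesis by (simp add: Suc mult.assoc power_commutes power_pull)
  qed
qed

lemma Fan_cases:
  obtains i j where "Fan u v = e1 ^ i * x ^ j" | j k where "Fan u v = x ^ j * y ^ k"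
  | k l where "Fan u v = y ^ k * e4 ^ l" | i l where "Fan u v = e1 ^ i * e4 ^ l"
  by (cases "u \<ge> 0"; cases "v \<ge> 0") (auto simp: Fan_def)

lemma e1_Fan: "e1 * Fan u v \<in> W"
proof (cases u v rule: Fan_cases)
  case (1 i j)
  then show ?thesis using cones(1)[of "Suc i" j] by (simp add: mult.assoc)
next
  case (2 j k)
  show ?thesis
  proof (cases k)
    case 0
    then show ?thesis using cones(1)[of 1 j] 2 by simp
  next
    case (Suc k')
    define c where "c = (1 / c1) ^ j"
    have 1: "e1 * x ^ j \<approx> scl c (x ^ j * e1)"
      unfolding c_def by (intro q_commute_power_right q_commute_inverse eqv_rels c_nonzero)
    have "x ^ j * (e1 * y) * y ^ k' \<in> W"
      by (rule W_sub[OF eqv_rels(6)])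
        (use cones(2)[of j k'] cones(2)[of "Suc (Suc j)" k'] in
          \<open>simp add: distrib_left distrib_right mult.assoc power_commutes power_pull W.add W.scl\<close>)
    then have "1 * scl c (x ^ j * e1) * (y * y ^ k') \<in> W"
      using W.scl[of _ c] by (simp add: mult.assoc)
    from W_sub[OF 1 this] show ?thesis using 2 Suc by (simp add: mult.assoc)
  qed
next
  case (3 k l)
  show ?thesis
  proof (cases k)
    case 0
    then show ?thesis using cones(4)[of 1 l] 3 by simp
  next
    case (Suc k')
    have "1 * (e1 * y) * (y ^ k' * e4 ^ l) \<in> W"
      by (rule W_sub[OF eqv_rels(6)])
        (use cones(3)[of k' l] x_y_e4[of 2 k' l] in
          \<open>simp add: distrib_right mult.assoc power2_eq_square W.add W.scl\<close>)
    then show ?thesis using 3 Suc by (simp add: mult.assoc)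
  qed
next
  case (4 i l)
  then show ?thesis using cones(4)[of "Suc i" l] by (simp add: mult.assoc)
qed

text \<open>Each \<open>e1\<close> that \<open>e4\<close> passes leaves one \<open>x\<close> in place of that \<open>e1\<close>, and all these corrections are
  proportional because \<open>x\<close> and \<open>e1\<close> commute up to a scalar.\<close>

lemma e4_e1_power: "\<exists>d. e4 * e1 ^ Suc i \<approx> scl (c5 ^ Suc i) (e1 ^ Suc i * e4) + scl d (e1 ^ i * x)"
proof (induction i)
  case 0
  show ?case using eqv_rels(7) by (intro exI[of _ c6]) simp
next
  case (Suc i)
  then obtain d where d: "e4 * e1 ^ Suc i \<approx> scl (c5 ^ Suc i) (e1 ^ Suc i * e4) + scl d (e1 ^ i * x)" ..
  have "e4 * e1 ^ Suc (Suc i) = (e4 * e1 ^ Suc i) * e1" by (simp add: mult.assoc power_commutes power_pull)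
  also have "\<dots> \<approx> (scl (c5 ^ Suc i) (e1 ^ Suc i * e4) + scl d (e1 ^ i * x)) * e1"
    by (rule eqv_right[OF d])
  also have "(scl (c5 ^ Suc i) (e1 ^ Suc i * e4) + scl d (e1 ^ i * x)) * e1
      = scl (c5 ^ Suc i) (e1 ^ Suc i * (e4 * e1)) + scl d (e1 ^ i * (x * e1))"
    by (simp add: distrib_right mult.assoc)
  also have "\<dots> \<approx> scl (c5 ^ Suc i) (e1 ^ Suc i * (scl c5 (e1 * e4) + scl c6 x))
      + scl d (e1 ^ i * scl c1 (e1 * x))"
    by (intro eqv_add eqv_scl eqv_left eqv_rels)
  also have "\<dots> = scl (c5 ^ Suc (Suc i)) (e1 ^ Suc (Suc i) * e4)
      + scl (c5 ^ Suc i * c6 + d * c1) (e1 ^ Suc i * x)"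
    by (simp add: distrib_left mult.assoc power_commutes power_pull scl_add_left mult_ac)
  finally show ?case by blast
qed

lemma e4_Fan: "e4 * Fan u v \<in> W"
proof -
  have y_e4: "e4 * (y ^ k * e4 ^ l) \<in> W" for k l
  proof -
    have "1 * scl (c3 ^ k) (y ^ k * e4) * e4 ^ l \<in> W"
      using W.scl[OF cones(3)[of k "Suc l"]] by (simp add: mult.assoc)
    from W_sub[OF q_commute_power_right[OF eqv_rels(3)] this] show ?thesis by (simp add: mult.assoc)
  qed
  have e1_case: "e4 * (e1 ^ Suc i * z) \<in> W"
    if "e1 ^ Suc i * (e4 * z) \<in> W" "e1 ^ i * (x * z) \<in> W" for i z
  proof -
    obtain d where d: "e4 * e1 ^ Suc i \<approx> scl (c5 ^ Suc i) (e1 ^ Suc i * e4) + scl d (e1 ^ i * x)"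
      using e4_e1_power by blast
    have "1 * (scl (c5 ^ Suc i) (e1 ^ Suc i * e4) + scl d (e1 ^ i * x)) * z \<in> W"
      using W.scl[OF that(1)] W.scl[OF that(2)]
      by (simp add: distrib_right mult.assoc W.add del: power_Suc)
    from W_sub[OF d this] show ?thesis by (simp add: mult.assoc del: power_Suc)
  qed
  show ?thesis
  proof (cases u v rule: Fan_cases)
    case (3 k l)
    then show ?thesis using y_e4 by simp
  next
    case (2 j k)
    show ?thesis
    proof (cases j)
      case 0
      then show ?thesis using y_e4[of k 0] 2 by simp
    next
      case (Suc j')
      have "1 * scl (c2 ^ j') (x ^ j' * y) * y ^ k \<in> W"
        using W.scl[OF cones(2)[of j' "Suc k"]] by (simp add: mult.assoc)
      from W_sub[OF q_commute_power_right[OF eqv_rels(2)] this]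
      have "y * (x ^ j' * y ^ k) \<in> W" by (simp add: mult.assoc)
      then have "1 * (e4 * x) * (x ^ j' * y ^ k) \<in> W"
        by (intro W_sub[OF eqv_rels(5)])
          (use cones(2)[of j' k] in \<open>simp add: distrib_right mult.assoc W.add W.scl\<close>)
      then show ?thesis using 2 Suc by (simp add: mult.assoc)
    qed
  next
    case (1 i j)
    show ?thesis
    proof (cases i)
      case 0
      show ?thesis
      proof (cases j)
        case (Suc j')
        have "y * x ^ j' \<in> W"
          using W_eqv[OF q_commute_power_right[OF eqv_rels(2)]] W.scl[OF cones(2)[of j' 1]] by simp
        then have "1 * (e4 * x) * x ^ j' \<in> W"
          by (intro W_sub[OF eqv_rels(5)])
            (use cones(2)[of j' 0] in \<open>simp add: distrib_right mult.assoc W.add W.scl\<close>)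
        then show ?thesis using 1 0 Suc by (simp add: mult.assoc)
      qed (use y_e4[of 0 0] 1 0 in simp)
    next
      case (Suc i')
      have "e1 ^ Suc i' * (e4 * x ^ j) \<in> W"
      proof (cases j)
        case 0
        then show ?thesis using cones(4)[of "Suc i'" 1] by simp
      next
        case (Suc j')
        have "e1 ^ i' * (e1 * y) * x ^ j' \<in> W"
          by (rule W_sub[OF eqv_rels(6)])
            (use cones(1)[of i' j'] cones(1)[of i' "Suc (Suc j')"] in
              \<open>simp add: distrib_left distrib_right mult.assoc power_commutes power_pull W.add W.scl\<close>)
        then have "e1 ^ Suc i' * (e4 * x) * x ^ j' \<in> W"
          by (intro W_sub[OF eqv_rels(5)])
            (use cones(1)[of "Suc i'" j'] in
              \<open>simp add: distrib_left distrib_right mult.assoc power_commutes power_pull W.add W.scl\<close>)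
        then show ?thesis by (simp add: Suc mult.assoc)
      qed
      then show ?thesis
        using e1_case[of i' "x ^ j"] cones(1)[of i' "Suc j"] 1 Suc by simp
    qed
  next
    case (4 i l)
    show ?thesis
    proof (cases i)
      case 0
      then show ?thesis using cones(3)[of 0 "Suc l"] 4 by simp
    next
      case (Suc i')
      then show ?thesis
        using e1_case[of i' "e4 ^ l"] cones(4)[of i "Suc l"] e1_x_e4[of i' 1 l] 4
        by (simp add: mult.assoc)
    qed
  qed
qed

lemma W_closed: "a \<in> W \<Longrightarrow> e1 * a \<in> W \<and> e4 * a \<in> W"
  by (induction rule: W.induct) (auto simp: distrib_left e1_Fan e4_Fan intro: W.add W.scl W.ideal I_left)

lemma one_W: "1 \<in> W"
  using cones(1)[of 0 0] by simp

lemma W_expansion: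
  "a \<in> W \<Longrightarrow> \<exists>c::int \<times> int \<Rightarrow>\<^sub>0 'k. a - (\<Sum>i\<in>keys c. scl (lookup c i) (Fan (fst i) (snd i))) \<in> I"
proof (induction rule: W.induct)
  case (ideal a)
  then show ?case by (intro exI[of _ 0]) simp
next
  case (Fan u v)
  show ?case by (intro exI[of _ "single (u, v) 1"]) (simp add: I_zero)
next
  case (add a b)
  let ?s = "\<lambda>c. \<Sum>i\<in>keys c. scl (lookup c i) (Fan (fst i) (snd i))"
  obtain c d where "a - ?s c \<in> I" "b - ?s d \<in> I" using add by blast
  moreover have "?s (c + d) = ?s c + ?s d"
  proof -
    have *: "?s f = (\<Sum>i\<in>keys c \<union> keys d. scl (lookup f i) (Fan (fst i) (snd i)))"
      if "keys f \<subseteq> keys c \<union> keys d" for f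
      using that by (intro sum.mono_neutral_left) (auto simp: in_keys_iff)
    have "?s (c + d) = (\<Sum>i\<in>keys c \<union> keys d. scl (lookup (c + d) i) (Fan (fst i) (snd i)))"
      by (rule *) (rule keys_add)
    also have "\<dots> = (\<Sum>i\<in>keys c \<union> keys d. scl (lookup c i) (Fan (fst i) (snd i)))
        + (\<Sum>i\<in>keys c \<union> keys d. scl (lookup d i) (Fan (fst i) (snd i)))"
      by (simp only: lookup_add scl_add_left sum.distrib)
    finally show ?thesis using *[of c] *[of d] by simp
  qed
  ultimately have "a + b - ?s (c + d) \<in> I" using I_add[of "a - ?s c" "b - ?s d"]
    by (simp add: algebra_simps)
  then show ?case by blast
next
  case (scl a e)
  let ?s = "\<lambda>c. \<Sum>i\<in>keys c. scl (lookup c i) (Fan (fst i) (snd i))"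
  obtain c where c: "a - ?s c \<in> I" using scl by blast
  have "?s (scl e c) = scl e (?s c)"
    unfolding scl_sum by (subst sum.mono_neutral_left[of "keys c"]) (auto simp: in_keys_iff)
  then have "scl e a - ?s (scl e c) \<in> I" using I_scl[OF c, of e] by simp
  then show ?case by blast
qed

end

section \<open>Relations from the quantum Serre relations\<close>

text \<open>
  In the free algebra, with \<open>a = E\<^sub>1\<close>, \<open>b = E\<^sub>4\<close>, \<open>u = q\<^sup>2\<close>, \<open>v = q\<^sup>-\<^sup>2\<close> and \<open>c = q + q\<^sup>-\<^sup>1\<close>, the Serre
  elements are multiples of \<open>z2 a - v a z2\<close> and \<open>b z3 - v z3 b\<close>. The other commutation relations
  follow by commuting the first of these twice with \<open>b\<close>, which turns \<open>a\<close> into \<open>z2\<close> and \<open>z2\<close> into \<open>z3\<close>.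
  The first step gives the relation between \<open>z3\<close> and \<open>a\<close>; the second step, which also uses that \<open>b z3 - v z3 b\<close>
  vanishes in the quotient, gives the one between \<open>z3\<close> and \<open>z2\<close>.
\<close>

context
  fixes a b z2 z3 :: "'b::monoid_add \<Rightarrow>\<^sub>0 'k::field" and u v c :: 'k
  assumes uv: "u * v = 1" and c: "c \<noteq> 0"
    and z2: "z2 = a * b - scl v (b * a)" and z3: "z3 = scl (1 / c) (z2 * b - b * z2)"
begin

lemma vu_simps: "v * u = 1" "v * (u * w) = w" "u * (v * w) = w" "u \<noteq> 0" "v \<noteq> 0"
  using uv by (auto simp: mult.commute[of v u] simp flip: mult.assoc)

lemma ba: "b * a = scl u (a * b) - scl u z2"
  using vu_simps uv by (simp add: z2)

lemma bz2: "b * z2 = z2 * b - scl c z3"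
  using c by (simp add: z3)

lemma serre1_identity:
  "z2 * a - scl v (a * z2) = scl (- v) (a ^ 2 * b - scl (u + v) (a * b * a) + b * a ^ 2)"
  by (simp add: z2 uv vu_simps algebra_simps power2_eq_square scl_add_left scl_minus_left)

lemma serre2_identity:
  "b * z3 - scl v (z3 * b) = scl (v / c) (b ^ 3 * a - scl (u + 1 + v) (b ^ 2 * a * b)
     + scl (u + 1 + v) (b * a * b ^ 2) - a * b ^ 3)"
  by (simp add: z3 z2 uv vu_simps algebra_simps power2_eq_square power3_eq_cube scl_add_left
      scl_minus_left add_divide_distrib)

lemma z3_a_identity:
  "scl u ((z2 * a - scl v (a * z2)) * b) - b * (z2 * a - scl v (a * z2))
     = scl c (z3 * a - a * z3) - scl (1 - u) (z2 * z2)"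
proof -
  have bw: "b * (z2 * w) = z2 * (b * w) - scl c (z3 * w)" "b * (a * w) = scl u (a * (b * w)) - scl u (z2 * w)" for w
    using arg_cong[OF bz2, of "\<lambda>t. t * w"] arg_cong[OF ba, of "\<lambda>t. t * w"]
    by (simp_all add: algebra_simps)
  then show ?thesis
    by (simp add: bw algebra_simps ba bz2 uv vu_simps scl_diff_left)
qed

lemma z3_z2_identity:
  defines "t \<equiv> scl c (z3 * a - a * z3) - scl (1 - u) (z2 * z2)" and "d \<equiv> b * z3 - scl v (z3 * b)"
  shows "b * t - t * b - scl c (d * a - scl u (a * d)) = scl c (z2 * z3 - scl u (z3 * z2))"
proof -
  have bz3: "b * z3 = scl v (z3 * b) + d" by (simp add: d_def)
  have bw: "b * (z2 * w) = z2 * (b * w) - scl c (z3 * w)" "b * (a * w) = scl u (a * (b * w)) - scl u (z2 * w)"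
    "b * (z3 * w) = scl v (z3 * (b * w)) + d * w" for w
    using arg_cong[OF bz2, of "\<lambda>t. t * w"] arg_cong[OF ba, of "\<lambda>t. t * w"] arg_cong[OF bz3, of "\<lambda>t. t * w"]
    by (simp_all add: algebra_simps)
  then show ?thesis unfolding t_def
    by (simp add: bw algebra_simps ba bz2 bz3 uv vu_simps scl_diff_left)
qed

end

section \<open>The free algebra\<close>

lemma free_algebra_simps [simp]:
  "carrier free_algebra = UNIV" "mult free_algebra = (*)" "one free_algebra = 1"
  "zero free_algebra = 0" "add free_algebra = (+)" "smult free_algebra = scl"
  by (simp_all add: free_algebra_def scl_def fun_eq_iff)

lemma free_kalgebra: "kalgebra (free_algebra :: ('k::field, ('g, 'k) nc_poly) module)"
proof (intro kalgebra.intro class_moduleI kalgebra_axioms.intro)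
  let ?F = "free_algebra :: ('k, ('g, 'k) nc_poly) module"
  show ab: "abelian_group ?F"
    by (rule abelian_groupI) (auto simp: add.assoc add.commute intro: exI[of _ "- _"] left_minus)
  show "Ring.ring ?F"
    by (rule ringI[OF ab]) (auto intro!: monoidI simp: algebra_simps)
qed (simp_all add: scl_add_left)

context quantum_torus
begin

definition word_value :: "('g \<Rightarrow> 'k torus) \<Rightarrow> 'g free_monoid \<Rightarrow> 'k torus" where
  "word_value \<phi> w = (case w of Word gs \<Rightarrow> foldr (\<lambda>g. tmul (\<phi> g)) gs (mono 0 0))"

definition eval_nc :: "('g \<Rightarrow> 'k torus) \<Rightarrow> ('g, 'k) nc_poly \<Rightarrow> 'k torus" where
  "eval_nc \<phi> f = (\<Sum>w\<in>keys f. scl (lookup f w) (word_value \<phi> w))"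

lemma eval_nc_add: "eval_nc \<phi> (f + g) = eval_nc \<phi> f + eval_nc \<phi> g"
proof -
  let ?A = "keys f \<union> keys g" and ?e = "\<lambda>f w. scl (lookup f w) (word_value \<phi> w)"
  have *: "eval_nc \<phi> h = (\<Sum>w\<in>?A. ?e h w)" if "keys h \<subseteq> ?A" for h
    unfolding eval_nc_def using that by (intro sum.mono_neutral_left) (auto simp: in_keys_iff)
  have "eval_nc \<phi> (f + g) = (\<Sum>w\<in>?A. ?e (f + g) w)" by (rule *) (rule keys_add)
  also have "\<dots> = (\<Sum>w\<in>?A. ?e f w) + (\<Sum>w\<in>?A. ?e g w)"
    by (simp only: lookup_add scl_add_left sum.distrib)
  finally show ?thesis using *[of f] *[of g] by simp
qed

lemma eval_nc_single: "eval_nc \<phi> (single w c) = scl c (word_value \<phi> w)"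
  by (simp add: eval_nc_def)

lemma eval_nc_0 [simp]: "eval_nc \<phi> 0 = 0"
  by (simp add: eval_nc_def)

lemma eval_nc_scl: "eval_nc \<phi> (scl c f) = scl c (eval_nc \<phi> f)"
  by (induction f rule: poly_mapping_add_induct) (simp_all add: eval_nc_add eval_nc_single)

lemma word_value_add:
  "word_value \<phi> (w + w') = word_value \<phi> w \<star> word_value \<phi> w'"
proof (cases w; cases w')
  fix gs gs' assume w: "w = Word gs" "w' = Word gs'"
  show ?thesis unfolding w
    by (induction gs) (simp_all add: word_value_def tmul_assoc)
qed

lemma eval_nc_mult: "eval_nc \<phi> (f * g) = eval_nc \<phi> f \<star> eval_nc \<phi> g"
proof (induction f rule: poly_mapping_add_induct)
  case (add w c f)
  have "eval_nc \<phi> (single w c * g) = eval_nc \<phi> (single w c) \<star> eval_nc \<phi> g"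
    by (induction g rule: poly_mapping_add_induct)
      (simp_all add: distrib_left mult_single eval_nc_add eval_nc_single word_value_add tmul_simps mult.commute)
  with add show ?case by (simp add: distrib_right eval_nc_add tmul_simps)
qed simp

lemma eval_nc_one: "eval_nc \<phi> 1 = mono 0 0"
proof -
  have "word_value \<phi> 0 = mono 0 0" by (simp add: word_value_def zero_free_monoid_def)
  then show ?thesis using eval_nc_single[of \<phi> 0 1] by simp
qed

lemma eval_nc_var: "eval_nc \<phi> (nc_var g) = \<phi> g"
  by (simp add: nc_var_def eval_nc_single word_value_def)

lemma eval_nc_diff: "eval_nc \<phi> (f - g) = eval_nc \<phi> f - eval_nc \<phi> g"
  using eval_nc_add[of \<phi> "f - g" g] by simp

lemma eval_nc_power: "eval_nc \<phi> (f ^ n) = eval_nc \<phi> f \<up> n"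
  by (induction n) (simp_all add: eval_nc_one eval_nc_mult)

lemma eval_nc_sum: "eval_nc \<phi> (sum f A) = (\<Sum>i\<in>A. eval_nc \<phi> (f i))"
  by (induction A rule: infinite_finite_induct) (simp_all add: eval_nc_add)

lemma eval_nc_hom: "torus_hom free_algebra (eval_nc \<phi>)"
  by (simp add: torus_hom_def eval_nc_add eval_nc_mult eval_nc_scl eval_nc_one)

end

lemma nc_poly_word_induct:
  fixes f :: "('g, 'k::field) nc_poly"
  assumes "P 1" "\<And>f g. P f \<Longrightarrow> P g \<Longrightarrow> P (f + g)" "\<And>c f. P f \<Longrightarrow> P (scl c f)"
    "\<And>g f. P f \<Longrightarrow> P (nc_var g * f)"
  shows "P f"
proof (induction f rule: poly_mapping_add_induct)
  case zero
  show ?case using assms(3)[of 1 0] assms(1) by simp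
next
  case (add w c f)
  obtain gs where w: "w = Word gs" by (cases w)
  have "P (single (Word gs) (1 :: 'k))"
  proof (induction gs)
    case Nil
    show ?case using assms(1) by (simp flip: zero_free_monoid_def)
  next
    case (Cons g gs)
    then show ?case using assms(4)[of "single (Word gs) 1" g] by (simp add: nc_var_def mult_single)
  qed
  from assms(3)[OF this, of c] add assms(2) show ?case by (simp add: w)
qed

section \<open>The quotient algebra inside the quantum torus\<close>

locale Uq_quotient =
  fixes q \<alpha> \<beta> :: "'k::field_char_0"
  assumes q_nonzero: "q \<noteq> 0" and q_generic: "\<forall>n::nat. n > 0 \<longrightarrow> q ^ n \<noteq> 1"
    and \<alpha>\<beta>: "\<alpha> \<noteq> 0 \<or> \<beta> \<noteq> 0"
begin

definition u where "u = q ^ 2"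
definition v where "v = inverse q ^ 2"
definition c where "c = q + inverse q"

lemma q_facts: "u * v = 1" "v \<noteq> 0" "c \<noteq> 0" "q ^ 2 \<noteq> 1" "1 + q ^ 2 \<noteq> 0" "c * q = q ^ 2 + 1"
proof -
  show "u * v = 1" "v \<noteq> 0" using q_nonzero by (simp_all add: u_def v_def field_simps)
  show q2: "q ^ 2 \<noteq> 1" using q_generic by simp
  have "q ^ 4 \<noteq> 1" using q_generic by simp
  moreover have "q ^ 4 - 1 = (q ^ 2 - 1) * (1 + q ^ 2)"
    by (simp add: algebra_simps power2_eq_square power4_eq_xxxx)
  ultimately show q3: "1 + q ^ 2 \<noteq> 0" by auto
  show cq: "c * q = q ^ 2 + 1" using q_nonzero by (simp add: c_def field_simps power2_eq_square)
  show "c \<noteq> 0" using cq q3 by (auto simp: add.commute)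
qed

text \<open>The last two identities normalize \<open>E\<^sub>3\<close> and \<open>E\<^sub>2\<close>: in the torus, \<open>x E\<^sub>4 - E\<^sub>4 x = p\<^sub>3 (v - 1) y\<close> and
  \<open>E\<^sub>1 E\<^sub>4 - v E\<^sub>4 E\<^sub>1 = p\<^sub>3 p\<^sub>4 (v - v\<^sup>3) x\<close>.\<close>

lemma p_facts: "p3 q \<noteq> 0" "p4 q \<noteq> 0" "p3 q * (v - 1) = c" "p3 q * p4 q * (v - v ^ 3) = 1"
proof -
  have d: "q ^ 2 - 1 \<noteq> 0" "1 + q ^ 2 \<noteq> 0" using q_facts by simp_all
  have n: "- (q ^ 3 + q) = - (q * (1 + q ^ 2))" by (simp add: algebra_simps power2_eq_square power3_eq_cube)
  show "p3 q \<noteq> 0" unfolding p3_def n using d q_nonzero by simp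
  show "p4 q \<noteq> 0" unfolding p4_def using d q_nonzero by simp
  have v1: "v - 1 = - (q ^ 2 - 1) / q ^ 2" using q_nonzero by (simp add: v_def field_simps)
  show "p3 q * (v - 1) = c" unfolding p3_def n v1 using d q_nonzero
    by (simp add: c_def field_simps power2_eq_square)
  have v3: "v - v ^ 3 = (q ^ 2 - 1) * (1 + q ^ 2) / q ^ 6"
    using q_nonzero by (simp add: v_def field_simps eval_nat_numeral)
  show "p3 q * p4 q * (v - v ^ 3) = 1" unfolding p3_def n p4_def v3 using d q_nonzero
    by (simp add: divide_simps) (simp add: algebra_simps eval_nat_numeral)
qed

sublocale T: rank_two v 2 1 \<alpha> "- p4 q" \<beta> "- p3 q"
proof
  have pos: "v ^ n \<noteq> 1" if "n > 0" for n :: nat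
  proof
    assume "v ^ n = 1"
    have "u ^ n * v ^ n = 1" using q_facts(1) by (simp flip: power_mult_distrib)
    then have "q ^ (2 * n) = 1" using \<open>v ^ n = 1\<close> by (simp add: u_def power_mult)
    then show False using q_generic that by simp
  qed
  show "v powi k \<noteq> 1" if "k \<noteq> 0" for k
  proof (cases "k > 0")
    case True
    then show ?thesis using pos[of "nat k"] by (simp add: power_int_def)
  next
    case False
    then show ?thesis using pos[of "nat (- k)"] that by (simp add: power_int_def power_inverse)
  qed
qed (use q_facts p_facts in auto)

\<comment> \<open>The exponent \<open>s = 1\<close> is a parameter of constants such as \<open>T.e4\<close> and must not become \<^term>\<open>Suc 0\<close>.\<close>
declare One_nat_def [simp del]

lemma e_values: "T.e1 = single (0, -1) \<alpha> + single (2, -1) (- p4 q)"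
  "T.e4 = single (-1, 0) \<beta> + single (-1, 1) (- p3 q)"
  by (simp_all add: T.e1_def T.e4_def)

abbreviation "F \<equiv> free_algebra :: ('k, (gen, 'k) nc_poly) module"
abbreviation "J \<equiv> serre_ideal q"
abbreviation "U \<equiv> Uq_plus q"
definition "K = Idl\<^bsub>U\<^esub> {chi1 q \<ominus>\<^bsub>U\<^esub> \<alpha> \<odot>\<^bsub>U\<^esub> \<one>\<^bsub>U\<^esub>, chi2 q \<ominus>\<^bsub>U\<^esub> \<beta> \<odot>\<^bsub>U\<^esub> \<one>\<^bsub>U\<^esub>}"
abbreviation "B \<equiv> B_quot q \<alpha> \<beta>"

text \<open>Representatives in the free algebra of \<open>E\<^sub>1, \<dots>, E\<^sub>4\<close> and of the two central relations.\<close>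

definition n1 :: "(gen, 'k) nc_poly" where "n1 = nc_var Gen1"
definition n4 :: "(gen, 'k) nc_poly" where "n4 = nc_var Gen4"
definition n2 :: "(gen, 'k) nc_poly" where "n2 = n1 * n4 - scl v (n4 * n1)"
definition n3 :: "(gen, 'k) nc_poly" where "n3 = scl (1 / c) (n2 * n4 - n4 * n2)"

definition r1 :: "(gen, 'k) nc_poly" where "r1 = n1 * n3 + scl (p4 q) (n2 * n2) - scl \<alpha> 1"
definition r2 :: "(gen, 'k) nc_poly" where "r2 = n2 * n4 + scl (p3 q) n3 - scl \<beta> 1"

sublocale F: kalgebra F
  by (rule free_kalgebra)

lemma F_minus [simp]: "f \<ominus>\<^bsub>F\<^esub> g = f - g"
  using F.A_simps(6)[of g] by (simp add: a_minus_def scl_minus_left)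

lemma J_ideal: "ideal J F"
  unfolding serre_ideal_def by (rule F.genideal_ideal) simp

lemma U_eq: "U = quot F J"
  by (simp add: Uq_plus_def)

sublocale U: kalgebra U
  unfolding U_eq by (rule F.quot_kalgebra[OF J_ideal])

definition \<pi>1 :: "(gen, 'k) nc_poly \<Rightarrow> (gen, 'k) nc_poly set" where "\<pi>1 f = J +>\<^bsub>F\<^esub> f"

lemma \<pi>1_simps:
  "\<pi>1 f \<oplus>\<^bsub>U\<^esub> \<pi>1 g = \<pi>1 (f + g)" "\<pi>1 f \<otimes>\<^bsub>U\<^esub> \<pi>1 g = \<pi>1 (f * g)" "e \<odot>\<^bsub>U\<^esub> \<pi>1 f = \<pi>1 (scl e f)"
  "\<pi>1 f \<ominus>\<^bsub>U\<^esub> \<pi>1 g = \<pi>1 (f - g)" "\<one>\<^bsub>U\<^esub> = \<pi>1 1" "\<pi>1 f \<in> carrier U" "\<pi>1 f = \<zero>\<^bsub>U\<^esub> \<longleftrightarrow> f \<in> J"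
  using F.quot_coset_simps[OF J_ideal, of f g] unfolding \<pi>1_def U_eq by simp_all

lemma \<pi>1_surj: "X \<in> carrier U \<Longrightarrow> \<exists>f. X = \<pi>1 f"
  by (auto simp: U_eq \<pi>1_def A_RCOSETS_def')

lemma E_eq: "E1 q = \<pi>1 n1" "E4 q = \<pi>1 n4" "E2 q = \<pi>1 n2" "E3 q = \<pi>1 n3"
proof -
  show 1: "E1 q = \<pi>1 n1" "E4 q = \<pi>1 n4" by (simp_all add: E1_def E4_def \<pi>1_def n1_def n4_def)
  show 2: "E2 q = \<pi>1 n2" by (simp add: E2_def 1 \<pi>1_simps n2_def v_def)
  show "E3 q = \<pi>1 n3" by (simp add: E3_def 1 2 \<pi>1_simps n3_def c_def)
qed

lemma gens_eq: "chi1 q \<ominus>\<^bsub>U\<^esub> \<alpha> \<odot>\<^bsub>U\<^esub> \<one>\<^bsub>U\<^esub> = \<pi>1 r1" "chi2 q \<ominus>\<^bsub>U\<^esub> \<beta> \<odot>\<^bsub>U\<^esub> \<one>\<^bsub>U\<^esub> = \<pi>1 r2"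
  by (simp_all add: chi1_def chi2_def E_eq \<pi>1_simps r1_def r2_def)

lemma K_ideal: "ideal K U"
  unfolding K_def gens_eq by (rule U.genideal_ideal) (simp add: \<pi>1_simps)

lemma B_eq: "B = quot U K"
  by (simp add: B_quot_def K_def)

sublocale B: kalgebra B
  unfolding B_eq by (rule U.quot_kalgebra[OF K_ideal])

definition \<pi> :: "(gen, 'k) nc_poly \<Rightarrow> (gen, 'k) nc_poly set set" where "\<pi> f = K +>\<^bsub>U\<^esub> \<pi>1 f"

lemma \<pi>_zero_iff: "\<pi> f = \<zero>\<^bsub>B\<^esub> \<longleftrightarrow> \<pi>1 f \<in> K"
  unfolding \<pi>_def B_eq by (rule U.quot_coset_simps(7)[OF K_ideal]) (rule \<pi>1_simps)+

lemma \<pi>_closed: "\<pi> f \<in> carrier B"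
  unfolding \<pi>_def B_eq by (rule U.quot_coset_simps(6)[OF K_ideal]) (rule \<pi>1_simps)+

lemma \<pi>_surj: "X \<in> carrier B \<Longrightarrow> \<exists>f. X = \<pi> f"
  using \<pi>1_surj by (fastforce simp: B_eq \<pi>_def A_RCOSETS_def')

text \<open>The noncommutative polynomials that vanish in \<open>B\<close>. Working modulo \<open>Rel\<close> replaces computing with
  cosets of cosets.\<close>

definition Rel :: "(gen, 'k) nc_poly set" where "Rel = {f. \<pi>1 f \<in> K}"

lemma Rel_closed:
  "0 \<in> Rel" "f \<in> Rel \<Longrightarrow> g \<in> Rel \<Longrightarrow> f + g \<in> Rel"
  "f \<in> Rel \<Longrightarrow> g * f \<in> Rel" "f \<in> Rel \<Longrightarrow> f * g \<in> Rel" "f \<in> J \<Longrightarrow> f \<in> Rel" "r1 \<in> Rel" "r2 \<in> Rel"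
proof -
  interpret K: ideal K U by (rule K_ideal)
  interpret J: ideal J F by (rule J_ideal)
  show J: "f \<in> J \<Longrightarrow> f \<in> Rel" for f
    using \<pi>1_simps(7)[of f] K.zero_closed by (simp add: Rel_def)
  show "0 \<in> Rel" using J J.zero_closed by simp
  show "f \<in> Rel \<Longrightarrow> g \<in> Rel \<Longrightarrow> f + g \<in> Rel"
    using K.a_closed[of "\<pi>1 f" "\<pi>1 g"] by (simp add: Rel_def \<pi>1_simps)
  show "f \<in> Rel \<Longrightarrow> g * f \<in> Rel" "f \<in> Rel \<Longrightarrow> f * g \<in> Rel"
    using K.I_l_closed[of "\<pi>1 f" "\<pi>1 g"] K.I_r_closed[of "\<pi>1 f" "\<pi>1 g"]
    by (simp_all add: Rel_def \<pi>1_simps)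
  have "{\<pi>1 r1, \<pi>1 r2} \<subseteq> K" unfolding K_def gens_eq by (rule U.genideal_self) (simp add: \<pi>1_simps)
  then show "r1 \<in> Rel" "r2 \<in> Rel" by (simp_all add: Rel_def)
qed

lemma Rel_scl: "f \<in> Rel \<Longrightarrow> scl e f \<in> Rel"
  using Rel_closed(3)[of f "scl e 1"] by simp

lemma Rel_diff: "f \<in> Rel \<Longrightarrow> g \<in> Rel \<Longrightarrow> f - g \<in> Rel"
  using Rel_closed(2)[of f "scl (-1) g"] Rel_scl[of g "-1"] by (simp add: scl_minus_left)

lemma serre_eq: "scl (- v) (serre1 q) = n2 * n1 - scl v (n1 * n2)"
  "scl (v / c) (serre2 q) = n4 * n3 - scl v (n3 * n4)"
  using serre1_identity[OF q_facts(1,3) n2_def n3_def] serre2_identity[OF q_facts(1,3) n2_def n3_def]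
  by (simp_all add: serre1_def serre2_def Let_def n1_def n4_def u_def v_def)

lemma serre_J: "serre1 q \<in> J" "serre2 q \<in> J"
  using F.genideal_self[of "{serre1 q, serre2 q}"] by (simp_all add: serre_ideal_def)

lemma rel_12: "n2 * n1 - scl v (n1 * n2) \<in> Rel" and rel_34: "n4 * n3 - scl v (n3 * n4) \<in> Rel"
  using serre_J unfolding serre_eq[symmetric] by (auto intro: Rel_scl Rel_closed(5))

lemma rel_13: "scl c (n3 * n1 - n1 * n3) - scl (1 - u) (n2 * n2) \<in> Rel"
  unfolding z3_a_identity[OF q_facts(1,3) n2_def n3_def, symmetric]
  by (intro Rel_diff Rel_scl Rel_closed(3,4) rel_12)

lemma rel_23: "n3 * n2 - scl v (n2 * n3) \<in> Rel"
proof -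
  have "scl c (n2 * n3 - scl u (n3 * n2)) \<in> Rel"
    unfolding z3_z2_identity[OF q_facts(1,3) n2_def n3_def, symmetric]
    by (intro Rel_diff Rel_scl Rel_closed(3,4) rel_13 rel_34)
  then have "scl (- v / c) (scl c (n2 * n3 - scl u (n3 * n2))) \<in> Rel" by (rule Rel_scl)
  moreover have "scl (- v / c) (scl c (n2 * n3 - scl u (n3 * n2))) = n3 * n2 - scl v (n2 * n3)"
    using q_facts by (simp add: scl_minus_left mult.commute[of v u])
  ultimately show ?thesis by simp
qed

sublocale fan_relations Rel n1 n2 n3 n4 \<alpha> \<beta> "- p4 q" "- p3 q" "- p3 q - c" v v v u "- u"
proof
  show "n4 * n1 - (scl u (n1 * n4) + scl (- u) n2) \<in> Rel"
    using Rel_closed(1) ba[OF q_facts(1,3) n2_def n3_def] by (simp add: scl_minus_left)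
  have 24: "n2 * n4 - (scl \<beta> 1 + scl (- p3 q) n3) = r2" by (simp add: r2_def scl_minus_left)
  then show "n2 * n4 - (scl \<beta> 1 + scl (- p3 q) n3) \<in> Rel" using Rel_closed(7) by simp
  have "n4 * n2 - (scl \<beta> 1 + scl (- p3 q - c) n3) = r2"
    using bz2[OF q_facts(1,3) n2_def n3_def] by (simp add: r2_def scl_minus_left scl_diff_left)
  then show "n4 * n2 - (scl \<beta> 1 + scl (- p3 q - c) n3) \<in> Rel" using Rel_closed(7) by simp
  have "n1 * n3 - (scl \<alpha> 1 + scl (- p4 q) (n2 * n2)) = r1" by (simp add: r1_def scl_minus_left)
  then show "n1 * n3 - (scl \<alpha> 1 + scl (- p4 q) (n2 * n2)) \<in> Rel" using Rel_closed(6) by simp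
qed (use Rel_closed q_facts rel_12 rel_34 rel_23 in auto)

lemma in_W: "f \<in> W"
proof (induction f rule: nc_poly_word_induct)
  case (4 g f)
  then show ?case using W_closed[of f] by (cases g) (simp_all add: n1_def n4_def)
qed (auto intro: one_W W.add W.scl)

definition gen_value :: "gen \<Rightarrow> 'k torus" where
  "gen_value g = (case g of Gen1 \<Rightarrow> T.e1 | Gen4 \<Rightarrow> T.e4)"

abbreviation "\<Phi> \<equiv> T.eval_nc gen_value"

notation T.tmul (infixl \<open>\<star>\<close> 70)

lemma \<Phi>_gens: "\<Phi> n1 = T.e1" "\<Phi> n4 = T.e4" "\<Phi> n2 = T.x" "\<Phi> n3 = T.y"
proof -
  show 1: "\<Phi> n1 = T.e1" "\<Phi> n4 = T.e4" by (simp_all add: n1_def n4_def T.eval_nc_var gen_value_def)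
  have "T.e1 \<star> T.e4 - scl v (T.e4 \<star> T.e1) = single (1, 0) (p3 q * p4 q * (v - v ^ 3))"
  proof (rule poly_mapping_eqI)
    have v3: "v * v powi 2 = v ^ 3" by (simp add: power2_eq_square power3_eq_cube)
    show "lookup (T.e1 \<star> T.e4 - scl v (T.e4 \<star> T.e1)) k
        = lookup (single (1, 0) (p3 q * p4 q * (v - v ^ 3))) k" for k
      unfolding e_values T.tmul_add_left T.tmul_add_right T.tmul_single
      by (auto simp: lookup_add lookup_minus lookup_single when_def right_diff_distrib v3[symmetric])
  qed
  then show 2: "\<Phi> n2 = T.x"
    by (simp add: n2_def T.eval_nc_diff T.eval_nc_mult T.eval_nc_scl 1 p_facts)
  have "T.x \<star> T.e4 - T.e4 \<star> T.x = single (0, 1) (p3 q * (v - 1))"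
  proof (rule poly_mapping_eqI)
    show "lookup (T.x \<star> T.e4 - T.e4 \<star> T.x) k = lookup (single (0, 1) (p3 q * (v - 1))) k" for k
      unfolding e_values T.tmul_add_left T.tmul_add_right T.tmul_single
      by (auto simp: lookup_add lookup_minus lookup_single when_def right_diff_distrib)
  qed
  then have "T.x \<star> T.e4 - T.e4 \<star> T.x = single (0, 1) c" by (simp only: p_facts)
  moreover have "\<Phi> n3 = scl (1 / c) (T.x \<star> T.e4 - T.e4 \<star> T.x)"
    by (simp only: n3_def T.eval_nc_diff T.eval_nc_mult T.eval_nc_scl 1 2)
  ultimately show "\<Phi> n3 = T.y" using q_facts(3) by simp
qed

lemma \<Phi>_serre: "\<Phi> (serre1 q) = 0" "\<Phi> (serre2 q) = 0"
proof -
  have "\<Phi> (scl (- v) (serre1 q)) = 0" "\<Phi> (scl (v / c) (serre2 q)) = 0"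
    unfolding serre_eq T.eval_nc_diff T.eval_nc_mult T.eval_nc_scl \<Phi>_gens e_values
    by (simp_all add: T.tmul_simps mult_ac q_facts power_int_def)
  then have "scl (- 1 / v) (scl (- v) (\<Phi> (serre1 q))) = 0" "scl (c / v) (scl (v / c) (\<Phi> (serre2 q))) = 0"
    by (simp_all only: T.eval_nc_scl scl_simps(4))
  then show "\<Phi> (serre1 q) = 0" "\<Phi> (serre2 q) = 0" using q_facts by simp_all
qed

lemma \<Phi>_r: "\<Phi> r1 = 0" "\<Phi> r2 = 0"
  unfolding r1_def r2_def T.eval_nc_diff T.eval_nc_mult T.eval_nc_scl T.eval_nc_add T.eval_nc_one \<Phi>_gens e_values
  by (simp_all add: T.tmul_simps flip: single_add single_uminus)

text \<open>The evaluation \<open>\<Phi>\<close> kills the Serre elements and the two central relations, and hence descends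
  through both quotients.\<close>

lemma embedding: "\<exists>h. T.torus_hom B h \<and> (\<forall>f. h (\<pi> f) = \<Phi> f)"
proof -
  have "J \<subseteq> {f \<in> carrier F. \<Phi> f = 0}"
    unfolding serre_ideal_def using \<Phi>_serre
    by (intro F.genideal_minimal T.torus_hom_kernel_ideal free_kalgebra T.eval_nc_hom) auto
  then have J0: "\<Phi> f = 0" if "f \<in> J" for f using that by auto
  obtain h1 where h1: "T.torus_hom U h1" "\<And>f. h1 (\<pi>1 f) = \<Phi> f"
    using T.torus_hom_quot[OF free_kalgebra J_ideal T.eval_nc_hom J0] unfolding U_eq \<pi>1_def
    by (metis UNIV_I free_algebra_simps(1))
  have "K \<subseteq> {X \<in> carrier U. h1 X = 0}"
    unfolding K_def gens_eq using \<Phi>_r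
    by (intro U.genideal_minimal T.torus_hom_kernel_ideal U.kalgebra_axioms h1(1)) (auto simp: h1(2) \<pi>1_simps)
  then have K0: "h1 X = 0" if "X \<in> K" for X using that by auto
  obtain h where "T.torus_hom B h" "\<And>X. X \<in> carrier U \<Longrightarrow> h (K +>\<^bsub>U\<^esub> X) = h1 X"
    using T.torus_hom_quot[OF U.kalgebra_axioms K_ideal h1(1) K0] unfolding B_eq by metis
  then show ?thesis using h1(2) \<pi>1_simps(6) unfolding \<pi>_def by (intro exI[of _ h]) simp
qed

lemma \<Phi>_Fan: "\<Phi> (Fan m n) = T.Mon m n"
  by (simp add: Fan_def T.Mon_def T.eval_nc_mult T.eval_nc_power \<Phi>_gens)

lemma \<Phi>_Rel:
  assumes "f \<in> Rel"
  shows "\<Phi> f = 0"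
proof -
  obtain h where h: "T.torus_hom B h" "\<And>f. h (\<pi> f) = \<Phi> f" using embedding by blast
  have "\<pi> f = \<zero>\<^bsub>B\<^esub>" using assms by (simp add: \<pi>_zero_iff Rel_def)
  then show ?thesis using h(2)[of f] T.torus_hom_zero[OF B.kalgebra_axioms h(1)] by simp
qed

text \<open>Modulo \<open>Rel\<close>, \<open>f\<close> is a combination of fan monomials, and its image under \<open>\<Phi>\<close> is the same combination
  of linearly independent elements.\<close>

lemma Rel_if_\<Phi>_zero:
  assumes "\<Phi> f = 0"
  shows "f \<in> Rel"
proof -
  obtain d :: "int \<times> int \<Rightarrow>\<^sub>0 'k"
    where d: "f - (\<Sum>i\<in>keys d. scl (lookup d i) (Fan (fst i) (snd i))) \<in> Rel"
    using W_expansion[OF in_W] by blast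
  from \<Phi>_Rel[OF d] assms have "(\<Sum>(m, n)\<in>keys d. scl (lookup d (m, n)) (T.Mon m n)) = 0"
    by (simp add: T.eval_nc_diff T.eval_nc_sum T.eval_nc_scl \<Phi>_Fan case_prod_beta)
  from T.Mon_independent[OF \<alpha>\<beta> finite_keys this] have "keys d = {}"
    by blast
  with d show ?thesis by simp
qed

lemma range_\<Phi>: "range \<Phi> = T.S"
proof (intro equalityI subsetI)
  fix t assume "t \<in> range \<Phi>"
  then obtain f where "t = \<Phi> f" by blast
  moreover have "\<Phi> f \<in> T.S"
  proof (induction f rule: nc_poly_word_induct)
    case (4 g f)
    then show ?case by (cases g) (simp_all add: T.eval_nc_mult T.eval_nc_var gen_value_def T.S.e1 T.S.e4)
  qed (simp_all add: T.eval_nc_one T.S.one T.eval_nc_add T.S.add T.eval_nc_scl T.S.scl)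
  ultimately show "t \<in> T.S" by simp
next
  fix t assume "t \<in> T.S"
  then show "t \<in> range \<Phi>"
  proof (induction rule: T.S.induct)
    case one
    show ?case by (rule range_eqI[of _ _ 1]) (simp add: T.eval_nc_one)
  next
    case (add a b)
    then obtain f g where "a = \<Phi> f" "b = \<Phi> g" by blast
    then show ?case by (intro range_eqI[of _ _ "f + g"]) (simp add: T.eval_nc_add)
  next
    case (scl a e)
    then obtain f where "a = \<Phi> f" by blast
    then show ?case by (intro range_eqI[of _ _ "scl e f"]) (simp add: T.eval_nc_scl)
  next
    case (e1 a)
    then obtain f where "a = \<Phi> f" by blast
    then show ?case by (intro range_eqI[of _ _ "n1 * f"]) (simp add: T.eval_nc_mult \<Phi>_gens)
  next
    case (x a)
    then obtain f where "a = \<Phi> f" by blast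
    then show ?case by (intro range_eqI[of _ _ "n2 * f"]) (simp add: T.eval_nc_mult \<Phi>_gens)
  next
    case (y a)
    then obtain f where "a = \<Phi> f" by blast
    then show ?case by (intro range_eqI[of _ _ "n3 * f"]) (simp add: T.eval_nc_mult \<Phi>_gens)
  next
    case (e4 a)
    then obtain f where "a = \<Phi> f" by blast
    then show ?case by (intro range_eqI[of _ _ "n4 * f"]) (simp add: T.eval_nc_mult \<Phi>_gens)
  qed
qed

lemma torus_algebra_B: "\<exists>h. torus_algebra v 2 1 \<alpha> (- p4 q) \<beta> (- p3 q) B h"
proof -
  obtain h where h: "T.torus_hom B h" "\<And>f. h (\<pi> f) = \<Phi> f" using embedding by blast
  have zero: "X = \<zero>\<^bsub>B\<^esub>" if "X \<in> carrier B" "h X = 0" for X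
  proof -
    obtain f where f: "X = \<pi> f" using \<pi>_surj \<open>X \<in> carrier B\<close> by blast
    then have "f \<in> Rel" using that h(2) by (intro Rel_if_\<Phi>_zero) simp
    then show ?thesis by (simp add: f \<pi>_zero_iff Rel_def)
  qed
  have "torus_algebra v 2 1 \<alpha> (- p4 q) \<beta> (- p3 q) B h"
  proof (intro torus_algebra.intro torus_algebra_axioms.intro T.rank_two_axioms B.kalgebra_axioms h(1) \<alpha>\<beta>)
    show "inj_on h (carrier B)"
    proof (rule inj_onI)
      fix X Y assume XY: "X \<in> carrier B" "Y \<in> carrier B" "h X = h Y"
      then have "h (X \<ominus>\<^bsub>B\<^esub> Y) = 0"
        using T.torus_hom_minus[OF B.kalgebra_axioms h(1)] by simp
      then have "X \<ominus>\<^bsub>B\<^esub> Y = \<zero>\<^bsub>B\<^esub>" using zero XY by simp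
      moreover have "(X \<ominus>\<^bsub>B\<^esub> Y) \<oplus>\<^bsub>B\<^esub> Y = X"
        unfolding a_minus_def using XY by (simp only: B.a_assoc B.l_neg B.a_inv_closed B.r_zero)
      ultimately show "X = Y" using XY(2) B.l_zero by simp
    qed
    have "h ` carrier B \<subseteq> range \<Phi>" by (intro image_subsetI) (metis \<pi>_surj h(2) rangeI)
    moreover have "range \<Phi> \<subseteq> h ` carrier B" by (intro image_subsetI) (metis \<pi>_closed h(2) imageI)
    ultimately have "h ` carrier B = range \<Phi>" by (rule equalityI)
    then show "h ` carrier B = T.S" by (simp add: range_\<Phi>)
  qed
  then show ?thesis by blast
qed

end

theorem theorem4p5:
  fixes q \<alpha> \<beta> :: "'k::field_char_0"
  assumes "q \<noteq> 0"
    and "\<forall>n::nat. n > 0 \<longrightarrow> q ^ n \<noteq> 1"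
    and "\<alpha> \<noteq> 0" and "\<beta> \<noteq> 0"
  shows "((\<forall>D\<in>Der (B_quot q \<alpha> \<beta>). D \<in> InnDer (B_quot q \<alpha> \<beta>))
        \<and> carrier (HH1 (B_quot q \<alpha> \<beta>)) = {\<zero>\<^bsub>HH1 (B_quot q \<alpha> \<beta>)\<^esub>})
    \<and> (vectorspace class_ring (HH1 (B_quot q \<alpha> 0))
        \<and> vectorspace.fin_dim class_ring (HH1 (B_quot q \<alpha> 0))
        \<and> vectorspace.dim class_ring (HH1 (B_quot q \<alpha> 0)) = 1)
    \<and> (vectorspace class_ring (HH1 (B_quot q 0 \<beta>))
        \<and> vectorspace.fin_dim class_ring (HH1 (B_quot q 0 \<beta>))
        \<and> vectorspace.dim class_ring (HH1 (B_quot q 0 \<beta>)) = 1)"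
proof (intro conjI)
  have ex: "\<exists>h. torus_algebra (inverse q ^ 2) 2 1 a (- p4 q) b (- p3 q) (B_quot q a b) h"
    if "a \<noteq> 0 \<or> b \<noteq> 0" for a b
  proof -
    interpret Uq_quotient q a b using assms that by unfold_locales auto
    show ?thesis using torus_algebra_B by (simp only: v_def)
  qed
  obtain h where h: "torus_algebra (inverse q ^ 2) 2 1 \<alpha> (- p4 q) \<beta> (- p3 q) (B_quot q \<alpha> \<beta>) h"
    using ex assms(3) by blast
  interpret torus_algebra "inverse q ^ 2" 2 1 \<alpha> "- p4 q" \<beta> "- p3 q" "B_quot q \<alpha> \<beta>" h by (fact h)
  show "\<forall>D\<in>Der (B_quot q \<alpha> \<beta>). D \<in> InnDer (B_quot q \<alpha> \<beta>)"
    using Der_inner assms(3,4) by blast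
  show "carrier (HH1 (B_quot q \<alpha> \<beta>)) = {\<zero>\<^bsub>HH1 (B_quot q \<alpha> \<beta>)\<^esub>}"
    using HH1_trivial assms(3,4) by blast
  obtain h1 where "torus_algebra (inverse q ^ 2) 2 1 \<alpha> (- p4 q) 0 (- p3 q) (B_quot q \<alpha> 0) h1"
    using ex assms(3) by blast
  then interpret A1: torus_algebra "inverse q ^ 2" 2 1 \<alpha> "- p4 q" 0 "- p3 q" "B_quot q \<alpha> 0" h1 .
  note A1.HH1_dim_one[of "(0, 1)"]
  then show "vectorspace class_ring (HH1 (B_quot q \<alpha> 0))"
    "vectorspace.fin_dim class_ring (HH1 (B_quot q \<alpha> 0))"
    "vectorspace.dim class_ring (HH1 (B_quot q \<alpha> 0)) = 1"
    using A1.S_gens(3) assms(3) by auto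
  obtain h2 where "torus_algebra (inverse q ^ 2) 2 1 0 (- p4 q) \<beta> (- p3 q) (B_quot q 0 \<beta>) h2"
    using ex assms(4) by blast
  then interpret A2: torus_algebra "inverse q ^ 2" 2 1 0 "- p4 q" \<beta> "- p3 q" "B_quot q 0 \<beta>" h2 .
  note A2.HH1_dim_one[of "(1, 0)"]
  then show "vectorspace class_ring (HH1 (B_quot q 0 \<beta>))"
    "vectorspace.fin_dim class_ring (HH1 (B_quot q 0 \<beta>))"
    "vectorspace.dim class_ring (HH1 (B_quot q 0 \<beta>)) = 1"
    using A2.S_gens(2) assms(4) by auto
qed

end
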